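(* Let $n\ge1$, $p,q>1$, and let $b\in L^1([0,\infty))$ be nonnegative. Let $u_0,v_0\in W^{1,1}_{\mathrm{loc}}(\mathbb{R}^n)$, $u_1,v_1\in L^1_{\mathrm{loc}}(\mathbb{R}^n)$ be nonnegative functions supported in $B_R$ for some $R>0$, with $u_1\ge u_0$ and $v_1$ not identically zero. Assume $$\Theta(n,p,q)\doteq\frac{1}{pq-1}-\frac{n-1}{2}\ge0.$$ Then there exist $\varepsilon_0=\varepsilon_0(n,b,p,q,R,v_1)>0$ and $C>0$ independent of $\varepsilon$ such that for every $\varepsilon\in(0,\varepsilon_0]$, whenever $(u,v)$ is a weak solution of the problem on $[0,T)$, one has $$T\le\begin{cases} C\varepsilon^{-1/\Theta(n,p,q)} & \text{if } \Theta(n,p,q)>0,\\ \exp\big(C\varepsilon^{-(pq-1)}\big) & \text{if } \Theta(n,p,q)=0.\end{cases}$$ In particular the lifespan $T(\varepsilon)$ is finite and satisfies these bounds.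
   Context: Consider, for $p,q>1$, $\varepsilon>0$ and a nonnegative function $b$ on $[0,\infty)$, the Cauchy problem $\partial_t^2u-\Delta u+\partial_tu=|\partial_tv|^p$, $\partial_t^2v-\Delta v+b(t)\partial_tv=|\partial_tu|^q$ for $t>0$, $x\in\mathbb{R}^n$, with $(u,\partial_tu,v,\partial_tv)(0,x)=\varepsilon(u_0,u_1,v_0,v_1)(x)$. Here $B_R=\{x\in\mathbb{R}^n:|x|\le R\}$. Weak solution: let $u_0,v_0\in W^{1,1}_{\mathrm{loc}}(\mathbb{R}^n)$, $u_1,v_1\in L^1_{\mathrm{loc}}(\mathbb{R}^n)$ with supports in $B_R$. A pair $(u,v)$ is a weak solution on $[0,T)$ if $u,v\in C([0,T);W^{1,1}_{\mathrm{loc}}(\mathbb{R}^n))\cap C^1([0,T);L^1_{\mathrm{loc}}(\mathbb{R}^n))$ with $\partial_tu\in L^q_{\mathrm{loc}}([0,T)\times\mathbb{R}^n)$, $\partial_tv\in L^p_{\mathrm{loc}}([0,T)\times\mathbb{R}^n)$, $\mathrm{supp}\,(u,v)(t,\cdot)\subset B_{R+t}$ for all $t\in(0,T)$, $u(0,\cdot)=\varepsilon u_0$, $v(0,\cdot)=\varepsilon v_0$ in $L^1_{\mathrm{loc}}$, and for all $t\in(0,T)$ and all $\phi,\psi\in C_0^\infty([0,T)\times\mathbb{R}^n)$: $\int_0^t\!\int_{\mathbb{R}^n}(-\partial_su\,\partial_s\phi+\partial_su\,\phi+\nabla u\cdot\nabla\phi)\,dx\,ds+\int_{\mathbb{R}^n}\partial_tu(t,x)\phi(t,x)\,dx=\varepsilon\int_{\mathbb{R}^n}u_1\phi(0,x)\,dx+\int_0^t\!\int_{\mathbb{R}^n}|\partial_sv|^p\phi\,dx\,ds$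 and $\int_0^t\!\int_{\mathbb{R}^n}(-\partial_sv\,\partial_s\psi+\nabla v\cdot\nabla\psi+b(s)\partial_sv\,\psi)\,dx\,ds+\int_{\mathbb{R}^n}\partial_tv(t,x)\psi(t,x)\,dx=\varepsilon\int_{\mathbb{R}^n}v_1\psi(0,x)\,dx+\int_0^t\!\int_{\mathbb{R}^n}|\partial_su|^q\psi\,dx\,ds$. *)

theory Defs
  imports "HOL-Analysis.Analysis"
begin

definition loc_L1 :: "('a::euclidean_space \<Rightarrow> real) \<Rightarrow> bool" where
  "loc_L1 f \<longleftrightarrow> (\<forall>K. compact K \<longrightarrow> set_integrable lborel K f)"

definition partial_dir :: "'a::euclidean_space \<Rightarrow> ('a \<Rightarrow> real) \<Rightarrow> 'a \<Rightarrow> real" where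
  "partial_dir b f x = deriv (\<lambda>s. f (x + s *\<^sub>R b)) 0"

fun iter_partial :: "'a::euclidean_space list \<Rightarrow> ('a \<Rightarrow> real) \<Rightarrow> 'a \<Rightarrow> real" where
  "iter_partial [] f = f"
| "iter_partial (b # bs) f = partial_dir b (iter_partial bs f)"

definition smooth_fun :: "('a::euclidean_space \<Rightarrow> real) \<Rightarrow> bool" where
  "smooth_fun f \<longleftrightarrow> (\<forall>bs. set bs \<subseteq> Basis \<longrightarrow>
      continuous_on UNIV (iter_partial bs f) \<and>
      (\<forall>b\<in>Basis. \<forall>x. (\<lambda>s. iter_partial bs f (x + s *\<^sub>R b)) differentiable (at 0)))"

definition test_fun :: "('a::euclidean_space \<Rightarrow> real) \<Rightarrow> bool" where
  "test_fun \<phi> \<longleftrightarrow> smooth_fun \<phi> \<and> (\<exists>r. \<forall>x. norm x > r \<longrightarrow> \<phi> x = 0)"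

definition st_test_fun :: "real \<Rightarrow> (real \<times> 'a::euclidean_space \<Rightarrow> real) \<Rightarrow> bool" where
  "st_test_fun T \<phi> \<longleftrightarrow> smooth_fun \<phi> \<and>
     (\<exists>T' r. T' < T \<and> (\<forall>s x. (s \<ge> T' \<or> norm x > r) \<longrightarrow> \<phi> (s, x) = 0))"

definition weak_grad :: "('a::euclidean_space \<Rightarrow> real) \<Rightarrow> ('a \<Rightarrow> 'a) \<Rightarrow> bool" where
  "weak_grad f g \<longleftrightarrow> loc_L1 f \<and> (\<forall>b\<in>Basis. loc_L1 (\<lambda>x. g x \<bullet> b)) \<and>
     (\<forall>\<phi>. test_fun \<phi> \<longrightarrow> (\<forall>b\<in>Basis.
        (LINT x|lborel. f x * partial_dir b \<phi> x) = - (LINT x|lborel. (g x \<bullet> b) * \<phi> x)))"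

definition W11_loc :: "('a::euclidean_space \<Rightarrow> real) \<Rightarrow> bool" where
  "W11_loc f \<longleftrightarrow> (\<exists>g. weak_grad f g)"

definition dt :: "(real \<times> 'a::euclidean_space \<Rightarrow> real) \<Rightarrow> real \<times> 'a \<Rightarrow> real" where
  "dt \<phi> z = partial_dir (1, 0) \<phi> z"

definition gradx :: "(real \<times> 'a::euclidean_space \<Rightarrow> real) \<Rightarrow> real \<times> 'a \<Rightarrow> 'a" where
  "gradx \<phi> z = (\<Sum>b\<in>Basis. partial_dir (0, b) \<phi> z *\<^sub>R b)"

definition Theta :: "nat \<Rightarrow> real \<Rightarrow> real \<Rightarrow> real" where
  "Theta n p q = 1 / (p * q - 1) - (real n - 1) / 2"

definition weak_solution ::
  "(real \<Rightarrow> real) \<Rightarrow> real \<Rightarrow> real \<Rightarrow> real \<Rightarrow>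
   ('a::euclidean_space \<Rightarrow> real) \<Rightarrow> ('a \<Rightarrow> real) \<Rightarrow> ('a \<Rightarrow> real) \<Rightarrow> ('a \<Rightarrow> real) \<Rightarrow>
   real \<Rightarrow> real \<Rightarrow> (real \<Rightarrow> 'a \<Rightarrow> real) \<Rightarrow> (real \<Rightarrow> 'a \<Rightarrow> real) \<Rightarrow> bool" where
  "weak_solution b p q \<epsilon> u0 u1 v0 v1 R T u v \<longleftrightarrow>
   (\<exists>ut vt gu gv.
     \<comment> \<open>u(t), v(t) in W^{1,1}_loc, ut(t), vt(t) in L^1_loc\<close>
     (\<forall>t\<in>{0..<T}. weak_grad (u t) (gu t) \<and> weak_grad (v t) (gv t) \<and>
         loc_L1 (ut t) \<and> loc_L1 (vt t)) \<and>
     \<comment> \<open>continuity into W^{1,1}_loc\<close>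
     (\<forall>t\<in>{0..<T}. \<forall>K. compact K \<longrightarrow>
        ((\<lambda>s. LINT x:K|lborel. \<bar>u s x - u t x\<bar> + norm (gu s x - gu t x)) \<longlongrightarrow> 0) (at t within {0..<T}) \<and>
        ((\<lambda>s. LINT x:K|lborel. \<bar>v s x - v t x\<bar> + norm (gv s x - gv t x)) \<longlongrightarrow> 0) (at t within {0..<T})) \<and>
     \<comment> \<open>C^1 into L^1_loc with derivatives ut, vt\<close>
     (\<forall>t\<in>{0..<T}. \<forall>K. compact K \<longrightarrow>
        ((\<lambda>s. LINT x:K|lborel. \<bar>(u s x - u t x) / (s - t) - ut t x\<bar>) \<longlongrightarrow> 0) (at t within {0..<T}) \<and>
        ((\<lambda>s. LINT x:K|lborel. \<bar>(v s x - v t x) / (s - t) - vt t x\<bar>) \<longlongrightarrow> 0) (at t within {0..<T}) \<and>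
        ((\<lambda>s. LINT x:K|lborel. \<bar>ut s x - ut t x\<bar>) \<longlongrightarrow> 0) (at t within {0..<T}) \<and>
        ((\<lambda>s. LINT x:K|lborel. \<bar>vt s x - vt t x\<bar>) \<longlongrightarrow> 0) (at t within {0..<T})) \<and>
     \<comment> \<open>ut in L^q_loc([0,T) x R^n), vt in L^p_loc([0,T) x R^n)\<close>
     (\<forall>K. compact K \<and> K \<subseteq> {0..<T} \<times> UNIV \<longrightarrow>
        set_integrable lborel K (\<lambda>(s, x). \<bar>ut s x\<bar> powr q) \<and>
        set_integrable lborel K (\<lambda>(s, x). \<bar>vt s x\<bar> powr p)) \<and>
     \<comment> \<open>support condition\<close>
     (\<forall>t\<in>{0<..<T}. AE x in lborel. norm x > R + t \<longrightarrow> u t x = 0 \<and> v t x = 0) \<and>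
     \<comment> \<open>initial data\<close>
     (AE x in lborel. u 0 x = \<epsilon> * u0 x) \<and> (AE x in lborel. v 0 x = \<epsilon> * v0 x) \<and>
     \<comment> \<open>weak formulation\<close>
     (\<forall>t\<in>{0<..<T}. \<forall>\<phi> \<psi>. st_test_fun T \<phi> \<and> st_test_fun T \<psi> \<longrightarrow>
        (LINT s:{0..t}|lborel. LINT x|lborel.
            - ut s x * dt \<phi> (s, x) + ut s x * \<phi> (s, x) + gu s x \<bullet> gradx \<phi> (s, x))
          + (LINT x|lborel. ut t x * \<phi> (t, x))
        = \<epsilon> * (LINT x|lborel. u1 x * \<phi> (0, x))
          + (LINT s:{0..t}|lborel. LINT x|lborel. \<bar>vt s x\<bar> powr p * \<phi> (s, x))
      \<and>
        (LINT s:{0..t}|lborel. LINT x|lborel.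
            - vt s x * dt \<psi> (s, x) + gv s x \<bullet> gradx \<psi> (s, x) + b s * vt s x * \<psi> (s, x))
          + (LINT x|lborel. vt t x * \<psi> (t, x))
        = \<epsilon> * (LINT x|lborel. v1 x * \<psi> (0, x))
          + (LINT s:{0..t}|lborel. LINT x|lborel. \<bar>ut s x\<bar> powr q * \<psi> (s, x))))"

end

theory Submission
  imports Defs "HOL-Computational_Algebra.Polynomial" "HOL-Probability.Distributions"
begin

text \<open>The test function is \<open>e\<^bsup>-t\<^esup> \<Phi>(x)\<close> with the single plane exponential \<open>\<Phi>(x) = exp (x \<bullet> e)\<close>, cut off
  outside the light cone. It satisfies \<open>\<Delta>\<Phi> = \<Phi>\<close>, and over the ball of radius \<open>R + t\<close> the function
  \<open>e\<^bsup>-t\<^esup> \<Phi>\<close> has integral at most a multiple of \<open>(1 + t)\<^bsup>(n-1)/2\<^esup>\<close>. Testing gives linear systems for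
  \<open>U = \<integral>u e\<^bsup>-t\<^esup>\<Phi>\<close>, \<open>U\<^sub>1 = \<integral>u\<^sub>t e\<^bsup>-t\<^esup>\<Phi>\<close> and likewise for \<open>v\<close>, driven by the nonlinear terms, which Hoelder's
  inequality bounds below by powers of \<open>U\<^sub>1\<close>, \<open>V\<^sub>1\<close>. Both systems are cooperative: \<open>V\<^sub>1\<close> dominates a constant
  times \<open>W = I \<epsilon> + \<integral>(nonlinearity)\<close>, with \<open>I\<close> the integral of \<open>v\<^sub>1 \<Phi>\<close>, while the damping lets
  \<open>U\<^sub>1\<close> retain its forcing only for a time of order one. With \<open>\<beta> = (n-1)/2\<close> this leads to
  \<open>W' \<ge> c X\<^sup>q (1+t)\<^bsup>-\<beta>(q-1)\<^esup>\<close> and \<open>X' \<ge> -\<mu> X + c W\<^sup>p (1+t)\<^bsup>-\<beta>(p-1)\<^esup>\<close>. While \<open>W\<close> is small against \<open>(1+t)\<^sup>\<beta>\<close> the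
  unit memory of \<open>X\<close> is harmless and \<open>W\<close> dominates the solution of
  \<open>w' = \<kappa> w\<^bsup>pq\<^esup> (1+t)\<^bsup>-\<beta>(pq-1)\<^esup>\<close>, which determines the lifespan; once \<open>W \<ge> M (1+t)\<^sup>\<beta>\<close>, blow-up follows
  within unit time.\<close>

subsection \<open>Smooth cutoffs and tensor-product test functions\<close>

text \<open>In differential form the averaged equations read \<open>U' = U1 - U\<close>,
  \<open>U1' = U - 2 U1 + F'\<close> and \<open>V' = V1 - V\<close>,
  \<open>V1' = V - (1 + b) V1 + G'\<close>; cooperative means that the off-diagonal coefficients are
  positive. As \<open>F\<close>, \<open>G\<close> have merely integrable densities and
  \<open>b\<close> is merely integrable, only the integrated forms are available, and the
  comparisons must not differentiate \<open>U1\<close> and \<open>V1\<close>.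

  Eliminating \<open>X\<close>, which forgets at rate \<mu>, leaves an inequality with delay:
  \<open>W'\<close> at \<open>t\<close> is bounded below through \<open>W\<close> at
  \<open>t - 1\<close>. It can be compared with the equation for \<open>w\<close> only while
  \<open>w\<close> at most doubles in unit time. As long as \<open>w\<close> stays below
  \<open>M (1+t)^\<beta>\<close>, its logarithmic derivative is at most
  \<open>\<kappa> M^(pq-1)\<close>, so a small \<kappa> achieves this; hence the split at that
  level. The equation for \<open>w\<close> is separable, and the primitive of
  \<open>(1+t)^(-\<beta>(pq-1))\<close> is a power or a logarithm according to \<Theta> > 0 or
  \<Theta> = 0.\<close>

fun times_diff :: "nat \<Rightarrow> (real \<Rightarrow> real) \<Rightarrow> bool" where
  "times_diff 0 f \<longleftrightarrow> True"
| "times_diff (Suc n) f \<longleftrightarrow> (\<exists>f'. (\<forall>x. (f has_real_derivative f' x) (at x)) \<and> times_diff n f')"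

text \<open>Smoothness is all finite orders, each with an existentially given derivative: closure
  under products and reciprocals is then an induction on the order, without computing
  \<open>deriv\<close>.\<close>

definition smooth1 :: "(real \<Rightarrow> real) \<Rightarrow> bool" where
  "smooth1 f \<longleftrightarrow> (\<forall>n. times_diff n f)"

lemma times_diff_SucI:
  "(\<And>x. (f has_real_derivative f' x) (at x)) \<Longrightarrow> times_diff n f' \<Longrightarrow> times_diff (Suc n) f"
  by auto

lemma times_diff_Suc: "times_diff (Suc n) f \<Longrightarrow> times_diff n f"
  by (induction n arbitrary: f) auto

lemma times_diff_const: "times_diff n (\<lambda>x. k)"
proof (induction n arbitrary: k)
  case (Suc n)
  show ?case using Suc[of 0] by (auto intro!: exI[of _ "\<lambda>x. 0"])
qed simp

lemma times_diff_add: "times_diff n f \<Longrightarrow> times_diff n g \<Longrightarrow> times_diff n (\<lambda>x. f x + g x)"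
proof (induction n arbitrary: f g)
  case (Suc n)
  then obtain f' g' where "\<forall>x. (f has_real_derivative f' x) (at x)" "times_diff n f'"
    "\<forall>x. (g has_real_derivative g' x) (at x)" "times_diff n g'" by auto
  then show ?case using Suc.IH by (auto intro!: exI[of _ "\<lambda>x. f' x + g' x"] DERIV_add)
qed simp

lemma times_diff_mult: "times_diff n f \<Longrightarrow> times_diff n g \<Longrightarrow> times_diff n (\<lambda>x. f x * g x)"
proof (induction n arbitrary: f g)
  case (Suc n)
  then obtain f' g' where *: "\<And>x. (f has_real_derivative f' x) (at x)" "times_diff n f'"
    "\<And>x. (g has_real_derivative g' x) (at x)" "times_diff n g'" by auto
  have "times_diff n (\<lambda>x. f' x * g x + g' x * f x)"
    using Suc.prems[THEN times_diff_Suc] * by (intro times_diff_add Suc.IH)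
  moreover have "((\<lambda>x. f x * g x) has_real_derivative f' x * g x + g' x * f x) (at x)" for x
    using DERIV_mult[OF *(1) *(3)] by simp
  ultimately show ?case by (rule times_diff_SucI[rotated])
qed simp

lemma times_diff_inverse:
  "times_diff n f \<Longrightarrow> (\<And>x. f x \<noteq> 0) \<Longrightarrow> times_diff n (\<lambda>x. inverse (f x))"
proof (induction n)
  case (Suc n)
  then obtain f' where *: "\<And>x. (f has_real_derivative f' x) (at x)" "times_diff n f'" by auto
  have i: "times_diff n (\<lambda>x. inverse (f x))" using Suc times_diff_Suc by blast
  have "times_diff n (\<lambda>x. -1 * (inverse (f x) * (f' x * inverse (f x))))"
    using i * by (intro times_diff_mult times_diff_const)
  moreover have "((\<lambda>x. inverse (f x)) has_real_derivative -1 * (inverse (f x) * (f' x * inverse (f x)))) (at x)" for x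
    using DERIV_inverse'[OF *(1)] Suc.prems(2) by (simp add: mult.assoc)
  ultimately show ?case by (rule times_diff_SucI[rotated])
qed simp

lemma times_diff_affine: "times_diff n f \<Longrightarrow> times_diff n (\<lambda>x. f (c * x + d))"
  for c d :: real
proof (induction n arbitrary: f)
  case (Suc n)
  then obtain f' where *: "\<And>x. (f has_real_derivative f' x) (at x)" "times_diff n f'" by auto
  have "((\<lambda>x. f (c * x + d)) has_real_derivative f' (c * x + d) * c) (at x)" for x
    by (rule DERIV_chain2[OF *(1)]) (auto intro!: derivative_eq_intros)
  moreover have "times_diff n (\<lambda>x. f' (c * x + d) * c)"
    using Suc.IH[OF *(2)] by (intro times_diff_mult times_diff_const)
  ultimately show ?case by (rule times_diff_SucI)
qed simp

lemma times_diff_exp: "times_diff n exp"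
  by (induction n) (auto intro: DERIV_exp)

lemma smooth1_mult: "smooth1 f \<Longrightarrow> smooth1 g \<Longrightarrow> smooth1 (\<lambda>x. f x * g x)"
  by (simp add: smooth1_def times_diff_mult)

lemma smooth1_affine: "smooth1 f \<Longrightarrow> smooth1 (\<lambda>x. f (c * x + d))"
  by (simp add: smooth1_def times_diff_affine)

lemma smooth1_exp: "smooth1 (\<lambda>x. exp (c * x))"
  using smooth1_affine[of exp c 0] by (simp add: smooth1_def times_diff_exp)

lemma smooth1_deriv:
  assumes "smooth1 f"
  shows "(f has_real_derivative deriv f x) (at x)" "smooth1 (deriv f)"
proof -
  have *: "\<exists>f'. (\<forall>x. (f has_real_derivative f' x) (at x)) \<and> times_diff n f'" for n
    using assms unfolding smooth1_def by (metis times_diff.simps(2))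
  show "(f has_real_derivative deriv f x) (at x)" using *[of 0] DERIV_imp_deriv by metis
  show "smooth1 (deriv f)" unfolding smooth1_def
  proof
    fix n
    obtain f' where f': "\<forall>x. (f has_real_derivative f' x) (at x)" "times_diff n f'" using * by blast
    then have "deriv f = f'" by (auto intro!: ext DERIV_imp_deriv)
    then show "times_diff n (deriv f)" using f' by simp
  qed
qed

lemma smooth1_continuous: "smooth1 f \<Longrightarrow> continuous_on A f"
  using smooth1_deriv(1) by (meson DERIV_isCont continuous_at_imp_continuous_on)

section \<open>Flat functions and smooth cutoffs\<close>

definition flat_fun :: "real poly \<Rightarrow> real \<Rightarrow> real" where
  "flat_fun P x = (if x > 0 then poly P (1 / x) * exp (- 1 / x) else 0)"

lemma poly_exp_tendsto_0:
  fixes P :: "real poly"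
  shows "((\<lambda>y. poly P y * exp (- y)) \<longlongrightarrow> 0) at_top"
proof -
  have *: "((\<lambda>y. coeff P i * (y ^ i * exp (- y))) \<longlongrightarrow> coeff P i * 0) at_top" for i
  proof (intro tendsto_intros)
    show "((\<lambda>y::real. y ^ i * exp (- y)) \<longlongrightarrow> 0) at_top"
      using tendsto_power_div_exp_0[of i] by (simp add: exp_minus field_simps)
  qed
  have "((\<lambda>y. \<Sum>i\<le>degree P. coeff P i * (y ^ i * exp (- y))) \<longlongrightarrow> (\<Sum>i\<le>degree P. coeff P i * 0)) at_top"
    by (intro tendsto_sum *)
  then show ?thesis by (simp add: poly_altdef sum_distrib_right mult.assoc)
qed

text \<open>With y = 1/x the derivative of P(y) exp(-y) in x is y^2 (P - P')(y) exp(-y), so the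
  polynomial parameter makes the family closed under differentiation. At the origin the difference
  quotient tends to 0 because exp(-y) beats every polynomial.\<close>

lemma flat_fun_deriv:
  "(flat_fun P has_real_derivative flat_fun ([:0, 0, 1:] * (P - pderiv P)) x) (at x)"
proof -
  let ?Q = "[:0, 0, 1:] * (P - pderiv P)"
  consider "x > 0" | "x < 0" | "x = 0" by linarith
  then show ?thesis
  proof cases
    case 1
    have "((\<lambda>x. poly P (1 / x) * exp (- 1 / x)) has_real_derivative
       poly (pderiv P) (1 / x) * (- 1 / x\<^sup>2) * exp (- 1 / x) + exp (- 1 / x) * (1 / x\<^sup>2) * poly P (1 / x)) (at x)"
      using 1 by (auto intro!: derivative_eq_intros DERIV_chain2[OF poly_DERIV] simp: power2_eq_square)
    moreover have "poly (pderiv P) (1 / x) * (- 1 / x\<^sup>2) * exp (- 1 / x) + exp (- 1 / x) * (1 / x\<^sup>2) * poly P (1 / x)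
       = flat_fun ?Q x"
      using 1 by (simp add: flat_fun_def power2_eq_square field_simps)
    ultimately have "((\<lambda>x. poly P (1 / x) * exp (- 1 / x)) has_real_derivative flat_fun ?Q x) (at x)" by simp
    then show ?thesis
      by (rule has_field_derivative_transform_within_open[where S="{0<..}"])
        (use 1 in \<open>auto simp: flat_fun_def\<close>)
  next
    case 2
    have "((\<lambda>x. 0) has_real_derivative flat_fun ?Q x) (at x)" using 2 by (simp add: flat_fun_def)
    then show ?thesis
      by (rule has_field_derivative_transform_within_open[where S="{..<0}"])
        (use 2 in \<open>auto simp: flat_fun_def\<close>)
  next
    case 3
    have "((\<lambda>h. flat_fun P h / h) \<longlongrightarrow> 0) (at 0)"
    proof (rule filterlim_split_at)
      have "((\<lambda>h. 0) \<longlongrightarrow> (0::real)) (at_left 0)" by simp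
      then show "((\<lambda>h. flat_fun P h / h) \<longlongrightarrow> 0) (at_left 0)"
        by (rule tendsto_cong[THEN iffD1, rotated])
          (auto simp: flat_fun_def eventually_at_filter)
      \<comment> \<open>Division by h is one more factor 1/h, absorbed by
        \<open>pCons 0 P\<close>.\<close>
      have "((\<lambda>h. poly (pCons 0 P) (inverse h) * exp (- (inverse h))) \<longlongrightarrow> 0) (at_right 0)"
        by (rule filterlim_compose[OF poly_exp_tendsto_0 filterlim_inverse_at_top_right])
      then show "((\<lambda>h. flat_fun P h / h) \<longlongrightarrow> 0) (at_right 0)"
        by (rule tendsto_cong[THEN iffD1, rotated])
          (auto simp: flat_fun_def eventually_at_filter field_simps)
    qed
    then show ?thesis using 3 by (simp add: DERIV_def flat_fun_def)
  qed
qed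

lemma times_diff_flat_fun: "times_diff n (flat_fun P)"
proof (induction n arbitrary: P)
  case (Suc n) then show ?case using flat_fun_deriv by auto
qed simp

text \<open>The quotient of h(b - x) by h(b - x) + h(x - a), with h the flat function for P = 1.
  Since a < b, at least one of the two arguments is positive, so the denominator never vanishes;
  each plateau is where one of the two terms is zero.\<close>

lemma smooth_step:
  fixes a b :: real
  assumes "a < b"
  obtains \<theta> where "smooth1 \<theta>" "\<And>x. x \<le> a \<Longrightarrow> \<theta> x = 1" "\<And>x. x \<ge> b \<Longrightarrow> \<theta> x = 0" "\<And>x. \<theta> x \<ge> 0"
proof
  let ?h = "flat_fun 1"
  let ?s = "\<lambda>x. ?h (-1 * x + b) + ?h (1 * x + (- a))"
  let ?t = "\<lambda>x. ?h (-1 * x + b) * inverse (?s x)"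
  have h: "?h x \<ge> 0" "?h x > 0 \<longleftrightarrow> x > 0" "x \<le> 0 \<Longrightarrow> ?h x = 0" for x by (auto simp: flat_fun_def)
  have s: "?s x > 0" for x
  proof (cases "x < b")
    case True
    then show ?thesis using h(1)[of "1 * x + (- a)"] h(2)[of "-1 * x + b"] by (intro add_pos_nonneg) auto
  next
    case False
    then show ?thesis using assms h(1)[of "-1 * x + b"] h(2)[of "1 * x + (- a)"] by (intro add_nonneg_pos) auto
  qed
  have ne: "?s x \<noteq> 0" for x using s[of x] by linarith
  show "smooth1 ?t" unfolding smooth1_def
    by (intro allI times_diff_mult times_diff_inverse times_diff_add times_diff_affine times_diff_flat_fun ne)
  show "?t x = 1" if "x \<le> a" for x
    using ne[of x] h(3)[of "1 * x + (- a)"] that by simp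
  show "?t x = 0" if "x \<ge> b" for x using h(3)[of "-1 * x + b"] that by simp
  show "?t x \<ge> 0" for x using h(1)[of "-1 * x + b"] s[of x] by (intro mult_nonneg_nonneg) auto
qed

lemma smooth_cutoff:
  fixes r :: real
  assumes "r > 0"
  obtains \<eta> where "smooth1 \<eta>" "\<And>x. \<bar>x\<bar> \<le> r \<Longrightarrow> \<eta> x = 1" "\<And>x. \<bar>x\<bar> \<ge> r + 1 \<Longrightarrow> \<eta> x = 0" "\<And>x. \<eta> x \<ge> 0"
proof -
  obtain \<theta> where t: "smooth1 \<theta>" "\<And>x. x \<le> r \<Longrightarrow> \<theta> x = 1" "\<And>x. x \<ge> r + 1 \<Longrightarrow> \<theta> x = 0" "\<And>x. \<theta> x \<ge> 0"
    using smooth_step[of r "r + 1"] by auto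
  show thesis
  proof (rule that[of "\<lambda>x. \<theta> x * \<theta> (-1 * x + 0)"])
    show "smooth1 (\<lambda>x. \<theta> x * \<theta> (-1 * x + 0))" using t smooth1_affine smooth1_mult by blast
    show "\<theta> x * \<theta> (-1 * x + 0) = 1" if "\<bar>x\<bar> \<le> r" for x using t(2)[of x] t(2)[of "-x"] that by auto
    show "\<theta> x * \<theta> (-1 * x + 0) = 0" if "\<bar>x\<bar> \<ge> r + 1" for x
      using t(3)[of x] t(3)[of "-x"] that by (cases "x \<ge> 0") auto
  qed (use t in auto)
qed

section \<open>Tensor products of one-variable functions as test functions\<close>

definition tensor :: "('a::euclidean_space \<Rightarrow> real \<Rightarrow> real) \<Rightarrow> 'a \<Rightarrow> real" where
  "tensor f x = (\<Prod>b\<in>Basis. f b (x \<bullet> b))"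

lemma tensor_split:
  assumes "b \<in> Basis"
  shows "tensor f x = f b (x \<bullet> b) * (\<Prod>c\<in>Basis - {b}. f c (x \<bullet> c))"
  unfolding tensor_def using assms by (subst prod.remove[of _ b]) auto

lemma tensor_has_deriv:
  assumes b: "b \<in> Basis" and f: "smooth1 (f b)"
  shows "((\<lambda>s. tensor f (x + s *\<^sub>R b)) has_real_derivative tensor (f(b := deriv (f b))) x) (at 0)"
proof -
  have "tensor f (x + s *\<^sub>R b) = f b (1 * s + x \<bullet> b) * (\<Prod>c\<in>Basis - {b}. f c (x \<bullet> c))" for s
  proof -
    have "(\<Prod>c\<in>Basis - {b}. f c ((x + s *\<^sub>R b) \<bullet> c)) = (\<Prod>c\<in>Basis - {b}. f c (x \<bullet> c))"
      using b by (intro prod.cong) (auto simp: inner_add_left inner_not_same_Basis)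
    then show ?thesis using b by (simp add: tensor_split[OF b] inner_add_left add.commute)
  qed
  moreover have "((\<lambda>s. f b (1 * s + x \<bullet> b)) has_real_derivative deriv (f b) (1 * 0 + x \<bullet> b) * 1) (at 0)"
    by (rule DERIV_chain2[OF smooth1_deriv(1)[OF f]]) (auto intro!: derivative_eq_intros)
  then have "((\<lambda>s. f b (1 * s + x \<bullet> b)) has_real_derivative deriv (f b) (x \<bullet> b)) (at 0)" by simp
  ultimately show ?thesis
    using DERIV_cmult_right[of "\<lambda>s. f b (1 * s + x \<bullet> b)"] by (simp add: tensor_split[OF b] o_def)
qed

lemma partial_dir_tensor:
  assumes "b \<in> Basis" "smooth1 (f b)"
  shows "partial_dir b (tensor f) = tensor (f(b := deriv (f b)))"
  using tensor_has_deriv[where f=f, OF assms] unfolding partial_dir_def by (auto intro: DERIV_imp_deriv)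

text \<open>Differentiation in a basis direction replaces one factor by its derivative, so tensors
  with smooth factors form a class stable under all iterated partials. Smoothness in several
  variables is thereby reduced to one variable.\<close>

lemma iter_partial_tensor:
  assumes "\<And>b. b \<in> Basis \<Longrightarrow> smooth1 (f b)" "set bs \<subseteq> Basis"
  shows "\<exists>g. iter_partial bs (tensor f) = tensor g \<and> (\<forall>b\<in>Basis. smooth1 (g b))"
  using assms(2)
proof (induction bs)
  case Nil then show ?case using assms by auto
next
  case (Cons b bs)
  then obtain g where "iter_partial bs (tensor f) = tensor g" "\<forall>b\<in>Basis. smooth1 (g b)" by auto
  with Cons show ?case
    by (auto intro!: exI[of _ "g(b := deriv (g b))"] simp: partial_dir_tensor smooth1_deriv(2))
qed

lemma continuous_tensor:
  assumes "\<And>b. b \<in> Basis \<Longrightarrow> smooth1 (f b)"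
  shows "continuous_on A (tensor f)"
proof -
  have "continuous_on A (\<lambda>x. f b (x \<bullet> b))" if "b \<in> Basis" for b
    by (rule continuous_on_compose2[OF smooth1_continuous[OF assms[OF that], of UNIV]])
      (auto intro: continuous_intros)
  then show ?thesis unfolding tensor_def by (intro continuous_on_prod) auto
qed

lemma smooth_tensor:
  assumes "\<And>b. b \<in> Basis \<Longrightarrow> smooth1 (f b)"
  shows "smooth_fun (tensor f)"
  unfolding smooth_fun_def
proof (intro allI impI conjI ballI)
  fix bs :: "'a list" assume "set bs \<subseteq> Basis"
  then obtain g where g: "iter_partial bs (tensor f) = tensor g" "\<forall>b\<in>Basis. smooth1 (g b)"
    using iter_partial_tensor assms by blast
  then show "continuous_on UNIV (iter_partial bs (tensor f))" using continuous_tensor by auto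
  show "(\<lambda>s. iter_partial bs (tensor f) (x + s *\<^sub>R b)) differentiable at 0" if "b \<in> Basis" for b x
    using tensor_has_deriv[OF that, of g x] g that
    by (auto simp: real_differentiable_def)
qed

lemma tensor_prod:
  fixes x :: "'a::euclidean_space"
  shows "tensor f (s, x) = f (1, 0) s * tensor (\<lambda>b. f (0, b)) x"
proof -
  have "Basis = insert (1, 0) ((\<lambda>b. (0::real, b)) ` (Basis::'a set))" (is "_ = ?B") by (auto simp: Basis_prod_def)
  then have "tensor f (s, x) = (\<Prod>b\<in>?B. f b ((s, x) \<bullet> b))" unfolding tensor_def by simp
  moreover have "(1, 0) \<notin> (\<lambda>b. (0::real, b)) ` (Basis::'a set)" by auto
  ultimately have "tensor f (s, x) = f (1, 0) s * (\<Prod>b\<in>(\<lambda>b. (0::real, b)) ` (Basis::'a set). f b ((s, x) \<bullet> b))"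
    by simp
  also have "(\<Prod>b\<in>(\<lambda>b. (0::real, b)) ` (Basis::'a set). f b ((s, x) \<bullet> b)) = tensor (\<lambda>b. f (0, b)) x"
    by (subst prod.reindex) (auto simp: inj_on_def tensor_def)
  finally show ?thesis .
qed

text \<open>The norm is at most the sum of the absolute coordinates, so beyond the dimension times
  \<rho> some coordinate exceeds \<rho> and its factor vanishes. This is where the dimension in the
  support radius of the weight comes from.\<close>

lemma tensor_eq_0:
  fixes x :: "'a::euclidean_space"
  assumes "\<And>b y. b \<in> Basis \<Longrightarrow> \<bar>y\<bar> > \<rho> \<Longrightarrow> f b y = 0" and "norm x > real DIM('a) * \<rho>"
  shows "tensor f x = 0"
proof -
  have "\<exists>b\<in>Basis. \<bar>x \<bullet> b\<bar> > \<rho>"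
  proof (rule ccontr)
    assume "\<not> ?thesis"
    then have "(\<Sum>b\<in>Basis. \<bar>x \<bullet> b\<bar>) \<le> (\<Sum>b\<in>(Basis::'a set). \<rho>)" by (intro sum_mono) force
    then show False using norm_le_l1[of x] assms(2) by simp
  qed
  then show ?thesis using assms(1) by (auto simp: tensor_def intro!: prod_zero)
qed

lemma test_fun_tensor:
  fixes f :: "'a::euclidean_space \<Rightarrow> real \<Rightarrow> real"
  assumes "\<And>b. b \<in> Basis \<Longrightarrow> smooth1 (f b)"
    and "\<And>b y. b \<in> Basis \<Longrightarrow> \<bar>y\<bar> > \<rho> \<Longrightarrow> f b y = 0"
  shows "test_fun (tensor f)"
  using smooth_tensor[of f, OF assms(1)] tensor_eq_0[of \<rho> f, OF assms(2)] unfolding test_fun_def by blast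

lemma deriv_cong_open:
  fixes f g :: "real \<Rightarrow> real"
  assumes "open S" "x \<in> S" "\<And>y. y \<in> S \<Longrightarrow> f y = g y"
  shows "deriv f x = deriv g x"
  by (rule deriv_cong_ev) (use assms in \<open>auto simp: eventually_nhds\<close>)

lemma deriv_zero_outside:
  fixes f :: "real \<Rightarrow> real"
  assumes "\<And>y. \<bar>y\<bar> > \<rho> \<Longrightarrow> f y = 0" "\<bar>y\<bar> > \<rho>"
  shows "deriv f y = 0"
proof -
  have "deriv f y = deriv (\<lambda>_. 0) y"
    by (rule deriv_cong_open[where S="{y. \<bar>y\<bar> > \<rho>}"]) (use assms in \<open>auto intro!: open_Collect_less continuous_intros\<close>)
  then show ?thesis by simp
qed

text \<open>\<open>dw b\<close> and \<open>ddw b\<close> are the first and second partial derivatives of the weight in direction \<open>b\<close>.\<close>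

locale exp_weight =
  fixes e :: "'a::euclidean_space" and \<rho> r :: real
    and w :: "'a \<Rightarrow> real" and dw ddw :: "'a \<Rightarrow> 'a \<Rightarrow> real"
  assumes w_nonneg: "\<And>x. w x \<ge> 0"
    and w_exp: "\<And>x. norm x \<le> \<rho> \<Longrightarrow> w x = exp (x \<bullet> e)"
    and laplace: "\<And>x. norm x \<le> \<rho> \<Longrightarrow> (\<Sum>b\<in>Basis. ddw b x) = w x"
    and cont_w: "continuous_on UNIV w"
    and cont_dw: "\<And>b. b \<in> Basis \<Longrightarrow> continuous_on UNIV (dw b)"
    and cont_ddw: "\<And>b. b \<in> Basis \<Longrightarrow> continuous_on UNIV (ddw b)"
    and supp_w: "\<And>x. norm x > r \<Longrightarrow> w x = 0"
    and supp_dw: "\<And>b x. b \<in> Basis \<Longrightarrow> norm x > r \<Longrightarrow> dw b x = 0"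
    and supp_ddw: "\<And>b x. b \<in> Basis \<Longrightarrow> norm x > r \<Longrightarrow> ddw b x = 0"
    and test_dw: "\<And>b. b \<in> Basis \<Longrightarrow> test_fun (dw b)"
    and partial_dw: "\<And>b. b \<in> Basis \<Longrightarrow> partial_dir b (dw b) = ddw b"
    and spacetime: "\<And>t T. t < T \<Longrightarrow> \<exists>\<phi>. st_test_fun T \<phi> \<and> (\<forall>s\<le>t. \<forall>x.
        \<phi> (s, x) = exp (- s) * w x \<and> dt \<phi> (s, x) = - exp (- s) * w x \<and>
        gradx \<phi> (s, x) = (\<Sum>b\<in>Basis. (exp (- s) * dw b x) *\<^sub>R b))"

text \<open>The plane exponential is a tensor with constant factors in the directions other than e,
  and cutting off each coordinate separately keeps it one. The cutoffs are 1 on a neighbourhood of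
  the ball of radius \<rho>; later \<rho> = R + T, so the solution never sees them before time
  T.\<close>

lemma exp_weight_exists:
  fixes e :: "'a::euclidean_space"
  assumes e: "e \<in> Basis" and rho: "\<rho> > 0"
  shows "\<exists>r w dw ddw. exp_weight e \<rho> r w dw ddw"
proof -
  \<comment> \<open>The plateau reaches \<rho> + 1: first and second derivatives of the factors then
    agree with those of the exponential at every coordinate of the closed ball.\<close>
  obtain \<eta> where eta: "smooth1 \<eta>" "\<And>x. \<bar>x\<bar> \<le> \<rho> + 1 \<Longrightarrow> \<eta> x = 1" "\<And>x. \<bar>x\<bar> \<ge> \<rho> + 1 + 1 \<Longrightarrow> \<eta> x = 0" "\<And>x. \<eta> x \<ge> 0"
    using smooth_cutoff[of "\<rho> + 1"] rho by auto
  define c :: "'a \<Rightarrow> real" where "c b = (if b = e then 1 else 0)" for b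
  define f where "f b y = \<eta> y * exp (c b * y)" for b y
  define w where "w = tensor f"
  define dw where "dw b = tensor (f(b := deriv (f b)))" for b
  define ddw where "ddw b = tensor (f(b := deriv (deriv (f b))))" for b
  define r where "r = real DIM('a) * (\<rho> + 2)"
  have sf: "smooth1 (f b)" for b unfolding f_def by (intro smooth1_mult smooth1_exp eta)
  have f0: "f b y = 0" if "\<bar>y\<bar> > \<rho> + 2" for b y using eta(3)[of y] that by (simp add: f_def)
  have df0: "deriv (f b) y = 0" if "\<bar>y\<bar> > \<rho> + 2" for b y by (rule deriv_zero_outside[OF f0 that])
  have ddf0: "deriv (deriv (f b)) y = 0" if "\<bar>y\<bar> > \<rho> + 2" for b y by (rule deriv_zero_outside[OF df0 that])
  have op: "open {y::real. \<bar>y\<bar> < \<rho> + 1}" by (intro open_Collect_less continuous_intros)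
  have fexp: "f b y = exp (c b * y)" if "\<bar>y\<bar> < \<rho> + 1" for b y using eta(2)[of y] that by (simp add: f_def)
  have dfexp: "deriv (f b) y = c b * exp (c b * y)" if "\<bar>y\<bar> < \<rho> + 1" for b y
  proof -
    have "deriv (f b) y = deriv (\<lambda>y. exp (c b * y)) y"
      by (rule deriv_cong_open[OF op]) (use that fexp in auto)
    also have "\<dots> = c b * exp (c b * y)" by (rule DERIV_imp_deriv) (auto intro!: derivative_eq_intros)
    finally show ?thesis .
  qed
  have ddfexp: "deriv (deriv (f b)) y = c b * c b * exp (c b * y)" if "\<bar>y\<bar> < \<rho> + 1" for b y
  proof -
    have "deriv (deriv (f b)) y = deriv (\<lambda>y. c b * exp (c b * y)) y"
      by (rule deriv_cong_open[OF op]) (use that dfexp in auto)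
    also have "\<dots> = c b * c b * exp (c b * y)" by (rule DERIV_imp_deriv) (auto intro!: derivative_eq_intros)
    finally show ?thesis .
  qed
  have inball: "\<bar>x \<bullet> b\<bar> < \<rho> + 1" if "norm x \<le> \<rho>" "b \<in> Basis" for x b
    using Basis_le_norm[OF that(2), of x] that by simp
  have sdw: "smooth1 ((f(b := deriv (f b))) b')" for b b' using sf smooth1_deriv(2) by auto
  have sddw: "smooth1 ((f(b := deriv (deriv (f b)))) b')" for b b' using sf smooth1_deriv(2) by auto
  have pw: "partial_dir b w = dw b" if "b \<in> Basis" for b
    unfolding w_def dw_def by (rule partial_dir_tensor[OF that sf])
  have "exp_weight e \<rho> r w dw ddw"
  proof
    show "w x \<ge> 0" for x unfolding w_def tensor_def f_def using eta(4) by (intro prod_nonneg) auto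
    show wexp: "w x = exp (x \<bullet> e)" if "norm x \<le> \<rho>" for x
    proof -
      have "w x = (\<Prod>b\<in>Basis. exp (c b * (x \<bullet> b)))" unfolding w_def tensor_def
        by (intro prod.cong refl fexp inball that)
      also have "\<dots> = exp (c e * (x \<bullet> e)) * (\<Prod>b\<in>Basis - {e}. exp (c b * (x \<bullet> b)))"
        using e by (simp add: prod.remove[of _ e])
      also have "(\<Prod>b\<in>Basis - {e}. exp (c b * (x \<bullet> b))) = 1" by (rule prod.neutral) (auto simp: c_def)
      finally show ?thesis by (simp add: c_def)
    qed
    show "(\<Sum>b\<in>Basis. ddw b x) = w x" if "norm x \<le> \<rho>" for x
    proof -
      \<comment> \<open>Each second derivative in direction b reproduces w up to the square of the
        frequency \<open>c b\<close>, which is 1 for e and 0 otherwise.\<close>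
      have "ddw b x = (c b * c b) * w x" if b: "b \<in> Basis" for b
      proof -
        have "ddw b x = deriv (deriv (f b)) (x \<bullet> b) * (\<Prod>c\<in>Basis - {b}. f c (x \<bullet> c))"
          unfolding ddw_def by (subst tensor_split[OF b]) (auto intro!: prod.cong)
        also have "deriv (deriv (f b)) (x \<bullet> b) = c b * c b * f b (x \<bullet> b)"
          using ddfexp fexp inball[OF \<open>norm x \<le> \<rho>\<close> b] by simp
        finally show ?thesis unfolding w_def by (simp add: tensor_split[OF b])
      qed
      then have "(\<Sum>b\<in>Basis. ddw b x) = (\<Sum>b\<in>Basis. if b = e then w x else 0)"
        by (intro sum.cong) (auto simp: c_def)
      then show ?thesis using e by simp
    qed
    show "continuous_on UNIV w" unfolding w_def using sf by (intro continuous_tensor)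
    show "continuous_on UNIV (dw b)" for b unfolding dw_def using sdw by (intro continuous_tensor)
    show "continuous_on UNIV (ddw b)" for b unfolding ddw_def using sddw by (intro continuous_tensor)
    show w0: "w x = 0" if "norm x > r" for x
      unfolding w_def using tensor_eq_0[of "\<rho> + 2" f x] f0 that by (simp add: r_def)
    show "dw b x = 0" if "norm x > r" for b x
      unfolding dw_def using tensor_eq_0[of "\<rho> + 2" "f(b := deriv (f b))" x] f0 df0 that by (simp add: r_def)
    show "ddw b x = 0" if "norm x > r" for b x
      unfolding ddw_def using tensor_eq_0[of "\<rho> + 2" "f(b := deriv (deriv (f b)))" x] f0 ddf0 that by (simp add: r_def)
    show "test_fun (dw b)" for b unfolding dw_def
      by (rule test_fun_tensor[where \<rho>="\<rho> + 2"]) (use sdw f0 df0 in auto)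
    show "partial_dir b (dw b) = ddw b" if "b \<in> Basis" for b
      unfolding dw_def ddw_def using partial_dir_tensor[where f="f(b := deriv (f b))", OF that sdw[of b b]] by simp
    show "\<exists>\<phi>. st_test_fun T \<phi> \<and> (\<forall>s\<le>t. \<forall>x.
        \<phi> (s, x) = exp (- s) * w x \<and> dt \<phi> (s, x) = - exp (- s) * w x \<and>
        gradx \<phi> (s, x) = (\<Sum>b\<in>Basis. (exp (- s) * dw b x) *\<^sub>R b))" if "t < T" for t T
    proof -
      \<comment> \<open>The test function must vanish before T while the exponential stays untouched
        up to t; going beyond t to a makes the time derivative correct at s = t as well.\<close>
      obtain a where a: "t < a" "a < T" using dense \<open>t < T\<close> by blast
      obtain a' where a': "a < a'" "a' < T" using dense a by blast
      obtain \<theta> where th: "smooth1 \<theta>" "\<And>x. x \<le> a \<Longrightarrow> \<theta> x = 1" "\<And>x. x \<ge> a' \<Longrightarrow> \<theta> x = 0" "\<And>x. \<theta> x \<ge> 0"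
        using smooth_step[OF a'(1)] by auto
      define g where "g s = \<theta> s * exp (- 1 * s)" for s
      have sg: "smooth1 g" unfolding g_def by (intro smooth1_mult smooth1_exp th)
      have g1: "g s = exp (- s)" if "s < a" for s using th(2)[of s] that by (simp add: g_def)
      have dg: "deriv g s = - exp (- s)" if "s < a" for s
      proof -
        have "deriv g s = deriv (\<lambda>s. exp (- s)) s"
          by (rule deriv_cong_open[where S="{..<a}"]) (use that g1 in auto)
        also have "\<dots> = - exp (- s)" by (rule DERIV_imp_deriv) (auto intro!: derivative_eq_intros)
        finally show ?thesis .
      qed
      define H where "H z = (if z = (1, 0) then g else f (snd z))" for z :: "real \<times> 'a"
      define \<phi> where "\<phi> = tensor H"
      have sH: "smooth1 (H z)" for z using sg sf by (simp add: H_def)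
      have H10: "H (1, 0) = g" and H0b: "H (0, b) = f b" for b by (auto simp: H_def)
      have phi: "\<phi> (s, x) = g s * w x" for s x
        unfolding \<phi>_def tensor_prod w_def H10 H0b by (rule refl)
      have "st_test_fun T \<phi>" unfolding st_test_fun_def
      proof (intro conjI exI allI impI)
        show "smooth_fun \<phi>" unfolding \<phi>_def using sH by (intro smooth_tensor)
        show "a' < T" by fact
        show "\<phi> (s, x) = 0" if "s \<ge> a' \<or> norm x > r" for s x
          using that th(3)[of s] w0[of x] by (auto simp: phi g_def)
      qed
      moreover have "dt \<phi> (s, x) = - exp (- s) * w x" if "s \<le> t" for s x
      proof -
        have "(1, 0) \<in> (Basis :: (real \<times> 'a) set)" by (simp add: Basis_prod_def)
        then have "dt \<phi> (s, x) = tensor (H((1, 0) := deriv (H (1, 0)))) (s, x)"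
          unfolding dt_def \<phi>_def by (simp add: partial_dir_tensor sH)
        also have "\<dots> = deriv g s * w x"
          unfolding tensor_prod w_def by (simp add: H10 H0b)
        finally show ?thesis using dg[of s] that a by simp
      qed
      moreover have "gradx \<phi> (s, x) = (\<Sum>b\<in>Basis. (exp (- s) * dw b x) *\<^sub>R b)" if "s \<le> t" for s x
        unfolding gradx_def
      proof (intro sum.cong refl arg_cong2[where f=scaleR])
        fix b :: 'a assume b: "b \<in> Basis"
        then have "(0, b) \<in> (Basis :: (real \<times> 'a) set)" by (simp add: Basis_prod_def)
        then have "partial_dir (0, b) \<phi> (s, x) = tensor (H((0, b) := deriv (H (0, b)))) (s, x)"
          unfolding \<phi>_def by (simp add: partial_dir_tensor sH)
        also have "\<dots> = g s * dw b x"
        proof -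
          have "(\<lambda>b'. (H((0, b) := deriv (H (0, b)))) (0, b')) = f(b := deriv (f b))"
            by (rule ext) (simp add: H0b)
          then show ?thesis unfolding tensor_prod dw_def by (simp add: H10)
        qed
        finally show "partial_dir (0, b) \<phi> (s, x) = exp (- s) * dw b x" using g1[of s] that a by simp
      qed
      moreover have "\<phi> (s, x) = exp (- s) * w x" if "s \<le> t" for s x using phi g1[of s] that a by simp
      ultimately show ?thesis by (intro exI[of _ \<phi>]) simp
    qed
  qed
  then show ?thesis by blast
qed

subsection \<open>The coupled differential inequalities\<close>

lemma mono_from_deriv:
  fixes f :: "real \<Rightarrow> real"
  assumes "a \<le> b" "continuous_on {a..b} f"
    and "\<And>x. a < x \<Longrightarrow> x < b \<Longrightarrow> (f has_real_derivative f' x) (at x)"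
    and "\<And>x. a < x \<Longrightarrow> x < b \<Longrightarrow> f' x \<ge> 0"
  shows "f a \<le> f b"
  by (rule DERIV_nonneg_imp_increasing_open[OF assms(1)]) (use assms in blast)+

text \<open>W stands for the accumulated forcing of the v-equation, X for a lower bound of the
  weighted average of the time derivative of u. The constants of the lifespan bound will be built
  from the parameters other than \<epsilon> and T; that makes the bound uniform in both.\<close>

locale coupled_system =
  fixes p q \<beta> c \<mu> I T \<epsilon> :: real and W W' X X' :: "real \<Rightarrow> real"
  assumes p: "p > 1" and q: "q > 1" and beta: "\<beta> \<ge> 0" and c: "c > 0" and lam: "\<mu> > 0"
    and I: "I > 0" and eps: "0 < \<epsilon>" "\<epsilon> \<le> 1"
    and contW: "continuous_on {0..<T} W" and contX: "continuous_on {0..<T} X"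
    and derW: "\<And>t. 0 < t \<Longrightarrow> t < T \<Longrightarrow> (W has_real_derivative W' t) (at t)"
    and derX: "\<And>t. 0 < t \<Longrightarrow> t < T \<Longrightarrow> (X has_real_derivative X' t) (at t)"
    and W'_ge: "\<And>t. 0 < t \<Longrightarrow> t < T \<Longrightarrow> W' t \<ge> c * X t powr q * (1 + t) powr (- \<beta> * (q - 1))"
    and X'_ge: "\<And>t. 0 < t \<Longrightarrow> t < T \<Longrightarrow>
       X' t \<ge> - \<mu> * X t + c * W t powr p * (1 + t) powr (- \<beta> * (p - 1))"
    and W0: "W 0 \<ge> I * \<epsilon>" and X0: "X 0 \<ge> 0"
begin

lemma contW': "0 \<le> a \<Longrightarrow> b < T \<Longrightarrow> continuous_on {a..b} W"
  by (rule continuous_on_subset[OF contW]) auto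

lemma contX': "0 \<le> a \<Longrightarrow> b < T \<Longrightarrow> continuous_on {a..b} X"
  by (rule continuous_on_subset[OF contX]) auto

lemma W_mono: assumes "0 \<le> a" "a \<le> b" "b < T" shows "W a \<le> W b"
proof (rule mono_from_deriv[where f=W and f'=W'])
  show "continuous_on {a..b} W" using assms contW' by blast
  show "(W has_real_derivative W' x) (at x)" if "a < x" "x < b" for x
    using that assms derW by simp
  show "W' x \<ge> 0" if "a < x" "x < b" for x
  proof -
    have "0 \<le> c * X x powr q * (1 + x) powr (- \<beta> * (q - 1))" using c by simp
    also have "\<dots> \<le> W' x" using that assms W'_ge by simp
    finally show ?thesis .
  qed
qed (use assms in simp)

lemma W_ge: "0 \<le> t \<Longrightarrow> t < T \<Longrightarrow> W t \<ge> I * \<epsilon>"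
  using W_mono[of 0 t] W0 by simp

lemma W_pos: "0 \<le> t \<Longrightarrow> t < T \<Longrightarrow> W t > 0"
  using W_ge[of t] I eps by (smt (verit) mult_pos_pos)

section \<open>Damped memory and the delayed inequality\<close>

lemma expX_der: assumes "0 < t" "t < T"
  shows "((\<lambda>s. exp (\<mu> * s) * X s) has_real_derivative exp (\<mu> * t) * (X' t + \<mu> * X t)) (at t)"
  using derX[OF assms] by (auto intro!: derivative_eq_intros simp: algebra_simps)

lemma expX_der_ge: assumes "0 < t" "t < T"
  shows "exp (\<mu> * t) * (X' t + \<mu> * X t) \<ge> exp (\<mu> * t) * (c * W t powr p * (1 + t) powr (- \<beta> * (p - 1)))"
  using X'_ge[OF assms] by simp

lemma X_nonneg: assumes "0 \<le> t" "t < T" shows "X t \<ge> 0"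
proof -
  have "exp (\<mu> * 0) * X 0 \<le> exp (\<mu> * t) * X t"
  proof (rule mono_from_deriv[where f="\<lambda>s. exp (\<mu> * s) * X s" and f'="\<lambda>t. exp (\<mu> * t) * (X' t + \<mu> * X t)"])
    show "continuous_on {0..t} (\<lambda>s. exp (\<mu> * s) * X s)"
      using assms contX' by (intro continuous_intros) auto
    show "exp (\<mu> * x) * (X' x + \<mu> * X x) \<ge> 0" if "0 < x" "x < t" for x
    proof -
      have "0 \<le> exp (\<mu> * x) * (c * W x powr p * (1 + x) powr (- \<beta> * (p - 1)))" using c by simp
      also have "\<dots> \<le> exp (\<mu> * x) * (X' x + \<mu> * X x)" using that assms expX_der_ge by simp
      finally show ?thesis .
    qed
  qed (use assms expX_der in auto)
  then have "0 \<le> exp (\<mu> * t) * X t" using X0 by simp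
  then show ?thesis by (simp add: zero_le_mult_iff)
qed

text \<open>Duhamel's formula with only the last unit of time kept. There W is at least its value at
  t - 1 and the decaying weight at least its value at t, and the integrating factor costs just
  e^(-\<mu>).\<close>

lemma X_delay: assumes "1 \<le> t" "t < T"
  shows "X t \<ge> c * exp (- \<mu>) * W (t - 1) powr p * (1 + t) powr (- \<beta> * (p - 1))"
proof -
  define A where "A = c * W (t - 1) powr p * (1 + t) powr (- \<beta> * (p - 1))"
  have A0: "A \<ge> 0" unfolding A_def using c by simp
  have "exp (\<mu> * (t-1)) * X (t-1) - exp (\<mu> * (t-1)) * A * (t-1) \<le> exp (\<mu> * t) * X t - exp (\<mu> * (t-1)) * A * t"
  proof (rule mono_from_deriv[where f="\<lambda>s. exp (\<mu> * s) * X s - exp (\<mu> * (t-1)) * A * s"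
        and f'="\<lambda>x. exp (\<mu> * x) * (X' x + \<mu> * X x) - exp (\<mu> * (t-1)) * A"])
    show "continuous_on {t - 1..t} (\<lambda>s. exp (\<mu> * s) * X s - exp (\<mu> * (t - 1)) * A * s)"
      using assms by (intro continuous_intros contX') auto
    show "((\<lambda>s. exp (\<mu> * s) * X s - exp (\<mu> * (t-1)) * A * s) has_real_derivative
        exp (\<mu> * x) * (X' x + \<mu> * X x) - exp (\<mu> * (t-1)) * A) (at x)" if "t - 1 < x" "x < t" for x
      by (rule derivative_eq_intros expX_der | use that assms in simp)+
    show "0 \<le> exp (\<mu> * x) * (X' x + \<mu> * X x) - exp (\<mu> * (t-1)) * A" if x: "t - 1 < x" "x < t" for x
    proof -
      have "A \<le> c * W x powr p * (1 + x) powr (- \<beta> * (p - 1))"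
        unfolding A_def
      proof (intro mult_mono)
        show "W (t - 1) powr p \<le> W x powr p"
          using x assms W_mono[of "t-1" x] W_pos[of "t-1"] p by (intro powr_mono2) auto
        show "(1 + t) powr (- \<beta> * (p - 1)) \<le> (1 + x) powr (- \<beta> * (p - 1))"
          using x assms beta p by (intro powr_mono2') (auto simp: mult_nonneg_nonneg)
      qed (use c in auto)
      then have "exp (\<mu> * (t-1)) * A \<le> exp (\<mu> * x) * (c * W x powr p * (1 + x) powr (- \<beta> * (p - 1)))"
        using x lam A0 by (intro mult_mono) auto
      also have "\<dots> \<le> exp (\<mu> * x) * (X' x + \<mu> * X x)" using x assms expX_der_ge by simp
      finally show ?thesis by simp
    qed
  qed simp
  moreover have "exp (\<mu> * (t-1)) * X (t-1) \<ge> 0" using X_nonneg assms by simp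
  ultimately have "exp (\<mu> * (t-1)) * A \<le> exp (\<mu> * t) * X t" by (simp add: algebra_simps)
  also have "exp (\<mu> * (t-1)) = exp (\<mu> * t) * exp (-\<mu>)" by (simp add: exp_add[symmetric] algebra_simps)
  finally have "exp (\<mu> * t) * (exp (-\<mu>) * A) \<le> exp (\<mu> * t) * X t" by (simp only: mult.assoc)
  then have "exp (-\<mu>) * A \<le> X t" by simp
  then show ?thesis by (simp add: A_def mult_ac)
qed

text \<open>The lower bound for X is inserted into the inequality for W'. The time weights combine
  through \<beta>(p - 1) q + \<beta>(q - 1) = \<beta>(pq - 1).\<close>

lemma W'_delay: assumes "1 \<le> t" "t < T"
  shows "W' t \<ge> c * (c * exp (- \<mu>)) powr q * W (t - 1) powr (p * q) * (1 + t) powr (- \<beta> * (p * q - 1))"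
proof -
  have "c * (c * exp (- \<mu>)) powr q * W (t - 1) powr (p * q) * (1 + t) powr (- \<beta> * (p * q - 1))
      = c * (c * exp (- \<mu>) * W (t - 1) powr p * (1 + t) powr (- \<beta> * (p - 1))) powr q * (1 + t) powr (- \<beta> * (q - 1))"
    using c assms W_pos[of "t-1"]
    by (simp add: powr_mult powr_powr powr_add[symmetric] algebra_simps)
  also have "\<dots> \<le> c * X t powr q * (1 + t) powr (- \<beta> * (q - 1))"
    using X_delay[OF assms] c q assms W_pos[of "t-1"]
    by (intro mult_right_mono mult_left_mono powr_mono2) auto
  also have "\<dots> \<le> W' t" using W'_ge assms by simp
  finally show ?thesis .
qed

text \<open>Over one unit of time the weights and the damping factor are comparable to constants;
  after rescaling the system becomes autonomous, z' \<ge> c y^p and y' \<ge> const z^q. In the first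
  half unit z rises above 1 by \<open>m2\<close>; in the second the sum Q of y and z obeys Q' \<ge>
  c2 Q^s, whose blow-up time from the value m is below 1/2 by \<open>m3\<close>.\<close>

lemma blowup_within_unit_time:
  fixes s c2 m :: real
  defines "s \<equiv> min p q" and "c2 \<equiv> c * exp (- \<mu> * q) / 2 powr (min p q)"
  assumes m1: "m \<ge> 1" and m2: "c * m powr p \<ge> 2" and m3: "m powr (- (s - 1)) < (s - 1) * c2 / 2"
    and t1: "0 \<le> t1" "t1 < T" "W t1 \<ge> m * 2 powr \<beta> * (1 + t1) powr \<beta>"
  shows "T \<le> t1 + 1"
proof (rule ccontr)
  assume "\<not> T \<le> t1 + 1"
  then have T: "t1 + 1 < T" by simp
  \<comment> \<open>2 + t1 is the largest value of 1 + t on the interval, so powers of \<rho> with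
    negative exponent bound the time weights from below.\<close>
  define \<rho> where "\<rho> = (2 + t1) powr \<beta>"
  have rho: "\<rho> > 0" using t1 by (simp add: \<rho>_def)
  have s1: "s > 1" using p q by (simp add: s_def)
  have c20: "c2 > 0" using c by (simp add: c2_def)
  define y where "y t = W t / \<rho>" for t
  define z where "z t = exp (\<mu> * (t - t1)) * X t / \<rho>" for t
  \<comment> \<open>The estimate 2 + t1 \<le> 2 (1 + t1) explains the factor 2^\<beta> in the
    assumption on W at t1: it yields W \<ge> m \<rho> there.\<close>
  have "\<rho> \<le> (2 * (1 + t1)) powr \<beta>" unfolding \<rho>_def using t1 beta by (intro powr_mono2) auto
  also have "\<dots> = 2 powr \<beta> * (1 + t1) powr \<beta>" using t1 by (subst powr_mult[symmetric]) auto
  finally have "m * \<rho> \<le> W t1" using t1 m1 by (smt (verit) mult_left_mono mult.assoc)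
  then have "y t1 \<ge> m" using rho by (simp add: y_def field_simps)
  moreover have "y t1 \<le> y t" if "t1 \<le> t" "t \<le> t1 + 1" for t
    using W_mono[of t1 t] that t1 T rho by (simp add: y_def divide_right_mono)
  ultimately have y_ge: "y t \<ge> m" if "t1 \<le> t" "t \<le> t1 + 1" for t using that by fastforce
  have z_ge0: "z t \<ge> 0" if "t1 \<le> t" "t \<le> t1 + 1" for t
    using X_nonneg[of t] that t1 T rho by (simp add: z_def)
  define y' where "y' t = W' t / \<rho>" for t
  define z' where "z' t = exp (\<mu> * (t - t1)) * (X' t + \<mu> * X t) / \<rho>" for t
  have dy: "(y has_real_derivative y' t) (at t)" if "t1 < t" "t \<le> t1 + 1" for t
    unfolding y_def y'_def using derW[of t] that t1 T by (intro DERIV_cdivide) auto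
  have dz: "(z has_real_derivative z' t) (at t)" if "t1 < t" "t \<le> t1 + 1" for t
    unfolding z_def z'_def using derX[of t] that t1 T rho
    by (auto intro!: derivative_eq_intros simp: field_simps)
  have cy: "continuous_on {t1..t1+1} y" unfolding y_def using rho t1 T
    by (intro continuous_intros contW') auto
  have cz: "continuous_on {t1..t1+1} z" unfolding z_def using rho t1 T
    by (intro continuous_intros contX') auto
  have rho_le: "\<rho> powr (- x) \<le> (1 + t) powr (- \<beta> * x)" if "t1 < t" "t \<le> t1 + 1" "x \<ge> 0" for t x
  proof -
    have "\<rho> powr (- x) = (2 + t1) powr (- \<beta> * x)" by (simp add: \<rho>_def powr_powr)
    also have "\<dots> \<le> (1 + t) powr (- \<beta> * x)" using that t1 beta
      by (intro powr_mono2') auto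
    finally show ?thesis .
  qed
  have z'_ge: "z' t \<ge> c * y t powr p" if "t1 < t" "t \<le> t1 + 1" for t
  proof -
    have "c * y t powr p = (c * W t powr p * \<rho> powr (- (p - 1))) / \<rho>"
      using rho W_pos[of t] that t1 T
      by (simp add: y_def powr_divide powr_minus powr_diff field_simps)
    also have "\<dots> \<le> (c * W t powr p * (1 + t) powr (- \<beta> * (p - 1))) / \<rho>"
      using rho c rho_le[of t "p-1"] that p by (intro divide_right_mono mult_left_mono) auto
    also have "\<dots> \<le> (X' t + \<mu> * X t) / \<rho>"
      using X'_ge[of t] that t1 T rho by (intro divide_right_mono) auto
    also have "\<dots> \<le> z' t"
    proof -
      have "0 \<le> c * W t powr p * (1 + t) powr (- \<beta> * (p - 1))" using c by simp
      also have "\<dots> \<le> X' t + \<mu> * X t" using X'_ge[of t] that t1 T by auto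
      finally have "1 * (X' t + \<mu> * X t) \<le> exp (\<mu> * (t - t1)) * (X' t + \<mu> * X t)"
        using that lam by (intro mult_right_mono) auto
      then show ?thesis unfolding z'_def using rho by (intro divide_right_mono) auto
    qed
    finally show ?thesis .
  qed
  \<comment> \<open>The integrating factor inside z is at most e^\<mu> on the unit interval, which
    costs exp (-\<mu> q).\<close>
  have y'_ge: "y' t \<ge> c * exp (- \<mu> * q) * z t powr q" if "t1 < t" "t \<le> t1 + 1" for t
  proof -
    have "z t powr q = exp (\<mu> * q * (t - t1)) * X t powr q * \<rho> powr (- q)"
      using rho X_nonneg[of t] that t1 T
      by (simp add: z_def powr_divide powr_mult powr_minus exp_powr_real field_simps)
    then have "exp (- \<mu> * q) * z t powr q = exp (\<mu> * q * (t - t1 - 1)) * (X t powr q * \<rho> powr (- q))"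
      by (simp add: mult.assoc[symmetric] exp_add[symmetric]) (simp add: algebra_simps)
    also have "\<dots> \<le> 1 * (X t powr q * \<rho> powr (- q))"
      using that lam q by (intro mult_right_mono) (auto simp: mult_nonneg_nonpos)
    finally have "c * (exp (- \<mu> * q) * z t powr q) \<le> c * (X t powr q * \<rho> powr (- q))"
      using c by simp
    also have "\<dots> = (c * X t powr q * \<rho> powr (- (q - 1))) / \<rho>"
      using rho by (simp add: powr_minus powr_diff field_simps)
    also have "\<dots> \<le> (c * X t powr q * (1 + t) powr (- \<beta> * (q - 1))) / \<rho>"
      using rho c rho_le[of t "q-1"] that q by (intro divide_right_mono mult_left_mono) auto
    also have "\<dots> \<le> y' t" unfolding y'_def
      using W'_ge[of t] that t1 T rho by (intro divide_right_mono) auto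
    finally show ?thesis by (simp add: mult_ac)
  qed
  have y'_ge0: "y' t \<ge> 0" if "t1 < t" "t \<le> t1 + 1" for t
    using y'_ge[OF that] c by (smt (verit) exp_gt_zero mult_nonneg_nonneg powr_ge_zero)
  have z'_ge2: "z' t \<ge> 2" if "t1 < t" "t \<le> t1 + 1" for t
  proof -
    have "2 \<le> c * m powr p" by (rule m2)
    also have "\<dots> \<le> c * y t powr p" using y_ge[of t] that m1 c p by (intro mult_left_mono powr_mono2) auto
    finally show ?thesis using z'_ge[OF that] by simp
  qed
  \<comment> \<open>From z \<ge> 0 and slope at least 2, half a unit suffices to reach 1.\<close>
  have z_half: "z t \<ge> 1" if "t1 + 1/2 \<le> t" "t \<le> t1 + 1" for t
  proof -
    have "z t1 - 2 * t1 \<le> z t - 2 * t"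
    proof (rule mono_from_deriv[where f="\<lambda>t. z t - 2 * t" and f'="\<lambda>t. z' t - 2"])
      show "continuous_on {t1..t} (\<lambda>t. z t - 2 * t)"
        using that by (intro continuous_intros continuous_on_subset[OF cz]) auto
      show "((\<lambda>t. z t - 2 * t) has_real_derivative z' x - 2) (at x)" if "t1 < x" "x < t" for x
        using dz[of x] that \<open>t \<le> t1 + 1\<close> by (auto intro!: derivative_eq_intros)
      show "0 \<le> z' x - 2" if "t1 < x" "x < t" for x using z'_ge2[of x] that \<open>t \<le> t1 + 1\<close> by simp
    qed (use that in auto)
    then show ?thesis using z_ge0[of t1] that by auto
  qed
  define Q where "Q t = y t + z t" for t
  have Q_ge: "Q t \<ge> m" if "t1 + 1/2 \<le> t" "t \<le> t1 + 1" for t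
    using y_ge[of t] z_half[of t] that by (simp add: Q_def)
  \<comment> \<open>With y and z at least 1, both exponents may be lowered to s = min p q; the
    factor \<open>2 powr s\<close> in \<open>c2\<close> pays for passing from the power of the sum
    to the sum of the powers.\<close>
  have Q'_ge: "y' t + z' t \<ge> c2 * Q t powr s" if "t1 + 1/2 \<le> t" "t \<le> t1 + 1" for t
  proof -
    let ?c = "c * exp (- \<mu> * q)"
    have y1: "y t \<ge> 1" and z1: "z t \<ge> 1" using y_ge[of t] z_half[of t] m1 that by auto
    have "Q t powr s \<le> (2 * max (y t) (z t)) powr s"
      using y1 z1 s1 unfolding Q_def by (intro powr_mono2) auto
    also have "\<dots> = 2 powr s * max (y t) (z t) powr s" using y1 by (simp add: powr_mult)
    also have "max (y t) (z t) powr s \<le> y t powr s + z t powr s"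
      by (cases "y t \<le> z t") (auto simp: max_def)
    finally have "c2 * Q t powr s \<le> c2 * (2 powr s * (y t powr s + z t powr s))"
      using c20 by (intro mult_left_mono) auto
    also have "\<dots> = ?c * y t powr s + ?c * z t powr s"
      by (simp add: c2_def s_def field_simps)
    also have "?c * y t powr s \<le> ?c * y t powr p"
      using y1 c by (intro mult_left_mono powr_mono) (auto simp: s_def)
    also have "?c * y t powr p \<le> c * y t powr p" using lam q c by (intro mult_right_mono) auto
    also have "\<dots> \<le> z' t" using z'_ge[of t] that by simp
    also have "?c * z t powr s \<le> ?c * z t powr q"
      using z1 c by (intro mult_left_mono powr_mono) (auto simp: s_def)
    also have "\<dots> \<le> y' t" using y'_ge[of t] that by simp
    finally show ?thesis by simp
  qed
  \<comment> \<open>Separation of variables: Q^(-(s-1)) falls at least at rate (s - 1) c2, hence by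
    more than its initial value over half a unit, although it is nonnegative.\<close>
  have "- (Q (t1+1/2) powr (- (s - 1))) - (s - 1) * c2 * (t1 + 1/2) \<le>
        - (Q (t1+1) powr (- (s - 1))) - (s - 1) * c2 * (t1 + 1)"
  proof (rule mono_from_deriv[where f="\<lambda>t. - (Q t powr (- (s - 1))) - (s - 1) * c2 * t"
        and f'="\<lambda>t. (s - 1) * Q t powr (- s) * (y' t + z' t) - (s - 1) * c2"])
    show "continuous_on {t1+1/2..t1+1} (\<lambda>t. - (Q t powr (- (s - 1))) - (s - 1) * c2 * t)"
    proof -
      have "continuous_on {t1+1/2..t1+1} Q" unfolding Q_def
        by (intro continuous_intros continuous_on_subset[OF cy] continuous_on_subset[OF cz]) auto
      then show ?thesis using Q_ge m1 by (intro continuous_intros) (auto, fastforce)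
    qed
    fix x assume x: "t1 + 1/2 < x" "x < t1 + 1"
    have Qp: "Q x > 0" using Q_ge[of x] x m1 by auto
    show "((\<lambda>t. - (Q t powr (- (s - 1))) - (s - 1) * c2 * t) has_real_derivative
        (s - 1) * Q x powr (- s) * (y' x + z' x) - (s - 1) * c2) (at x)"
    proof -
      have dQ: "(Q has_real_derivative (y' x + z' x)) (at x)"
        unfolding Q_def using dy[of x] dz[of x] x by (intro DERIV_add) auto
      show ?thesis
        using DERIV_fun_powr[OF dQ Qp, of "- (s - 1)"]
        by (intro DERIV_cong[OF DERIV_diff[OF DERIV_minus DERIV_cmult_Id]]) (auto simp: algebra_simps)
    qed
    have "(s - 1) * c2 = (s - 1) * Q x powr (- s) * (c2 * Q x powr s)"
      using Qp by (simp add: powr_minus field_simps)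
    also have "\<dots> \<le> (s - 1) * Q x powr (- s) * (y' x + z' x)"
      using Q'_ge[of x] x s1 by (intro mult_left_mono) auto
    finally show "0 \<le> (s - 1) * Q x powr (- s) * (y' x + z' x) - (s - 1) * c2" by simp
  qed simp
  moreover have "Q (t1+1/2) powr (- (s - 1)) \<le> m powr (- (s - 1))"
    using Q_ge[of "t1+1/2"] m1 s1 by (intro powr_mono2') auto
  moreover have "Q (t1+1) powr (- (s - 1)) \<ge> 0" by simp
  moreover have "(s - 1) * c2 * (t1 + 1) = (s - 1) * c2 * (t1 + 1/2) + (s - 1) * c2 / 2"
    by (simp add: field_simps)
  moreover have "x < A / 2 \<Longrightarrow> - y - B \<le> - z - C \<Longrightarrow> y \<le> x \<Longrightarrow> 0 \<le> z \<Longrightarrow> C = B + A / 2 \<Longrightarrow> False"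
    for A B C x y z :: real by linarith
  ultimately show False using m3 by blast
qed

text \<open>The comparison function w solves w' = \<kappa> w^(pq) (1+t)^(-a) from w(0) = I
  \<epsilon> / 2, and z = w^(-r) is affine in the primitive L; Ts is the zero of z, the blow-up time
  of w. The time T1 \<le> Ts is the first at which w reaches M (1+t)^\<beta>. Up to T1, W dominates
  w; if T exceeds T1, blow-up takes at most one more unit.\<close>

lemma lifespan_via_primitive:
  fixes L :: "real \<Rightarrow> real" and m M \<kappa> Ts r a :: real
  defines "r \<equiv> p * q - 1" and "a \<equiv> \<beta> * (p * q - 1)"
  assumes L0: "L 0 = 0" and derL: "\<And>t. t \<ge> 0 \<Longrightarrow> (L has_real_derivative (1 + t) powr (- a)) (at t)"
    and m1: "m \<ge> 1" and m2: "c * m powr p \<ge> 2"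
    and m3: "m powr (- (min p q - 1)) < (min p q - 1) * (c * exp (- \<mu> * q) / 2 powr (min p q)) / 2"
    and m4: "M = m * 2 powr \<beta>" and m5: "I \<le> M"
    and k: "\<kappa> > 0" "\<kappa> * M powr r \<le> ln 2" "\<kappa> \<le> c * (c * exp (- \<mu>)) powr q * 2 powr (- (p * q))"
    and Ts: "Ts \<ge> 0" "L Ts = (I * \<epsilon> / 2) powr (- r) / (r * \<kappa>)"
  shows "T \<le> Ts + 1"
proof -
  have pq: "p * q > 1" using p q by (simp add: less_1_mult)
  have r: "r > 0" using pq by (simp add: r_def)
  have a: "a \<ge> 0" using beta pq by (simp add: a_def)
  have M: "M > 0" using m1 m4 by simp
  \<comment> \<open>Half the initial size: on the first unit interval, where no delayed value
    exists, W \<ge> I \<epsilon> = 2 w0 has to dominate w, which at most doubles there.\<close>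
  define w0 where "w0 = I * \<epsilon> / 2"
  have w0: "w0 > 0" using I eps by (simp add: w0_def)
  have w0M: "w0 < M"
  proof -
    have "I * \<epsilon> \<le> I" using I eps by simp
    then show ?thesis using m5 I unfolding w0_def by linarith
  qed
  define z where "z t = w0 powr (- r) - r * \<kappa> * L t" for t
  \<comment> \<open>In terms of w, z = h means w = M (1+t)^\<beta>, because a = r \<beta>.\<close>
  define h where "h t = M powr (- r) * (1 + t) powr (- a)" for t
  have contL: "continuous_on {0..} L"
    by (meson DERIV_isCont derL atLeast_iff continuous_at_imp_continuous_on)
  have contz: "continuous_on {0..} z" unfolding z_def by (intro continuous_intros contL)
  have conth: "continuous_on {0..} h" unfolding h_def by (intro continuous_intros) auto
  have z0: "z 0 > h 0"
    unfolding z_def h_def using w0 w0M M L0 r by (simp add: powr_less_mono2_neg)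
  have zTs: "z Ts = 0" using Ts r k by (simp add: z_def w0_def)
  have hpos: "h t > 0" if "t \<ge> 0" for t using that M by (simp add: h_def)
  \<comment> \<open>A closed condition on a compact interval; z - h is negative at Ts, so S is
    nonempty and has a least element, the first crossing.\<close>
  define S where "S = {t \<in> {0..Ts}. z t - h t \<in> {..0}}"
  have "closed ({0..Ts} \<inter> (\<lambda>t. z t - h t) -` {..0})"
    by (intro continuous_closed_preimage closed_atMost closed_atLeastAtMost continuous_intros
        continuous_on_subset[OF contz] continuous_on_subset[OF conth]) auto
  then have "closed S" unfolding S_def by (simp add: Int_def vimage_def)
  moreover have "bounded S" by (rule bounded_subset[of "{0..Ts}"]) (auto simp: S_def)
  ultimately have "compact S" by (simp add: compact_eq_bounded_closed)
  moreover have "Ts \<in> S" using Ts zTs hpos[of Ts] by (simp add: S_def)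
  ultimately obtain T1 where T1: "T1 \<in> S" "\<And>t. t \<in> S \<Longrightarrow> T1 \<le> t"
    using compact_attains_inf[of S] by auto
  have T1b: "0 \<le> T1" "T1 \<le> Ts" "z T1 \<le> h T1" using T1 by (auto simp: S_def)
  have zh: "z t > h t" if "0 \<le> t" "t < T1" for t
  proof (rule ccontr)
    assume "\<not> z t > h t"
    then have "t \<in> S" using that T1b by (simp add: S_def)
    then show False using T1(2)[of t] that by simp
  qed
  have zT1: "z T1 = h T1"
  proof (rule ccontr)
    assume "z T1 \<noteq> h T1"
    then have lt: "z T1 < h T1" using T1b by simp
    have "continuous_on {0..T1} (\<lambda>t. z t - h t)"
      by (intro continuous_intros continuous_on_subset[OF contz] continuous_on_subset[OF conth]) auto
    then obtain t where t: "0 \<le> t" "t \<le> T1" "z t - h t = 0"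
      using IVT2'[of "\<lambda>t. z t - h t" T1 0 0] lt z0 T1b by auto
    then have "t \<in> S" using T1b by (simp add: S_def)
    then have "t = T1" using T1(2)[of t] t by linarith
    then show False using t lt by simp
  qed
  have zh': "z t \<ge> h t" if "0 \<le> t" "t \<le> T1" for t using zh[of t] zT1 that by (cases "t = T1") auto
  have zpos: "z t > 0" if "0 \<le> t" "t \<le> T1" for t using zh'[OF that] hpos[OF that(1)] by linarith
  define w where "w t = z t powr (- 1 / r)" for t
  define w' where "w' t = \<kappa> * w t powr (p * q) * (1 + t) powr (- a)" for t
  have wpos: "w t > 0" if "0 \<le> t" "t \<le> T1" for t using zpos[OF that] by (simp add: w_def)
  have derw: "(w has_real_derivative w' t) (at t)" if "0 \<le> t" "t \<le> T1" for t
  proof -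
    have "(z has_real_derivative - (r * \<kappa> * (1 + t) powr (- a))) (at t)"
      unfolding z_def using derL[of t] that by (auto intro!: derivative_eq_intros)
    from DERIV_fun_powr[OF this zpos[OF that], of "- 1 / r"]
    have "(w has_real_derivative (- 1 / r) * z t powr (- 1 / r - 1) * - (r * \<kappa> * (1 + t) powr (- a))) (at t)"
      unfolding w_def by simp
    moreover have "w t powr (p * q) = z t powr (- 1 / r - 1)"
    proof -
      have "- 1 / r * (p * q) = - 1 / r - 1" using r by (simp add: r_def field_simps)
      then show ?thesis by (simp add: w_def powr_powr)
    qed
    ultimately show ?thesis using r by (simp add: w'_def mult_ac)
  qed
  have contw: "continuous_on {a..b} w" if "0 \<le> a" "b \<le> T1" for a b
    using derw[THEN DERIV_isCont] that by (intro continuous_at_imp_continuous_on) auto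
  have w'_ge0: "w' t \<ge> 0" for t using k by (simp add: w'_def)
  \<comment> \<open>Up to T1, w^r = 1/z \<le> 1/h = M^r (1+t)^a, so the logarithmic derivative of w
    is at most \<kappa> M^r \<le> ln 2.\<close>
  have w'_le: "w' t \<le> ln 2 * w t" if "0 \<le> t" "t \<le> T1" for t
  proof -
    have "w t powr r * (1 + t) powr (- a) \<le> M powr r"
    proof -
      have "w t powr r = z t powr (- 1 / r * r)" unfolding w_def by (rule powr_powr)
      also have "- 1 / r * r = - 1" using r by simp
      also have "z t powr (- 1) = 1 / z t" by (rule powr_neg_one[OF zpos[OF that]])
      finally have "w t powr r = 1 / z t" .
      moreover have "(1 + t) powr (- a) = M powr r * h t" using M by (simp add: h_def powr_minus field_simps)
      moreover have "h t / z t \<le> 1" using zh'[OF that] zpos[OF that] by simp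
      ultimately show ?thesis using mult_left_mono[of "h t / z t" 1 "M powr r"] by simp
    qed
    then have "\<kappa> * (w t powr r * (1 + t) powr (- a)) \<le> ln 2"
      using mult_left_mono[of "w t powr r * (1 + t) powr (- a)" "M powr r" \<kappa>] k by linarith
    then have "\<kappa> * (w t powr r * (1 + t) powr (- a)) * w t \<le> ln 2 * w t"
      using wpos[OF that] by (intro mult_right_mono) auto
    moreover have "w t powr (p * q) = w t powr r * w t"
      using wpos[OF that] by (simp add: r_def powr_diff)
    ultimately show ?thesis by (simp add: w'_def mult_ac)
  qed
  have w_double: "w t \<le> 2 * w s" if "0 \<le> s" "s \<le> t" "t \<le> s + 1" "t \<le> T1" for s t
  proof -
    have "- (exp (- ln 2 * s) * w s) \<le> - (exp (- ln 2 * t) * w t)"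
    proof (rule mono_from_deriv[where f="\<lambda>t. - (exp (- ln 2 * t) * w t)"
          and f'="\<lambda>t. exp (- ln 2 * t) * (ln 2 * w t - w' t)"])
      show "continuous_on {s..t} (\<lambda>t. - (exp (- ln 2 * t) * w t))"
        using that by (intro continuous_intros contw) auto
      show "((\<lambda>t. - (exp (- ln 2 * t) * w t)) has_real_derivative exp (- ln 2 * x) * (ln 2 * w x - w' x)) (at x)"
        if "s < x" "x < t" for x
        using derw[of x] that \<open>0 \<le> s\<close> \<open>t \<le> T1\<close> by (auto intro!: derivative_eq_intros simp: algebra_simps)
      show "0 \<le> exp (- ln 2 * x) * (ln 2 * w x - w' x)" if "s < x" "x < t" for x
        using w'_le[of x] that \<open>0 \<le> s\<close> \<open>t \<le> T1\<close> by simp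
    qed (use that in auto)
    then have "exp (- ln 2 * t) * w t \<le> exp (- ln 2 * s) * w s" by simp
    then have "exp (ln 2 * t) * (exp (- ln 2 * t) * w t) \<le> exp (ln 2 * t) * (exp (- ln 2 * s) * w s)"
      by (intro mult_left_mono) auto
    moreover have "exp (ln 2 * t) * (exp (- ln 2 * t) * w t) = w t"
      by (simp add: mult.assoc[symmetric] exp_add[symmetric])
    moreover have "exp (ln 2 * t) * (exp (- ln 2 * s) * w s) = exp (ln 2 * (t - s)) * w s"
      by (simp add: mult.assoc[symmetric] exp_add[symmetric] right_diff_distrib)
    ultimately have "w t \<le> exp (ln 2 * (t - s)) * w s" by (simp only:)
    also have "\<dots> \<le> exp (ln 2 * 1) * w s"
    proof (rule mult_right_mono)
      show "exp (ln 2 * (t - s)) \<le> exp (ln 2 * (1::real))"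
        using that mult_left_mono[of "t - s" 1 "ln 2"] by (subst exp_le_cancel_iff) auto
    qed (use that wpos[of s] in auto)
    finally show ?thesis by simp
  qed
  have wz: "w 0 = w0" using w0 r L0 by (simp add: w_def z_def powr_powr)
  \<comment> \<open>Induction over unit intervals: for x in the current one, the delayed value at x
    - 1 is covered by the induction hypothesis.\<close>
  have Ww: "W t \<ge> w t" if "0 \<le> t" "t \<le> T1" "t < T" "t \<le> real n + 1" for t n
    using that
  proof (induction n arbitrary: t)
    case 0
    then have "w t \<le> 2 * w0" using w_double[of 0 t] wz by simp
    also have "\<dots> = I * \<epsilon>" by (simp add: w0_def)
    also have "\<dots> \<le> W t" using W_ge 0 by simp
    finally show ?case .
  next
    case (Suc n)
    show ?case
    proof (cases "t \<le> real n + 1")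
      case True then show ?thesis using Suc by simp
    next
      case False
      define s where "s = real n + 1"
      have s: "1 \<le> s" "s < t" "t \<le> s + 1" using False Suc by (auto simp: s_def)
      have "W s - w s \<le> W t - w t"
      proof (rule mono_from_deriv[where f="\<lambda>t. W t - w t" and f'="\<lambda>t. W' t - w' t"])
        show "continuous_on {s..t} (\<lambda>t. W t - w t)"
          using s Suc by (intro continuous_intros contw contW') auto
        fix x assume x: "s < x" "x < t"
        show "((\<lambda>t. W t - w t) has_real_derivative W' x - w' x) (at x)"
          using derw[of x] derW[of x] x s Suc by (intro DERIV_diff) auto
        have IH: "w (x - 1) \<le> W (x - 1)" using Suc.IH[of "x - 1"] x s Suc.prems by (simp add: s_def)
        have wp: "w (x - 1) > 0" using wpos[of "x-1"] x s Suc.prems by simp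
        \<comment> \<open>Doubling replaces w(x) by w(x - 1) at the price 2^(pq), which the third
          condition on \<kappa> compensates.\<close>
        have "w x powr (p * q) \<le> (2 * w (x - 1)) powr (p * q)"
          using w_double[of "x-1" x] wpos[of x] x s Suc.prems pq by (intro powr_mono2) auto
        also have "\<dots> = 2 powr (p * q) * w (x - 1) powr (p * q)"
          by (rule powr_mult)
        also have "\<dots> \<le> 2 powr (p * q) * W (x - 1) powr (p * q)"
          using IH wp pq by (intro mult_left_mono powr_mono2) auto
        finally have 1: "w x powr (p * q) \<le> 2 powr (p * q) * W (x - 1) powr (p * q)" .
        have "\<kappa> * w x powr (p * q) \<le> (c * (c * exp (- \<mu>)) powr q * 2 powr (- (p * q))) * (2 powr (p * q) * W (x - 1) powr (p * q))"
          using k 1 c by (intro mult_mono) auto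
        also have "\<dots> = c * (c * exp (- \<mu>)) powr q * W (x - 1) powr (p * q)"
          by (simp add: powr_minus)
        finally have "w' x \<le> c * (c * exp (- \<mu>)) powr q * W (x - 1) powr (p * q) * (1 + x) powr (- a)"
          unfolding w'_def by (intro mult_right_mono) auto
        also have "\<dots> \<le> W' x" using W'_delay[of x] x s Suc.prems by (simp add: a_def)
        finally show "0 \<le> W' x - w' x" by simp
      qed (use s in simp)
      moreover have "w s \<le> W s" using Suc.IH[of s] s Suc.prems by (simp add: s_def)
      ultimately show ?thesis by simp
    qed
  qed
  show ?thesis
  proof (cases "T1 < T")
    case False then show ?thesis using T1b by simp
  next
    case True
    obtain n where "T1 \<le> real n" using real_arch_simple by blast
    then have "W T1 \<ge> w T1" using Ww[of T1 n] T1b True by simp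
    also have "w T1 = M * (1 + T1) powr \<beta>"
    proof -
      have "a = r * \<beta>" by (simp add: a_def r_def)
      then show ?thesis using M T1b r by (simp add: w_def zT1 h_def powr_mult powr_powr)
    qed
    finally have "T \<le> T1 + 1"
      using blowup_within_unit_time[OF m1 m2 m3 T1b(1) True] m4 by simp
    then show ?thesis using T1b by simp
  qed
qed

end

text \<open>All constants are fixed before T, \<epsilon> and the solution: m large for blow-up
  within a unit, then M, then \<kappa> small for doubling and for the delay. The remaining equation
  L Ts = K \<epsilon>^(-r) is solved explicitly, by a power for a < 1 and by an exponential for a =
  1.\<close>

lemma coupled_system_lifespan:
  fixes p q \<beta> c \<mu> I :: real
  assumes "p > 1" "q > 1" "\<beta> \<ge> 0" "c > 0" "\<mu> > 0" "I > 0" "\<beta> * (p * q - 1) \<le> 1"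
  shows "\<exists>C>0. \<forall>T \<epsilon> W W' X X'. coupled_system p q \<beta> c \<mu> I T \<epsilon> W W' X X' \<longrightarrow>
     T \<le> (if \<beta> * (p * q - 1) < 1 then C * \<epsilon> powr (- (p * q - 1) / (1 - \<beta> * (p * q - 1)))
          else exp (C * \<epsilon> powr (- (p * q - 1))))"
proof -
  define r where "r = p * q - 1"
  define a where "a = \<beta> * r"
  have r: "r > 0" using assms by (simp add: r_def less_1_mult)
  have a: "0 \<le> a" "a \<le> 1" using assms r by (auto simp: a_def r_def)
  define s where "s = min p q"
  have s: "s > 1" using assms by (simp add: s_def)
  define \<eta> where "\<eta> = (s - 1) * (c * exp (- \<mu> * q) / 2 powr s) / 2"
  have eta: "\<eta> > 0" using s assms by (simp add: \<eta>_def)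
  have "eventually (\<lambda>m. m \<ge> max 1 I \<and> c * m powr p \<ge> 2 \<and> m powr (- (s - 1)) < \<eta>) at_top"
  proof (intro eventually_conj)
    show "eventually (\<lambda>m. m \<ge> max 1 I) at_top" by (rule eventually_ge_at_top)
    show "eventually (\<lambda>m. c * m powr p \<ge> 2) at_top"
      using eventually_ge_at_top[of "max 1 (2 / c)"]
    proof eventually_elim
      case (elim m)
      then have "2 / c \<le> m powr 1" by simp
      also have "\<dots> \<le> m powr p" using elim assms by (intro powr_mono) auto
      finally show ?case using assms by (simp add: field_simps)
    qed
    have "((\<lambda>m. m powr (- (s - 1))) \<longlongrightarrow> 0) (at_top::real filter)"
      using s by (intro tendsto_neg_powr filterlim_ident) auto
    then show "eventually (\<lambda>m. m powr (- (s - 1)) < \<eta>) at_top"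
      using order_tendstoD(2) eta by blast
  qed
  then obtain m where m: "m \<ge> max 1 I" "c * m powr p \<ge> 2" "m powr (- (s - 1)) < \<eta>"
    using eventually_happens by fastforce
  define M where "M = m * 2 powr \<beta>"
  have "2 powr \<beta> \<ge> 1" using assms by (simp add: ge_one_powr_ge_zero)
  then have "m * 1 \<le> M" unfolding M_def using m by (intro mult_left_mono) auto
  then have M: "M \<ge> I" "M > 0" using m by auto
  define \<kappa> where "\<kappa> = min (ln 2 / M powr r) (c * (c * exp (- \<mu>)) powr q * 2 powr (- (p * q)))"
  have k0: "\<kappa> > 0" using assms M by (simp add: \<kappa>_def)
  have "\<kappa> * M powr r \<le> (ln 2 / M powr r) * M powr r"
    by (intro mult_right_mono) (auto simp: \<kappa>_def)
  then have k1: "\<kappa> * M powr r \<le> ln 2" using M by simp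
  define K where "K = (I / 2) powr (- r) / (r * \<kappa>)"
  have K: "K > 0" using assms r k0 by (simp add: K_def)
  have main: "T \<le> Ts + 1"
    if "coupled_system p q \<beta> c \<mu> I T \<epsilon> W W' X X'" "L 0 = 0" "Ts \<ge> 0" "L Ts = K * \<epsilon> powr (- r)"
      "\<And>t. t \<ge> 0 \<Longrightarrow> (L has_real_derivative (1 + t) powr (- a)) (at t)" for T \<epsilon> W W' X X' L Ts
  proof -
    interpret coupled_system p q \<beta> c \<mu> I T \<epsilon> W W' X X' by fact
    have "I * \<epsilon> / 2 = I / 2 * \<epsilon>" by simp
    then have "(I * \<epsilon> / 2) powr (- r) = (I / 2) powr (- r) * \<epsilon> powr (- r)"
      using I eps by (simp only: powr_mult)
    then have LT: "L Ts = (I * \<epsilon> / 2) powr (- r) / (r * \<kappa>)" using that(4) by (simp add: K_def)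
    show ?thesis
      by (rule lifespan_via_primitive[of L m M \<kappa>])
        (use that m M M_def k0 k1 LT in \<open>auto simp: r_def a_def s_def \<eta>_def \<kappa>_def\<close>)
  qed
  have ee: "\<epsilon> powr (- r) \<ge> 1" if "0 < \<epsilon>" "\<epsilon> \<le> 1" for \<epsilon> :: real
    using powr_mono2'[of "- r" \<epsilon> 1] that r by simp
  show ?thesis
  proof (cases "a < 1")
    case True
    define C where "C = (1 + (1 - a) * K) powr (1 / (1 - a))"
    have D: "1 + (1 - a) * K > 1" using True K by simp
    have "T \<le> C * \<epsilon> powr (- r / (1 - a))" if cs: "coupled_system p q \<beta> c \<mu> I T \<epsilon> W W' X X'" for T \<epsilon> W W' X X'
    proof -
      interpret coupled_system p q \<beta> c \<mu> I T \<epsilon> W W' X X' by fact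
      \<comment> \<open>B is the value of (1 + Ts)^(1-a), so the extra unit of time cancels the
        shift by 1.\<close>
      define B where "B = 1 + (1 - a) * (K * \<epsilon> powr (- r))"
      have B: "B \<ge> 1" using True K by (simp add: B_def)
      define L where "L t = ((1 + t) powr (1 - a) - 1) / (1 - a)" for t :: real
      have "T \<le> (B powr (1 / (1 - a)) - 1) + 1"
      proof (rule main[OF cs, of L])
        show "L 0 = 0" by (simp add: L_def)
        show "B powr (1 / (1 - a)) - 1 \<ge> 0" using B True by (simp add: ge_one_powr_ge_zero)
        show "L (B powr (1 / (1 - a)) - 1) = K * \<epsilon> powr (- r)"
          using B True by (simp add: L_def powr_powr) (simp add: B_def)
        show "(L has_real_derivative (1 + t) powr (- a)) (at t)" if "t \<ge> 0" for t
          unfolding L_def using that True by (auto intro!: derivative_eq_intros)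
      qed
      also have "\<dots> = B powr (1 / (1 - a))" by simp
      \<comment> \<open>Since \<epsilon> \<le> 1, also \<epsilon>^(-r) \<ge> 1, and the summand 1 of
        B is absorbed.\<close>
      also have "\<dots> \<le> ((1 + (1 - a) * K) * \<epsilon> powr (- r)) powr (1 / (1 - a))"
        using B True ee[OF eps] by (intro powr_mono2) (auto simp: B_def algebra_simps)
      also have "\<dots> = C * \<epsilon> powr (- r / (1 - a))"
        using D by (simp add: powr_mult powr_powr C_def)
      finally show ?thesis .
    qed
    moreover have "C > 0" using D by (simp add: C_def)
    ultimately show ?thesis using True by (intro exI[of _ C]) (simp add: r_def[symmetric] a_def[symmetric])
  next
    case False
    then have a1: "a = 1" using a by simp
    have "T \<le> exp (K * \<epsilon> powr (- r))" if cs: "coupled_system p q \<beta> c \<mu> I T \<epsilon> W W' X X'" for T \<epsilon> W W' X X'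
    proof -
      interpret coupled_system p q \<beta> c \<mu> I T \<epsilon> W W' X X' by fact
      have "T \<le> (exp (K * \<epsilon> powr (- r)) - 1) + 1"
      proof (rule main[OF cs, of "\<lambda>t. ln (1 + t)"])
        show "exp (K * \<epsilon> powr (- r)) - 1 \<ge> 0" using K by simp
        show "((\<lambda>t. ln (1 + t)) has_real_derivative (1 + t) powr (- a)) (at t)" if "t \<ge> 0" for t
          using that a1 by (auto intro!: derivative_eq_intros simp: powr_minus_divide)
      qed auto
      then show ?thesis by simp
    qed
    then show ?thesis using False K a1 by (intro exI[of _ K]) (simp add: r_def[symmetric] a_def[symmetric])
  qed
qed

subsection \<open>Integral inequalities for the averaged functionals\<close>

lemma integral_increment:
  fixes f :: "real \<Rightarrow> real"
  assumes "f integrable_on {0..t}" "0 \<le> t0" "t0 \<le> t"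
  shows "integral {0..t} f - integral {0..t0} f = integral {t0..t} f"
  using Henstock_Kurzweil_Integration.integral_combine[of 0 t0 t f] assms by simp

lemma integral_deriv_at:
  fixes f :: "real \<Rightarrow> real"
  assumes "continuous_on {0..<T} f" "0 < t" "t < T"
  shows "((\<lambda>t. integral {0..t} f) has_real_derivative f t) (at t)"
proof -
  obtain u where u: "t < u" "u < T" using assms dense by blast
  have "continuous_on {0..u} f" by (rule continuous_on_subset[OF assms(1)]) (use u in auto)
  then have "((\<lambda>t. integral {0..t} f) has_real_derivative f t) (at t within {0..u})"
    by (rule integral_has_real_derivative) (use u assms in auto)
  then show ?thesis using u assms by (simp add: at_within_Icc_at)
qed

text \<open>Integrability is assumed only up to times below T, so continuity at t is taken from a
  compact interval ending strictly between t and T.\<close>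

lemma continuous_integral:
  fixes f :: "real \<Rightarrow> real"
  assumes "\<And>t. 0 \<le> t \<Longrightarrow> t < T \<Longrightarrow> f integrable_on {0..t}"
  shows "continuous_on {0..<T} (\<lambda>t. integral {0..t} f)"
proof -
  have "continuous (at t within {0..<T}) (\<lambda>t. integral {0..t} f)" if t: "0 \<le> t" "t < T" for t
  proof -
    obtain u where u: "t < u" "u < T" using t dense by blast
    have "continuous_on {0..u} (\<lambda>t. integral {0..t} f)"
      by (rule indefinite_integral_continuous_1) (use assms u t in auto)
    then have "continuous (at t within {0..u}) (\<lambda>t. integral {0..t} f)"
      using t u by (simp add: continuous_on_eq_continuous_within)
    moreover have "at t within {0..u} = at t within {0..<T}"
      by (rule at_within_nhd[of t "{..<u}"]) (use t u in auto)
    ultimately show ?thesis by simp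
  qed
  then show ?thesis by (simp add: continuous_on_eq_continuous_within)
qed

lemma integral_eq_diff:
  fixes f F :: "real \<Rightarrow> real"
  assumes "0 \<le> t" "continuous_on {0..t} F"
    and "\<And>s. 0 < s \<Longrightarrow> s < t \<Longrightarrow> (F has_real_derivative f s) (at s)"
  shows "integral {0..t} f = F t - F 0"
  using fundamental_theorem_of_calculus_interior[of 0 t F f] assms
  by (intro integral_unique) (auto simp: has_real_derivative_iff_has_vector_derivative)

lemma set_integrable_mult_continuous:
  fixes b f :: "real \<Rightarrow> real"
  assumes "set_integrable lborel {c..d} b" "continuous_on {c..d} f"
  shows "set_integrable lborel {c..d} (\<lambda>s. b s * f s)"
proof -
  have "compact (f ` {c..d})" using assms compact_continuous_image by blast
  then obtain M where M: "\<And>s. s \<in> {c..d} \<Longrightarrow> \<bar>f s\<bar> \<le> M"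
    by (meson compact_imp_bounded bounded_real image_eqI)
  have fm: "(\<lambda>s. indicator {c..d} s *\<^sub>R f s) \<in> borel_measurable lborel"
    using assms(2) borel_measurable_continuous_on_indicator[of "{c..d}" f] by simp
  have bi: "integrable lborel (\<lambda>s. indicator {c..d} s *\<^sub>R b s)"
    using assms(1) by (simp add: set_integrable_def)
  have eq: "(\<lambda>s. indicator {c..d} s *\<^sub>R (b s * f s)) =
     (\<lambda>s. (indicator {c..d} s *\<^sub>R b s) * (indicator {c..d} s *\<^sub>R f s))"
    by (auto simp: indicator_def)
  have "integrable lborel (\<lambda>s. (indicator {c..d} s *\<^sub>R b s) * (indicator {c..d} s *\<^sub>R f s))"
  proof (rule Bochner_Integration.integrable_bound[where f="\<lambda>s. M * (indicator {c..d} s *\<^sub>R b s)"])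
    show "integrable lborel (\<lambda>s. M * (indicator {c..d} s *\<^sub>R b s))" using bi by simp
    show "(\<lambda>s. (indicator {c..d} s *\<^sub>R b s) * (indicator {c..d} s *\<^sub>R f s)) \<in> borel_measurable lborel"
      using bi fm by (intro borel_measurable_times) auto
    show "AE s in lborel. norm ((indicator {c..d} s *\<^sub>R b s) * (indicator {c..d} s *\<^sub>R f s))
        \<le> norm (M * (indicator {c..d} s *\<^sub>R b s))"
    proof (rule AE_I2)
      fix s
      have "\<bar>b s\<bar> * \<bar>f s\<bar> \<le> \<bar>M\<bar> * \<bar>b s\<bar>" if "s \<in> {c..d}"
        using M[OF that] by (subst mult.commute) (intro mult_right_mono, auto)
      then show "norm ((indicator {c..d} s *\<^sub>R b s) * (indicator {c..d} s *\<^sub>R f s))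
        \<le> norm (M * (indicator {c..d} s *\<^sub>R b s))" by (auto simp: indicator_def abs_mult)
    qed
  qed
  then show ?thesis unfolding set_integrable_def eq .
qed

section \<open>Monotonicity and first-touching arguments for integral equations\<close>

lemma continuous_nbhd:
  fixes f :: "real \<Rightarrow> real"
  assumes "continuous_on {0..<T} f" "0 \<le> t0" "t0 < T" "e > 0"
  obtains d where "d > 0" "\<And>t. 0 \<le> t \<Longrightarrow> t < T \<Longrightarrow> \<bar>t - t0\<bar> < d \<Longrightarrow> \<bar>f t - f t0\<bar> < e"
  using assms unfolding continuous_on_iff dist_real_def by (metis atLeastLessThan_iff)

text \<open>E is merely monotone, so Y cannot be differentiated. Freezing E at the final time t
  works: with Z = y0 - \<mu> \<integral>Y, the function e^(\<mu> s) (Z(s) + E(t)) has derivative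
  \<mu> e^(\<mu> s) (E(t) - E(s)) \<ge> 0.\<close>

lemma damped_integral_nonneg:
  fixes Y E :: "real \<Rightarrow> real"
  assumes contY: "continuous_on {0..<T} Y" and mu: "\<mu> > 0" and y0: "y0 \<ge> 0" and E0: "E 0 \<ge> 0"
    and mono: "\<And>s t. 0 \<le> s \<Longrightarrow> s \<le> t \<Longrightarrow> t < T \<Longrightarrow> E s \<le> E t"
    and eq: "\<And>t. 0 \<le> t \<Longrightarrow> t < T \<Longrightarrow> Y t = y0 + E t - \<mu> * integral {0..t} Y"
    and t: "0 \<le> t" "t < T"
  shows "Y t \<ge> 0"
proof -
  define Z where "Z s = y0 - \<mu> * integral {0..s} Y" for s
  have "exp (\<mu> * 0) * (Z 0 + E t) \<le> exp (\<mu> * t) * (Z t + E t)"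
  proof (rule mono_from_deriv[where f="\<lambda>s. exp (\<mu> * s) * (Z s + E t)"
        and f'="\<lambda>s. \<mu> * exp (\<mu> * s) * (E t - E s)"])
    have "continuous_on {0..<T} (\<lambda>t. integral {0..t} Y)"
      by (rule continuous_integral) (auto intro!: integrable_continuous_real continuous_on_subset[OF contY])
    then have "continuous_on {0..<T} (\<lambda>s. exp (\<mu> * s) * (Z s + E t))"
      unfolding Z_def by (intro continuous_intros)
    then show "continuous_on {0..t} (\<lambda>s. exp (\<mu> * s) * (Z s + E t))"
      by (rule continuous_on_subset) (use t in auto)
    fix x assume x: "0 < x" "x < t"
    have "(Z has_real_derivative - \<mu> * Y x) (at x)" unfolding Z_def
      using integral_deriv_at[OF contY, of x] x t by (auto intro!: derivative_eq_intros)
    then have "((\<lambda>s. exp (\<mu> * s) * (Z s + E t)) has_real_derivative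
        \<mu> * exp (\<mu> * x) * (Z x + E t) - \<mu> * exp (\<mu> * x) * Y x) (at x)"
      by (auto intro!: derivative_eq_intros simp: algebra_simps)
    moreover have "Y x = Z x + E x" using eq[of x] x t by (simp add: Z_def)
    ultimately show "((\<lambda>s. exp (\<mu> * s) * (Z s + E t)) has_real_derivative \<mu> * exp (\<mu> * x) * (E t - E x)) (at x)"
      by (simp add: algebra_simps)
    show "0 \<le> \<mu> * exp (\<mu> * x) * (E t - E x)" using mono[of x t] x t mu by simp
  qed (use t in simp)
  moreover have "0 \<le> Z 0 + E t" using y0 E0 mono[of 0 t] t by (simp add: Z_def)
  ultimately have "0 \<le> exp (\<mu> * t) * (Z t + E t)" by simp
  then show ?thesis using eq[OF t] by (simp add: Z_def zero_le_mult_iff)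
qed

text \<open>Since \<open>b\<close> is merely integrable there is no integrating factor of class \<open>C\<^sup>1\<close>; instead \<open>f\<close> is compared
  with the barrier at the first time where they touch, the rate 4 leaving room for the error terms.\<close>

lemma exp_lower_barrier:
  fixes f b G :: "real \<Rightarrow> real"
  defines "B \<equiv> \<lambda>t. integral {0..t} b"
  assumes contf: "continuous_on {0..<T} f" and contG: "continuous_on {0..<T} G"
    and monoG: "\<And>s t. 0 \<le> s \<Longrightarrow> s \<le> t \<Longrightarrow> t < T \<Longrightarrow> G s \<le> G t" and G0: "G 0 = 0"
    and b: "set_integrable lborel {0..} b" "\<And>t. t \<ge> 0 \<Longrightarrow> b t \<ge> 0"
    and k: "k > 0" and \<delta>: "\<delta> > 0" and f0: "f 0 \<ge> \<delta> * k"
    and touch: "\<And>t0. \<lbrakk>0 \<le> t0; t0 < T; \<And>s. 0 \<le> s \<Longrightarrow> s \<le> t0 \<Longrightarrow> f s \<ge> \<delta> * (k + G s) * exp (- 4 * B s);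
        f t0 = \<delta> * (k + G t0) * exp (- 4 * B t0)\<rbrakk> \<Longrightarrow>
        \<exists>d>0. \<forall>t. t0 < t \<and> t < t0 + d \<and> t < T \<longrightarrow>
          f t - f t0 \<ge> \<delta> * (G t - G t0) - integral {t0..t} (\<lambda>s. b s * f s)"
    and t: "0 \<le> t" "t < T"
  shows "f t \<ge> \<delta> * (k + G t) * exp (- 4 * B t)"
proof (rule ccontr)
  define K where "K t = \<delta> * (k + G t) * exp (- 4 * B t)" for t
  define A where "A = {t \<in> {0..<T}. f t < K t}"
  assume "\<not> ?thesis"
  then have tA: "t \<in> A" using t by (simp add: A_def K_def)
  have bint: "set_integrable lborel {c..d} b" if "0 \<le> c" for c d
    by (rule set_integrable_subset[OF b(1)]) (use that in auto)
  have bHK: "b integrable_on {c..d}" if "0 \<le> c" for c d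
    using set_borel_integral_eq_integral(1)[OF bint[OF that]] .
  have B0: "B 0 = 0" by (simp add: B_def)
  have Binc: "B t - B s = integral {s..t} b" if "0 \<le> s" "s \<le> t" for s t
    unfolding B_def using that bHK by (intro integral_increment) auto
  have Bmono: "B s \<le> B t" if "0 \<le> s" "s \<le> t" for s t
    using Binc[OF that] integral_nonneg[OF bHK[OF that(1), of t]] b(2) that by force
  have contB: "continuous_on {0..<T} B" unfolding B_def using bHK by (intro continuous_integral) auto
  have contK: "continuous_on {0..<T} K" unfolding K_def by (intro continuous_intros contG contB)
  have G_ge: "G s \<ge> 0" if "0 \<le> s" "s < T" for s using monoG[of 0 s] G0 that by simp
  have Kpos: "K s > 0" if "0 \<le> s" "s < T" for s using G_ge[OF that] k \<delta> by (simp add: K_def add_pos_nonneg)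
  define t0 where "t0 = Inf A"
  have bdd: "bdd_below A" by (rule bdd_belowI[of _ 0]) (auto simp: A_def)
  have t0: "0 \<le> t0" "t0 \<le> t" unfolding t0_def using tA bdd
    by (auto intro!: cInf_greatest cInf_lower simp: A_def)
  then have t0T: "t0 < T" using t by simp
  have below: "f s \<ge> K s" if "0 \<le> s" "s < t0" for s
    using cInf_lower[OF _ bdd, of s] that t0T by (force simp: A_def t0_def)
  have contD: "continuous_on {0..<T} (\<lambda>s. f s - K s)" by (intro continuous_intros contf contK)
  have near: "\<exists>s\<in>A. s < t0 + d" if "d > 0" for d
    using cInf_less_iff[of A "t0 + d"] tA bdd that by (auto simp: t0_def)
  \<comment> \<open>By continuity t0 is a touching point: the bound holds before t0, or at time 0 by
    \<open>f0\<close>, and fails arbitrarily close to t0 afterwards.\<close>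
  have ge: "f t0 \<ge> K t0"
  proof (rule ccontr)
    assume "\<not> f t0 \<ge> K t0"
    then have *: "K t0 - f t0 > 0" by simp
    have "t0 \<noteq> 0" using * f0 B0 G0 by (auto simp: K_def)
    then have "t0 > 0" using t0 by simp
    obtain d where d: "d > 0" "\<And>t. 0 \<le> t \<Longrightarrow> t < T \<Longrightarrow> \<bar>t - t0\<bar> < d \<Longrightarrow> \<bar>(f t - K t) - (f t0 - K t0)\<bar> < K t0 - f t0"
      using continuous_nbhd[OF contD t0(1) t0T *] by blast
    define s where "s = max 0 (t0 - d / 2)"
    have "0 \<le> s" "s < t0" "\<bar>s - t0\<bar> < d" using \<open>t0 > 0\<close> d(1) by (auto simp: s_def)
    then show False using d(2)[of s] below[of s] t0T by auto
  qed
  have le: "f t0 \<le> K t0"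
  proof (rule ccontr)
    assume "\<not> f t0 \<le> K t0"
    then have *: "f t0 - K t0 > 0" by simp
    obtain d where d: "d > 0" "\<And>t. 0 \<le> t \<Longrightarrow> t < T \<Longrightarrow> \<bar>t - t0\<bar> < d \<Longrightarrow> \<bar>(f t - K t) - (f t0 - K t0)\<bar> < f t0 - K t0"
      using continuous_nbhd[OF contD t0(1) t0T *] by blast
    obtain s where s: "s \<in> A" "s < t0 + d" using near d by blast
    then have "t0 \<le> s" using cInf_lower[OF _ bdd] by (simp add: t0_def)
    then show False using d(2)[of s] s by (auto simp: A_def)
  qed
  have eq: "f t0 = K t0" using ge le by simp
  have "\<And>s. 0 \<le> s \<Longrightarrow> s \<le> t0 \<Longrightarrow> f s \<ge> K s" using below ge by (metis less_eq_real_def)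
  then obtain d1 where d1: "d1 > 0" "\<And>t. t0 < t \<Longrightarrow> t < t0 + d1 \<Longrightarrow> t < T \<Longrightarrow>
          f t - f t0 \<ge> \<delta> * (G t - G t0) - integral {t0..t} (\<lambda>s. b s * f s)"
    using touch[OF t0(1) t0T] eq unfolding K_def by blast
  have fp: "f t0 > 0" using eq Kpos t0 t0T by simp
  obtain d2 where d2: "d2 > 0" "\<And>t. 0 \<le> t \<Longrightarrow> t < T \<Longrightarrow> \<bar>t - t0\<bar> < d2 \<Longrightarrow> \<bar>f t - f t0\<bar> < f t0 / 2"
    using continuous_nbhd[OF contf t0(1) t0T, of "f t0 / 2"] fp by auto
  obtain d3 where d3: "d3 > 0" "\<And>t. 0 \<le> t \<Longrightarrow> t < T \<Longrightarrow> \<bar>t - t0\<bar> < d3 \<Longrightarrow> \<bar>B t - B t0\<bar> < 1 / 4"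
    using continuous_nbhd[OF contB t0(1) t0T, of "1 / 4"] by auto
  obtain s where s: "s \<in> A" "s < t0 + min d1 (min d2 d3)" using near[of "min d1 (min d2 d3)"] d1 d2 d3 by auto
  have sT: "0 \<le> s" "s < T" "f s < K s" using s by (auto simp: A_def)
  have "t0 \<le> s" using cInf_lower[OF _ bdd] s by (simp add: t0_def)
  moreover have "s \<noteq> t0" using eq sT by auto
  ultimately have s0: "t0 < s" by simp
  \<comment> \<open>x is the mass of b between t0 and s. As f stays below 3/2 of its value at t0,
    the damping removes at most 3x/2 times that value, while the barrier falls by the factor exp
    (-4x).\<close>
  define x where "x = B s - B t0"
  have x: "0 \<le> x" "x < 1 / 4" using Bmono[of t0 s] d3(2)[of s] s s0 sT t0 by (auto simp: x_def)
  have contf': "continuous_on {t0..s} f" by (rule continuous_on_subset[OF contf]) (use t0 sT in auto)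
  have "integral {t0..s} (\<lambda>s. b s * f s) \<le> integral {t0..s} (\<lambda>s. b s * (3 / 2 * f t0))"
  proof (rule integral_le)
    show "(\<lambda>s. b s * f s) integrable_on {t0..s}"
      using set_borel_integral_eq_integral(1)[OF set_integrable_mult_continuous[OF bint[OF t0(1)] contf']] .
    show "(\<lambda>s. b s * (3 / 2 * f t0)) integrable_on {t0..s}"
      using bHK[OF t0(1)] by (rule integrable_on_mult_left)
    show "b y * f y \<le> b y * (3 / 2 * f t0)" if "y \<in> {t0..s}" for y
    proof (rule mult_left_mono)
      have "\<bar>y - t0\<bar> < d2" "0 \<le> y" "y < T" using that s sT t0 by auto
      then show "f y \<le> 3 / 2 * f t0" using d2(2)[of y] by linarith
    qed (use that b t0 in auto)
  qed
  also have "\<dots> = x * (3 / 2 * f t0)" unfolding x_def using Binc[of t0 s] t0 s0 by simp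
  finally have i: "integral {t0..s} (\<lambda>s. b s * f s) \<le> x * (3 / 2 * f t0)" .
  have fs: "f s \<ge> f t0 + \<delta> * (G s - G t0) - x * (3 / 2 * f t0)"
  proof -
    have "s < t0 + d1" using s by simp
    then show ?thesis using d1(2)[of s] i s0 sT(2) by linarith
  qed
  have dG: "G s - G t0 \<ge> 0" using monoG[of t0 s] t0 s0 sT by simp
  have "K s = exp (- 4 * x) * K t0 + \<delta> * (G s - G t0) * exp (- 4 * B s)"
    unfolding K_def x_def by (simp add: algebra_simps exp_diff exp_add exp_minus divide_simps)
  also have "exp (- 4 * x) * K t0 \<le> (1 - 3 / 2 * x) * K t0"
  proof (rule mult_right_mono)
    \<comment> \<open>The product is 1 + 5x/2 - 6x^2, which is at least 1 for 0 \<le> x < 1/4; this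
      is the room provided by the rate 4.\<close>
    have "1 \<le> (1 - 3 / 2 * x) * (1 + 4 * x)"
    proof -
      have "x * (5 / 2 - 6 * x) \<ge> 0" using x by (intro mult_nonneg_nonneg) auto
      then show ?thesis by (simp add: algebra_simps)
    qed
    also have "\<dots> \<le> (1 - 3 / 2 * x) * exp (4 * x)"
      using x exp_ge_add_one_self[of "4 * x"] by (intro mult_left_mono) auto
    finally show "exp (- 4 * x) \<le> 1 - 3 / 2 * x" by (simp add: exp_minus field_simps)
  qed (use Kpos[of t0] t0 t0T in simp)
  also have "\<delta> * (G s - G t0) * exp (- 4 * B s) \<le> \<delta> * (G s - G t0) * 1"
    using dG \<delta> Bmono[of 0 s] B0 sT by (intro mult_left_mono) auto
  finally have "K s \<le> (1 - 3 / 2 * x) * f t0 + \<delta> * (G s - G t0)" using eq by simp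
  then show False using fs sT(3) by (simp add: algebra_simps)
qed

lemma nonneg_of_deriv_ge:
  fixes V :: "real \<Rightarrow> real"
  assumes "continuous_on {0..t} V" "V 0 \<ge> 0" "0 \<le> t"
    and "\<And>s. 0 < s \<Longrightarrow> s < t \<Longrightarrow> (V has_real_derivative V' s) (at s)"
    and "\<And>s. 0 < s \<Longrightarrow> s < t \<Longrightarrow> V' s + k * V s \<ge> 0"
  shows "V t \<ge> 0"
proof -
  have "exp (k * 0) * V 0 \<le> exp (k * t) * V t"
  proof (rule mono_from_deriv[where f="\<lambda>s. exp (k * s) * V s" and f'="\<lambda>s. exp (k * s) * (V' s + k * V s)"])
    show "continuous_on {0..t} (\<lambda>s. exp (k * s) * V s)" by (intro continuous_intros assms)
    show "((\<lambda>s. exp (k * s) * V s) has_real_derivative exp (k * x) * (V' x + k * V x)) (at x)" if "0 < x" "x < t" for x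
      using assms(4)[OF that] by (auto intro!: derivative_eq_intros simp: algebra_simps)
  qed (use assms in auto)
  then have "0 \<le> exp (k * t) * V t" using assms(2) by simp
  then show ?thesis by (simp add: zero_le_mult_iff)
qed

text \<open>In the sum S = V1 + V the coupling cancels, formally S' = G' - b V1, so a barrier for S
  comes first. Where V1 touches a quarter of that barrier, 0 < V1 \<le> S/4 and hence V1 < V; then
  V' = V1 - V < 0 nearby, and V1 gains at least what S gains. A fraction below 1/2 is what forces V1
  < V.\<close>

lemma scattering_lower_bound:
  fixes V V1 b G :: "real \<Rightarrow> real"
  assumes contV: "continuous_on {0..<T} V" and contV1: "continuous_on {0..<T} V1"
    and derV: "\<And>t. 0 < t \<Longrightarrow> t < T \<Longrightarrow> (V has_real_derivative V1 t - V t) (at t)"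
    and V0: "V 0 \<ge> 0" and e: "e > 0"
    and contG: "continuous_on {0..<T} G"
    and monoG: "\<And>s t. 0 \<le> s \<Longrightarrow> s \<le> t \<Longrightarrow> t < T \<Longrightarrow> G s \<le> G t" and G0: "G 0 = 0"
    and b: "set_integrable lborel {0..} b" "\<And>t. t \<ge> 0 \<Longrightarrow> b t \<ge> 0"
    and eq: "\<And>t. 0 \<le> t \<Longrightarrow> t < T \<Longrightarrow>
      V1 t + integral {0..t} (\<lambda>s. V1 s - V s) + integral {0..t} (\<lambda>s. b s * V1 s) = e + G t"
    and t: "0 \<le> t" "t < T"
  shows "V1 t \<ge> 1 / 4 * (e + G t) * exp (- 4 * integral {0..t} b)"
proof -
  have bint: "set_integrable lborel {c..d} b" if "0 \<le> c" for c d
    by (rule set_integrable_subset[OF b(1)]) (use that in auto)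
  have sub: "continuous_on {c..d} f" if "continuous_on {0..<T} f" "0 \<le> c" "d < T" for c d and f :: "real \<Rightarrow> real"
    by (rule continuous_on_subset[OF that(1)]) (use that in auto)
  have bf: "(\<lambda>s. b s * f s) integrable_on {c..d}" if "continuous_on {0..<T} f" "0 \<le> c" "d < T" for f c d
    using set_borel_integral_eq_integral(1)[OF set_integrable_mult_continuous[OF bint[OF that(2)] sub[OF that]]] .
  have V10: "V1 0 = e" using eq[of 0] t G0 by simp
  define S where "S t = V1 t + V t" for t
  have contS: "continuous_on {0..<T} S" unfolding S_def by (intro continuous_intros contV contV1)
  have Seq: "S t = e + V 0 + G t - integral {0..t} (\<lambda>s. b s * V1 s)" if "0 \<le> t" "t < T" for t
  proof -
    have "integral {0..t} (\<lambda>s. V1 s - V s) = V t - V 0"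
      by (rule integral_eq_diff) (use that derV sub[OF contV] in auto)
    then show ?thesis using eq[OF that] by (simp add: S_def)
  qed
  have Sinc: "S t - S t0 = (G t - G t0) - integral {t0..t} (\<lambda>s. b s * V1 s)" if "0 \<le> t0" "t0 \<le> t" "t < T" for t0 t
    using Seq[of t] Seq[of t0] integral_increment[OF bf[OF contV1 order_refl], of t t0] that by simp
  \<comment> \<open>Since V' + 2 V = S, nonnegativity of S keeps V nonnegative, and therefore V1
    \<le> S.\<close>
  have Vnn: "V t \<ge> 0" if "0 \<le> t" "t < T" "\<And>s. 0 \<le> s \<Longrightarrow> s < t \<Longrightarrow> S s \<ge> 0" for t
    by (rule nonneg_of_deriv_ge[where V=V and V'="\<lambda>s. V1 s - V s" and k=2])
      (use that sub[OF contV] V0 derV in \<open>auto simp: S_def add.commute\<close>)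
  have Sbound: "S t \<ge> 1 * (e + G t) * exp (- 4 * integral {0..t} b)" if "0 \<le> t" "t < T" for t
  proof (rule exp_lower_barrier[OF contS contG monoG G0 b e])
    fix t0 assume t0: "0 \<le> t0" "t0 < T"
      and low: "\<And>s. 0 \<le> s \<Longrightarrow> s \<le> t0 \<Longrightarrow> 1 * (e + G s) * exp (- 4 * integral {0..s} b) \<le> S s"
    have Spos: "S s > 0" if "0 \<le> s" "s \<le> t0" for s
    proof -
      have "0 < 1 * (e + G s) * exp (- 4 * integral {0..s} b)" using e monoG[of 0 s] G0 that t0 by simp
      then show ?thesis using low[OF that] by linarith
    qed
    obtain d where d: "d > 0" "\<And>t. 0 \<le> t \<Longrightarrow> t < T \<Longrightarrow> \<bar>t - t0\<bar> < d \<Longrightarrow> \<bar>S t - S t0\<bar> < S t0"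
      using continuous_nbhd[OF contS t0, of "S t0"] Spos t0 by auto
    have Snn: "S s \<ge> 0" if "0 \<le> s" "s < t0 + d" "s < T" for s
      using Spos[of s] d(2)[of s] that by (cases "s \<le> t0") auto
    show "\<exists>d>0. \<forall>t. t0 < t \<and> t < t0 + d \<and> t < T \<longrightarrow>
          1 * (G t - G t0) - integral {t0..t} (\<lambda>s. b s * S s) \<le> S t - S t0"
    proof (intro exI[of _ d] conjI allI impI)
      fix t assume t: "t0 < t \<and> t < t0 + d \<and> t < T"
      have "integral {t0..t} (\<lambda>s. b s * V1 s) \<le> integral {t0..t} (\<lambda>s. b s * S s)"
      proof (rule integral_le)
        show "b s * V1 s \<le> b s * S s" if "s \<in> {t0..t}" for s
          using Vnn[of s] Snn that t t0 b(2)[of s] by (intro mult_left_mono) (auto simp: S_def)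
      qed (use bf contV1 contS t0 t in auto)
      then show "1 * (G t - G t0) - integral {t0..t} (\<lambda>s. b s * S s) \<le> S t - S t0"
        using Sinc[of t0 t] t t0 by simp
    qed (use d in simp)
  next
    show "1 * e \<le> S 0" using V10 V0 by (simp add: S_def)
  qed (use that in auto)
  show ?thesis
  proof (rule exp_lower_barrier[OF contV1 contG monoG G0 b e])
    fix t0 assume t0: "0 \<le> t0" "t0 < T"
      and V1t0: "V1 t0 = 1 / 4 * (e + G t0) * exp (- 4 * integral {0..t0} b)"
    have S4: "V1 t0 \<le> S t0 / 4" using Sbound[OF t0] V1t0 by simp
    have "0 < 1 / 4 * (e + G t0) * exp (- 4 * integral {0..t0} b)" using e monoG[of 0 t0] G0 t0 by simp
    then have neg: "V t0 - V1 t0 > 0" using S4 V1t0 by (simp add: S_def)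
    have "continuous_on {0..<T} (\<lambda>t. V t - V1 t)" by (intro continuous_intros contV contV1)
    then obtain d where d: "d > 0" "\<And>t. 0 \<le> t \<Longrightarrow> t < T \<Longrightarrow> \<bar>t - t0\<bar> < d \<Longrightarrow> \<bar>(V t - V1 t) - (V t0 - V1 t0)\<bar> < V t0 - V1 t0"
      using continuous_nbhd[OF _ t0 neg] by blast
    show "\<exists>d>0. \<forall>t. t0 < t \<and> t < t0 + d \<and> t < T \<longrightarrow>
          1 / 4 * (G t - G t0) - integral {t0..t} (\<lambda>s. b s * V1 s) \<le> V1 t - V1 t0"
    proof (intro exI[of _ d] conjI allI impI)
      fix t assume t: "t0 < t \<and> t < t0 + d \<and> t < T"
      have "- V t0 \<le> - V t"
      proof (rule mono_from_deriv[where f="\<lambda>s. - V s" and f'="\<lambda>s. - (V1 s - V s)"])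
        show "continuous_on {t0..t} (\<lambda>s. - V s)" using t t0 by (intro continuous_intros sub[OF contV]) auto
        show "((\<lambda>s. - V s) has_real_derivative - (V1 x - V x)) (at x)" if "t0 < x" "x < t" for x
          by (rule DERIV_minus, rule derV) (use that t t0 in auto)
        show "0 \<le> - (V1 x - V x)" if "t0 < x" "x < t" for x
          using d(2)[of x] that t t0 by simp
      qed (use t in simp)
      moreover have "1 / 4 * (G t - G t0) \<le> G t - G t0" using monoG[of t0 t] t t0 by simp
      ultimately show "1 / 4 * (G t - G t0) - integral {t0..t} (\<lambda>s. b s * V1 s) \<le> V1 t - V1 t0"
        using Sinc[of t0 t] t t0 unfolding S_def by linarith
    qed (use d in simp)
  next
    show "1 / 4 * e \<le> V1 0" using V10 e by simp
  qed (use t in auto)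
qed

text \<open>The golden-ratio constant solves \<open>k\<^sup>2 + k = 1\<close>, which makes \<open>U1 - k U\<close> satisfy a closed scalar equation
  with damping \<open>2 + k\<close>.\<close>

lemma damped_lower_bound:
  fixes U U1 F X h :: "real \<Rightarrow> real" and k :: real
  defines "k \<equiv> (sqrt 5 - 1) / 2"
  assumes contU: "continuous_on {0..<T} U" and contU1: "continuous_on {0..<T} U1"
    and derU: "\<And>t. 0 < t \<Longrightarrow> t < T \<Longrightarrow> (U has_real_derivative U1 t - U t) (at t)"
    and U0: "U 0 \<ge> 0" "U 0 \<le> a1"
    and eq: "\<And>t. 0 \<le> t \<Longrightarrow> t < T \<Longrightarrow> U1 t + integral {0..t} (\<lambda>s. 2 * U1 s - U s) = a1 + F t"
    and F0: "F 0 = 0"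
    and conth: "continuous_on {0..<T} h" and h: "\<And>t. 0 \<le> t \<Longrightarrow> t < T \<Longrightarrow> h t \<ge> 0"
    and contX: "continuous_on {0..<T} X"
    and derX: "\<And>t. 0 < t \<Longrightarrow> t < T \<Longrightarrow> (X has_real_derivative - (2 + k) * X t + h t) (at t)"
    and X0: "X 0 = 0"
    and Fh: "\<And>s t. 0 \<le> s \<Longrightarrow> s \<le> t \<Longrightarrow> t < T \<Longrightarrow> F t - F s \<ge> integral {s..t} h"
    and t: "0 \<le> t" "t < T"
  shows "U1 t \<ge> X t"
proof -
  have "(2::real) < sqrt 5" "sqrt 5 < 3" by (auto intro: real_less_rsqrt real_less_lsqrt)
  then have k: "0 < k" "k < 1" by (auto simp: k_def)
  have kk: "k * k = 1 - k" by (simp add: k_def field_simps)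
  have sub: "continuous_on {0..d} f" if "continuous_on {0..<T} f" "d < T" for d and f :: "real \<Rightarrow> real"
    by (rule continuous_on_subset[OF that(1)]) (use that in auto)
  have int: "f integrable_on {0..d}" if "continuous_on {0..<T} f" "d < T" for d and f :: "real \<Rightarrow> real"
    by (rule integrable_continuous_real[OF sub[OF that]])
  have Xnn: "X t \<ge> 0" if "0 \<le> t" "t < T" for t
    by (rule nonneg_of_deriv_ge[where V=X and V'="\<lambda>t. - (2 + k) * X t + h t" and k="2 + k"])
      (use that sub[OF contX] X0 derX h in \<open>auto simp: algebra_simps\<close>)
  define Y where "Y t = U1 t - k * U t - X t" for t
  define E where "E t = F t - integral {0..t} h" for t
  have contY: "continuous_on {0..<T} Y" unfolding Y_def by (intro continuous_intros contU contU1 contX)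
  have Ynn: "Y t \<ge> 0" if "0 \<le> t" "t < T" for t
  proof (rule damped_integral_nonneg[OF contY, where ?y0.0="a1 - k * U 0" and E=E and \<mu>="2 + k"])
    \<comment> \<open>Initial positivity of U1 - k U: k < 1 together with U(0) \<le> a1, the
      averaged form of \<open>u1 \<ge> u0\<close>.\<close>
    have "k * U 0 \<le> 1 * U 0" using k U0 by (intro mult_right_mono) auto
    then show "a1 - k * U 0 \<ge> 0" using U0 by simp
    show "E 0 \<ge> 0" by (simp add: E_def F0)
    show "E s \<le> E t" if "0 \<le> s" "s \<le> t" "t < T" for s t
      using Fh[OF that] integral_increment[OF int[OF conth], of t s] that by (simp add: E_def)
    show "Y t = a1 - k * U 0 + E t - (2 + k) * integral {0..t} Y" if t: "0 \<le> t" "t < T" for t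
    proof -
      have 1: "integral {0..t} (\<lambda>s. U1 s - U s) = U t - U 0"
        by (rule integral_eq_diff) (use t derU sub[OF contU] in auto)
      have 2: "integral {0..t} (\<lambda>s. - (2 + k) * X s + h s) = X t - X 0"
        by (rule integral_eq_diff) (use t derX sub[OF contX] in auto)
      let ?u = "integral {0..t} U" and ?u1 = "integral {0..t} U1" and ?x = "integral {0..t} X"
      note i = int[OF contU t(2)] int[OF contU1 t(2)] int[OF contX t(2)] int[OF conth t(2)]
      have "?u1 - ?u = U t - U 0" using 1 i by (simp add: Henstock_Kurzweil_Integration.integral_diff)
      moreover have "- (2 + k) * ?x + integral {0..t} h = X t"
      proof -
        have "integral {0..t} (\<lambda>s. - (2 + k) * X s + h s) = integral {0..t} (\<lambda>s. - (2 + k) * X s) + integral {0..t} h"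
          by (rule Henstock_Kurzweil_Integration.integral_add) (use i in \<open>auto intro: integrable_on_mult_right\<close>)
        also have "integral {0..t} (\<lambda>s. - (2 + k) * X s) = - (2 + k) * ?x" by (rule integral_mult_right)
        finally show ?thesis using 2 X0 by simp
      qed
      moreover have "U1 t + (2 * ?u1 - ?u) = a1 + F t"
      proof -
        have "integral {0..t} (\<lambda>s. 2 * U1 s - U s) = integral {0..t} (\<lambda>s. 2 * U1 s) - ?u"
          by (rule Henstock_Kurzweil_Integration.integral_diff) (use i in \<open>auto intro: integrable_on_mult_right\<close>)
        then show ?thesis using eq[OF t] by simp
      qed
      moreover have "integral {0..t} Y = ?u1 - k * ?u - ?x"
      proof -
        have "integral {0..t} Y = integral {0..t} (\<lambda>s. U1 s - k * U s) - ?x" unfolding Y_def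
          by (rule Henstock_Kurzweil_Integration.integral_diff)
            (use i in \<open>auto intro!: integrable_on_mult_right Henstock_Kurzweil_Integration.integrable_diff\<close>)
        also have "integral {0..t} (\<lambda>s. U1 s - k * U s) = ?u1 - integral {0..t} (\<lambda>s. k * U s)"
          by (rule Henstock_Kurzweil_Integration.integral_diff) (use i in \<open>auto intro: integrable_on_mult_right\<close>)
        finally show ?thesis by simp
      qed
      \<comment> \<open>The relation k^2 = 1 - k turns (1 + k) U - (2 + k) U1 into -(2 + k) (U1 - k
        U).\<close>
      moreover have "k * (k * ?u) = ?u - k * ?u" using kk by (simp add: mult.assoc[symmetric] left_diff_distrib)
      moreover have "U1 t - k * U t - X t = a1 - k * U 0 + (F t - H) - (2 + k) * I"
        if "u1 - u = U t - U 0" "- (2 + k) * x + H = X t" "U1 t + (2 * u1 - u) = a1 + F t"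
          "I = u1 - k * u - x" "k * (k * u) = u - k * u" for u u1 x H I
        using that by algebra
      ultimately have "U1 t - k * U t - X t = a1 - k * U 0 + (F t - integral {0..t} h) - (2 + k) * integral {0..t} Y"
        by blast
      then show ?thesis by (simp only: E_def) (simp add: Y_def)
    qed
  qed (use that k in auto)
  \<comment> \<open>From U' = U1 - U and U1 = Y + X + k U follows U' + (1 - k) U = Y + X \<ge>
    0.\<close>
  have "U t \<ge> 0"
  proof (rule nonneg_of_deriv_ge[where V=U and V'="\<lambda>t. U1 t - U t" and k="1 - k"])
    show "0 \<le> U1 s - U s + (1 - k) * U s" if "0 < s" "s < t" for s
      using Ynn[of s] Xnn[of s] that t by (simp add: Y_def algebra_simps)
  qed (use t sub[OF contU] derU U0 in auto)
  then have "k * U t \<ge> 0" using k by simp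
  then show ?thesis using Ynn[OF t] by (simp add: Y_def)
qed

text \<open>F and G need not be differentiable, so W and X are minorants built by integration: W
  integrates a lower bound for the growth of G, and X solves X' = -\<mu> X + h with h made from W.
  The loop closes through V1 \<ge> c0 W, hence F grows at least like the integral of h, hence U1
  \<ge> X, hence W' \<ge> c X^q. Of the two entries of the minimum c, the first yields W \<le> I
  \<epsilon> + G, the second the bound on h.\<close>

lemma functionals_coupled_system:
  fixes U U1 V V1 F G b :: "real \<Rightarrow> real" and p q \<beta> d I \<epsilon> a1 T :: real
  defines "c0 \<equiv> 1 / 4 * exp (- 4 * integral {0..} b)"
  defines "c \<equiv> min d (c0 powr p * d)"
  assumes p: "p > 1" and q: "q > 1" and beta: "\<beta> \<ge> 0" and d: "d > 0" and I: "I > 0"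
    and eps: "0 < \<epsilon>" "\<epsilon> \<le> 1"
    and b: "set_integrable lborel {0..} b" "\<And>t. t \<ge> 0 \<Longrightarrow> b t \<ge> 0"
    and contU: "continuous_on {0..<T} U" and contU1: "continuous_on {0..<T} U1"
    and contV: "continuous_on {0..<T} V" and contV1: "continuous_on {0..<T} V1"
    and derU: "\<And>t. 0 < t \<Longrightarrow> t < T \<Longrightarrow> (U has_real_derivative U1 t - U t) (at t)"
    and derV: "\<And>t. 0 < t \<Longrightarrow> t < T \<Longrightarrow> (V has_real_derivative V1 t - V t) (at t)"
    and U0: "U 0 \<ge> 0" "U 0 \<le> a1" and V0: "V 0 \<ge> 0"
    and eqU: "\<And>t. 0 \<le> t \<Longrightarrow> t < T \<Longrightarrow> U1 t + integral {0..t} (\<lambda>s. 2 * U1 s - U s) = a1 + F t"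
    and eqV: "\<And>t. 0 \<le> t \<Longrightarrow> t < T \<Longrightarrow>
      V1 t + integral {0..t} (\<lambda>s. V1 s - V s) + integral {0..t} (\<lambda>s. b s * V1 s) = I * \<epsilon> + G t"
    and F0: "F 0 = 0" and G0: "G 0 = 0" and contG: "continuous_on {0..<T} G"
    and F: "\<And>s t. 0 \<le> s \<Longrightarrow> s \<le> t \<Longrightarrow> t < T \<Longrightarrow>
      F t - F s \<ge> integral {s..t} (\<lambda>x. d * \<bar>V1 x\<bar> powr p * (1 + x) powr (- \<beta> * (p - 1)))"
    and G: "\<And>s t. 0 \<le> s \<Longrightarrow> s \<le> t \<Longrightarrow> t < T \<Longrightarrow>
      G t - G s \<ge> integral {s..t} (\<lambda>x. d * \<bar>U1 x\<bar> powr q * (1 + x) powr (- \<beta> * (q - 1)))"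
  shows "\<exists>W W' X X'. coupled_system p q \<beta> c (2 + (sqrt 5 - 1) / 2) I T \<epsilon> W W' X X'"
proof -
  define \<mu> :: real where "\<mu> = 2 + (sqrt 5 - 1) / 2"
  have "(1::real) < sqrt 5" by (rule real_less_rsqrt) simp
  then have mu: "\<mu> > 0" unfolding \<mu>_def by (intro add_pos_nonneg) auto
  have c00: "c0 > 0" by (simp add: c0_def)
  have c: "c > 0" "c \<le> d" "c \<le> c0 powr p * d" using d c00 by (auto simp: c_def)
  have pnn: "(\<lambda>x. d * \<bar>g x\<bar> powr r * (1 + x) powr (- \<beta> * (r - 1))) integrable_on {s..t} \<and>
      integral {s..t} (\<lambda>x. d * \<bar>g x\<bar> powr r * (1 + x) powr (- \<beta> * (r - 1))) \<ge> 0"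
    if "continuous_on {0..<T} g" "0 \<le> s" "t < T" "r > 1" for g s t r
  proof -
    have "continuous_on {s..t} g" by (rule continuous_on_subset[OF that(1)]) (use that in auto)
    then have "(\<lambda>x. d * \<bar>g x\<bar> powr r * (1 + x) powr (- \<beta> * (r - 1))) integrable_on {s..t}"
      using that by (intro integrable_continuous_real continuous_intros continuous_on_powr') auto
    then show ?thesis using d by (auto intro!: integral_nonneg)
  qed
  have monoG: "G s \<le> G t" if "0 \<le> s" "s \<le> t" "t < T" for s t
    using G[OF that] pnn[OF contU1, of s t q] that q by simp
  define W' where "W' t = c * \<bar>U1 t\<bar> powr q * (1 + t) powr (- \<beta> * (q - 1))" for t
  have contW': "continuous_on {0..<T} W'" unfolding W'_def using q
    by (intro continuous_intros continuous_on_powr' contU1) auto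
  have intc: "f integrable_on {0..t}" if "continuous_on {0..<T} f" "t < T" for f :: "real \<Rightarrow> real" and t
    by (rule integrable_continuous_real, rule continuous_on_subset[OF that(1)]) (use that in auto)
  define W where "W t = I * \<epsilon> + integral {0..t} W'" for t
  have contW: "continuous_on {0..<T} W" unfolding W_def
    by (intro continuous_intros continuous_integral intc contW')
  have derW: "(W has_real_derivative W' t) (at t)" if "0 < t" "t < T" for t
    unfolding W_def using integral_deriv_at[OF contW' that] by (auto intro!: derivative_eq_intros)
  have W_le: "W t \<le> I * \<epsilon> + G t" if t: "0 \<le> t" "t < T" for t
  proof -
    have "integral {0..t} W' \<le> integral {0..t} (\<lambda>x. d * \<bar>U1 x\<bar> powr q * (1 + x) powr (- \<beta> * (q - 1)))"
    proof (rule integral_le)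
      show "W' x \<le> d * \<bar>U1 x\<bar> powr q * (1 + x) powr (- \<beta> * (q - 1))" for x
        unfolding W'_def using c by (intro mult_right_mono) auto
    qed (use intc[OF contW' t(2)] pnn[OF contU1, of 0 t q] t q in auto)
    also have "\<dots> \<le> G t - G 0" using G[of 0 t] t by simp
    finally show ?thesis by (simp add: W_def G0)
  qed
  have W_pos: "W t > 0" if t: "0 \<le> t" "t < T" for t
  proof -
    have "integral {0..t} W' \<ge> 0" using intc[OF contW' t(2)] c by (intro integral_nonneg) (auto simp: W'_def)
    then show ?thesis using I eps by (simp add: W_def add_pos_nonneg)
  qed
  have Iep: "I * \<epsilon> > 0" using I eps by simp
  have V1_ge: "V1 t \<ge> c0 * W t" if t: "0 \<le> t" "t < T" for t
  proof -
    have bt: "set_integrable lborel {0..t} b" by (rule set_integrable_subset[OF b(1)]) auto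
    have "integral {0..t} b \<le> integral {0..} b"
      by (rule integral_subset_le)
        (use set_borel_integral_eq_integral(1)[OF b(1)] set_borel_integral_eq_integral(1)[OF bt] b(2) in auto)
    then have "c0 \<le> 1 / 4 * exp (- 4 * integral {0..t} b)" by (simp add: c0_def)
    then have "c0 * W t \<le> (1 / 4 * exp (- 4 * integral {0..t} b)) * (I * \<epsilon> + G t)"
      using W_le[OF t] W_pos[OF t] by (intro mult_mono) auto
    also have "\<dots> = 1 / 4 * (I * \<epsilon> + G t) * exp (- 4 * integral {0..t} b)" by simp
    also have "\<dots> \<le> V1 t"
      by (rule scattering_lower_bound[OF contV contV1 derV V0 Iep contG monoG G0 b eqV t])
    finally show ?thesis .
  qed
  define h where "h t = c * W t powr p * (1 + t) powr (- \<beta> * (p - 1))" for t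
  have "\<forall>t\<in>{0..<T}. W t \<noteq> 0" using W_pos by (metis atLeastLessThan_iff less_irrefl)
  then have conth: "continuous_on {0..<T} h" unfolding h_def
    by (intro continuous_intros contW) auto
  have hnn: "h t \<ge> 0" for t using c by (simp add: h_def)
  have contph: "continuous_on {0..<T} (\<lambda>s. exp (\<mu> * s) * h s)" by (intro continuous_intros conth)
  define X where "X t = exp (- \<mu> * t) * integral {0..t} (\<lambda>s. exp (\<mu> * s) * h s)" for t
  have contX: "continuous_on {0..<T} X" unfolding X_def
    by (intro continuous_intros continuous_integral intc contph)
  have derX: "(X has_real_derivative - \<mu> * X t + h t) (at t)" if t: "0 < t" "t < T" for t
  proof -
    have "(X has_real_derivative - \<mu> * exp (- \<mu> * t) * integral {0..t} (\<lambda>s. exp (\<mu> * s) * h s)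
       + exp (- \<mu> * t) * (exp (\<mu> * t) * h t)) (at t)"
      unfolding X_def using integral_deriv_at[OF contph t]
      by (auto intro!: derivative_eq_intros simp: algebra_simps)
    moreover have "exp (- \<mu> * t) * (exp (\<mu> * t) * h t) = h t"
      by (simp add: mult.assoc[symmetric] exp_add[symmetric])
    ultimately show ?thesis by (simp only: X_def mult.assoc)
  qed
  have Fh: "F t - F s \<ge> integral {s..t} h" if st: "0 \<le> s" "s \<le> t" "t < T" for s t
  proof -
    have "integral {s..t} h \<le> integral {s..t} (\<lambda>x. d * \<bar>V1 x\<bar> powr p * (1 + x) powr (- \<beta> * (p - 1)))"
    proof (rule integral_le)
      show "h integrable_on {s..t}"
        by (rule integrable_continuous_real, rule continuous_on_subset[OF conth]) (use st in auto)
      show "(\<lambda>x. d * \<bar>V1 x\<bar> powr p * (1 + x) powr (- \<beta> * (p - 1))) integrable_on {s..t}"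
        using pnn[OF contV1, of s t p] st p by simp
      fix x assume x: "x \<in> {s..t}"
      then have xT: "0 \<le> x" "x < T" using st by auto
      have "c * W x powr p \<le> (c0 powr p * d) * W x powr p" using c by (intro mult_right_mono) auto
      also have "\<dots> = d * (c0 * W x) powr p" using c00 W_pos[OF xT] by (simp add: powr_mult)
      also have "\<dots> \<le> d * \<bar>V1 x\<bar> powr p"
        using V1_ge[OF xT] W_pos[OF xT] c00 d p by (intro mult_left_mono powr_mono2) auto
      finally show "h x \<le> d * \<bar>V1 x\<bar> powr p * (1 + x) powr (- \<beta> * (p - 1))"
        unfolding h_def by (intro mult_right_mono) auto
    qed
    then show ?thesis using F[OF st] by simp
  qed
  have X0: "X 0 = 0" by (simp add: X_def)
  have U1X: "U1 t \<ge> X t" if t: "0 \<le> t" "t < T" for t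
    by (rule damped_lower_bound[OF contU contU1 derU U0 eqU F0 conth hnn contX derX[unfolded \<mu>_def] X0 Fh t])
  have Xnn: "X t \<ge> 0" if t: "0 \<le> t" "t < T" for t
    using intc[OF contph t(2)] hnn unfolding X_def by (intro mult_nonneg_nonneg integral_nonneg) auto
  have "coupled_system p q \<beta> c \<mu> I T \<epsilon> W W' X (\<lambda>t. - \<mu> * X t + h t)"
  proof
    show "c * X t powr q * (1 + t) powr (- \<beta> * (q - 1)) \<le> W' t" if "0 < t" "t < T" for t
      unfolding W'_def using that U1X[of t] Xnn[of t] c q
      by (intro mult_right_mono mult_left_mono powr_mono2) auto
    show "- \<mu> * X t + c * W t powr p * (1 + t) powr (- \<beta> * (p - 1)) \<le> - \<mu> * X t + h t" for t
      by (simp add: h_def)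
    show "I * \<epsilon> \<le> W 0" by (simp add: W_def)
    show "0 \<le> X 0" by (simp add: X0)
  qed (fact p q beta c(1) mu I eps contW contX derW derX)+
  then show ?thesis unfolding \<mu>_def by blast
qed

subsection \<open>Weighted integrals\<close>

text \<open>Convexity: the left side is the tangent at k to the p-th power. Young's inequality with
  the conjugate exponents p and p/(p - 1) is exactly this tangent bound.\<close>

lemma powr_above_tangent:
  fixes p x k :: real
  assumes "p > 1" "x \<ge> 0" "k \<ge> 0"
  shows "p * k powr (p - 1) * x - (p - 1) * k powr p \<le> x powr p"
proof -
  have "x * k powr (p - 1) \<le> x powr p / p + (k powr (p - 1)) powr (p / (p - 1)) / (p / (p - 1))"
    using assms by (intro Youngs_inequality) (auto simp: field_simps)
  also have "(k powr (p - 1)) powr (p / (p - 1)) = k powr p"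
    using assms by (simp add: powr_powr)
  finally have "p * (x * k powr (p - 1)) \<le> p * (x powr p / p + k powr p / (p / (p - 1)))"
    using assms by (intro mult_left_mono) auto
  also have "\<dots> = x powr p + (p - 1) * k powr p" using assms by (simp add: field_simps)
  finally show ?thesis by (simp add: algebra_simps)
qed

text \<open>The tangent inequality is integrated at k = S/D, the value that maximizes the resulting
  lower bound. D may exceed the mass of w on B because it enters with a minus sign.\<close>

lemma reverse_Holder:
  fixes a w :: "'a \<Rightarrow> real"
  assumes p: "p > 1" and w: "\<And>x. w x \<ge> 0"
    and aw: "integrable M (\<lambda>x. a x * w x)"
    and apw: "integrable M (\<lambda>x. \<bar>a x\<bar> powr p * w x)"
    and supp: "AE x in M. x \<notin> B \<longrightarrow> a x = 0"
    and Bw: "integrable M (\<lambda>x. indicator B x * w x)" and D: "(LINT x|M. indicator B x * w x) \<le> D" "D > 0"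
  shows "\<bar>LINT x|M. a x * w x\<bar> powr p * D powr (- (p - 1)) \<le> (LINT x|M. \<bar>a x\<bar> powr p * w x)"
proof -
  define S where "S = (LINT x|M. \<bar>a x\<bar> * w x)"
  have abs_eq: "\<bar>a x * w x\<bar> = \<bar>a x\<bar> * w x" for x using w by (simp add: abs_mult)
  have ai: "integrable M (\<lambda>x. \<bar>a x\<bar> * w x)" using integrable_abs[OF aw] by (simp add: abs_eq)
  have S: "\<bar>LINT x|M. a x * w x\<bar> \<le> S"
    unfolding S_def using integral_abs_bound[of M "\<lambda>x. a x * w x"] by (simp add: abs_eq)
  have S0: "S \<ge> 0" using S by linarith
  define k where "k = S / D"
  have k0: "k \<ge> 0" using S0 D by (simp add: k_def)
  have kS: "k powr (p - 1) * S = S powr p * D powr (- (p - 1))" and kD: "k powr p * D = S powr p * D powr (- (p - 1))"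
    using S0 D p by (auto simp: k_def powr_divide powr_diff powr_minus field_simps)
  have "S powr p * D powr (- (p - 1)) = p * (k powr (p - 1) * S) - (p - 1) * (k powr p * D)"
    unfolding kS kD by (simp add: algebra_simps)
  also have "\<dots> \<le> p * (k powr (p - 1) * S) - (p - 1) * (k powr p * (LINT x|M. indicator B x * w x))"
    using D p by (intro diff_left_mono mult_left_mono) auto
  also have "\<dots> = (LINT x|M. p * k powr (p - 1) * (\<bar>a x\<bar> * w x) - (p - 1) * k powr p * (indicator B x * w x))"
    using ai Bw by (simp add: S_def mult.assoc)
  also have "\<dots> \<le> (LINT x|M. \<bar>a x\<bar> powr p * w x)"
  proof (rule integral_mono_AE)
    show "integrable M (\<lambda>x. p * k powr (p - 1) * (\<bar>a x\<bar> * w x) - (p - 1) * k powr p * (indicator B x * w x))"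
      using ai Bw by auto
    show "AE x in M. p * k powr (p - 1) * (\<bar>a x\<bar> * w x) - (p - 1) * k powr p * (indicator B x * w x)
        \<le> \<bar>a x\<bar> powr p * w x"
      using supp
    proof eventually_elim
      case (elim x)
      show ?case
      proof (cases "x \<in> B")
        case True
        have "(p * k powr (p - 1) * \<bar>a x\<bar> - (p - 1) * k powr p) * w x \<le> \<bar>a x\<bar> powr p * w x"
          using powr_above_tangent[OF p _ k0, of "\<bar>a x\<bar>"] w by (intro mult_right_mono) auto
        then show ?thesis using True by (simp add: algebra_simps)
      qed (use elim in simp)
    qed
  qed (rule apw)
  finally have "S powr p * D powr (- (p - 1)) \<le> (LINT x|M. \<bar>a x\<bar> powr p * w x)" .
  moreover have "\<bar>LINT x|M. a x * w x\<bar> powr p * D powr (- (p - 1)) \<le> S powr p * D powr (- (p - 1))"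
    using S p by (intro mult_right_mono powr_mono2) auto
  ultimately show ?thesis by simp
qed

section \<open>Mass of the plane exponential on balls\<close>

lemma nn_integral_gaussian:
  assumes "r > 0"
  shows "(\<integral>\<^sup>+ y. ennreal (exp (- y\<^sup>2 / (4 * r))) \<partial>lborel) = ennreal (sqrt (4 * pi * r))"
proof -
  have "exp (- y\<^sup>2 / (4 * r)) = sqrt (4 * pi * r) * normal_density 0 (sqrt (2 * r)) y" for y
    using assms by (simp add: normal_density_def mult_ac)
  then have "(\<integral>\<^sup>+ y. ennreal (exp (- y\<^sup>2 / (4 * r))) \<partial>lborel)
      = (\<integral>\<^sup>+ y. ennreal (sqrt (4 * pi * r) * normal_density 0 (sqrt (2 * r)) y) \<partial>lborel)" by simp
  also have "\<dots> = ennreal (LINT y|lborel. sqrt (4 * pi * r) * normal_density 0 (sqrt (2 * r)) y)"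
    using assms by (intro nn_integral_eq_integral) auto
  also have "\<dots> = ennreal (sqrt (4 * pi * r))" using assms by simp
  finally show ?thesis .
qed

text \<open>In the ball, \<open>\<bar>x'\<bar>\<^sup>2 \<le> (r - x\<^sub>e) (r + x\<^sub>e) \<le> 2 r (r - x\<^sub>e)\<close> for the component \<open>x'\<close> orthogonal
  to \<open>e\<close>, so half of the exponential turns into a Gaussian in \<open>x'\<close> of width \<open>\<surd>r\<close>.\<close>

lemma nn_integral_exp_ball:
  fixes e :: "'a::euclidean_space"
  assumes e: "e \<in> Basis" and r: "r > 0"
  shows "(\<integral>\<^sup>+ x. ennreal (indicator (cball 0 r) x * exp (x \<bullet> e)) \<partial>lborel)
    \<le> ennreal (2 * exp r * (4 * pi * r) powr ((real DIM('a) - 1) / 2))"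
proof -
  define f where "f b y = (if b = e then exp (r / 2) * exp (y / 2) * indicator {-r..r} y
     else exp (- y\<^sup>2 / (4 * r)))" for b :: 'a and y :: real
  have f0: "f b y \<ge> 0" for b y by (simp add: f_def)
  have pt: "indicator (cball 0 r) x * exp (x \<bullet> e) \<le> (\<Prod>b\<in>Basis. f b (x \<bullet> b))" for x
  proof (cases "x \<in> cball 0 r")
    case False then show ?thesis using f0 by (simp add: prod_nonneg)
  next
    case True
    define y where "y = x \<bullet> e"
    define q where "q = (\<Sum>b\<in>Basis - {e}. (x \<bullet> b)\<^sup>2)"
    have nx: "norm x \<le> r" using True by simp
    have y: "\<bar>y\<bar> \<le> r" unfolding y_def using Basis_le_norm[OF e, of x] nx by simp
    have "(norm x)\<^sup>2 = (\<Sum>b\<in>Basis. (x \<bullet> b)\<^sup>2)"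
      unfolding power2_norm_eq_inner euclidean_inner[of x x] by (simp add: power2_eq_square)
    also have "\<dots> = y\<^sup>2 + q" unfolding y_def q_def using e by (simp add: sum.remove[of _ e])
    finally have "y\<^sup>2 + q \<le> r\<^sup>2" using nx by (metis norm_ge_zero power_mono)
    then have "q \<le> (r - y) * (r + y)" by (simp add: algebra_simps power2_eq_square)
    also have "\<dots> \<le> (r - y) * (2 * r)" using y by (intro mult_left_mono) auto
    finally have "q / (4 * r) \<le> (r - y) / 2" using r by (simp add: field_simps)
    then have le: "- ((r - y) / 2) \<le> - q / (4 * r)" by simp
    have "exp y = exp (r / 2) * exp (y / 2) * exp (- ((r - y) / 2))"
      by (simp add: exp_add[symmetric] field_simps)
    also have "\<dots> \<le> exp (r / 2) * exp (y / 2) * exp (- q / (4 * r))"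
      using le by (intro mult_left_mono) auto
    also have "exp (- q / (4 * r)) = (\<Prod>b\<in>Basis - {e}. exp (- (x \<bullet> b)\<^sup>2 / (4 * r)))"
      unfolding q_def by (simp add: exp_sum[symmetric] sum_divide_distrib sum_negf)
    also have "exp (r / 2) * exp (y / 2) * \<dots> = f e (x \<bullet> e) * (\<Prod>b\<in>Basis - {e}. f b (x \<bullet> b))"
      using y by (simp add: f_def y_def[symmetric] indicator_def abs_le_iff)
    also have "\<dots> = (\<Prod>b\<in>Basis. f b (x \<bullet> b))" using e by (simp add: prod.remove[of _ e])
    finally show ?thesis using True by (simp add: y_def)
  qed
  have "(\<integral>\<^sup>+ x. ennreal (indicator (cball 0 r) x * exp (x \<bullet> e)) \<partial>lborel)
     \<le> (\<integral>\<^sup>+ x. (\<Prod>b\<in>Basis. ennreal (f b (x \<bullet> b))) \<partial>lborel)"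
    using pt f0 by (intro nn_integral_mono) (simp add: prod_ennreal ennreal_leI)
  also have "\<dots> = (\<Prod>b\<in>Basis. \<integral>\<^sup>+ y. ennreal (f b y) \<partial>lborel)"
    by (rule nn_integral_lborel_prod) (auto simp: f_def)
  also have "\<dots> = (\<integral>\<^sup>+ y. ennreal (f e y) \<partial>lborel) * (\<Prod>b\<in>Basis - {e}. \<integral>\<^sup>+ y. ennreal (f b y) \<partial>lborel)"
    using e by (simp add: prod.remove[of _ e])
  also have "(\<Prod>b\<in>Basis - {e}. \<integral>\<^sup>+ y. ennreal (f b y) \<partial>lborel) = (\<Prod>b\<in>Basis - {e}. ennreal (sqrt (4 * pi * r)))"
    using nn_integral_gaussian[OF r] by (intro prod.cong refl) (simp add: f_def)
  also have "\<dots> = ennreal (sqrt (4 * pi * r) ^ (DIM('a) - 1))"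
    using e r by (simp add: ennreal_power)
  \<comment> \<open>Only the direction e is exponentially large: the factor e^(r/2) times the
    integral of e^(y/2), which is at most 2 e^(r/2).\<close>
  also have "(\<integral>\<^sup>+ y. ennreal (f e y) \<partial>lborel) \<le> ennreal (2 * exp r)"
  proof -
    have "(\<integral>\<^sup>+ y. ennreal (f e y) \<partial>lborel) = (\<integral>\<^sup>+ y. ennreal (exp (r / 2) * exp (y / 2)) * indicator {-r..r} y \<partial>lborel)"
      by (intro nn_integral_cong) (simp add: f_def indicator_def)
    also have "\<dots> = ennreal (2 * exp (r / 2) * exp (r / 2) - 2 * exp (r / 2) * exp (- r / 2))"
      by (rule nn_integral_FTC_Icc) (use r in \<open>auto intro!: derivative_eq_intros\<close>)
    also have "\<dots> \<le> ennreal (2 * exp r)"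
      by (intro ennreal_leI) (simp add: mult.assoc exp_add[symmetric])
    finally show ?thesis .
  qed
  also have "ennreal (2 * exp r) * ennreal (sqrt (4 * pi * r) ^ (DIM('a) - 1))
      = ennreal (2 * exp r * (4 * pi * r) powr ((real DIM('a) - 1) / 2))"
  proof -
    have "sqrt (4 * pi * r) ^ (DIM('a) - 1) = (4 * pi * r) powr ((real DIM('a) - 1) / 2)"
      using r DIM_positive[where 'a='a]
      by (simp add: powr_half_sqrt[symmetric] powr_realpow[symmetric] powr_powr of_nat_diff Suc_leI)
    then show ?thesis by (simp add: ennreal_mult[symmetric])
  qed
  finally show ?thesis by (simp add: mult_right_mono)
qed

lemma integral_exp_ball:
  fixes e :: "'a::euclidean_space"
  assumes e: "e \<in> Basis" and r: "r > 0"
  shows "integrable lborel (\<lambda>x. indicator (cball 0 r) x * exp (x \<bullet> e))"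
    and "(LINT x|lborel. indicator (cball 0 r) x * exp (x \<bullet> e))
      \<le> 2 * exp r * (4 * pi * r) powr ((real DIM('a) - 1) / 2)"
proof -
  have m: "(\<lambda>x. indicator (cball 0 r) x * exp (x \<bullet> e)) \<in> borel_measurable lborel"
    using borel_measurable_continuous_on_indicator[of "cball 0 r" "\<lambda>x. exp (x \<bullet> e)"]
    by (simp add: continuous_intros)
  show i: "integrable lborel (\<lambda>x. indicator (cball 0 r) x * exp (x \<bullet> e))"
    using nn_integral_exp_ball[OF assms] m
    by (intro integrableI_nonneg) (auto simp: less_top[symmetric] top_unique)
  have "ennreal (LINT x|lborel. indicator (cball 0 r) x * exp (x \<bullet> e))
      = (\<integral>\<^sup>+ x. ennreal (indicator (cball 0 r) x * exp (x \<bullet> e)) \<partial>lborel)"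
    by (rule nn_integral_eq_integral[symmetric, OF i]) auto
  then show "(LINT x|lborel. indicator (cball 0 r) x * exp (x \<bullet> e))
      \<le> 2 * exp r * (4 * pi * r) powr ((real DIM('a) - 1) / 2)"
    using nn_integral_exp_ball[OF assms]
    by (metis ennreal_le_iff exp_ge_zero mult_nonneg_nonneg powr_ge_zero zero_le_numeral)
qed

section \<open>Pairing locally integrable functions with compactly supported weights\<close>

lemma norm_mult_le_bound:
  fixes y c M :: real
  assumes "\<bar>c\<bar> \<le> M"
  shows "norm (y * c) \<le> norm (M * y)"
proof -
  have "\<bar>c\<bar> * \<bar>y\<bar> \<le> \<bar>M\<bar> * \<bar>y\<bar>" using assms by (intro mult_right_mono) auto
  then show ?thesis by (simp add: abs_mult mult.commute)
qed

lemma bounded_weight: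
  fixes w :: "'a::euclidean_space \<Rightarrow> real"
  assumes "continuous_on UNIV w" "\<And>x. norm x > r \<Longrightarrow> w x = 0"
  obtains M where "M \<ge> 0" "\<And>x. \<bar>w x\<bar> \<le> M"
proof -
  have "compact (w ` cball 0 r)"
    by (intro compact_continuous_image continuous_on_subset[OF assms(1)]) auto
  then obtain M where M: "\<And>x. x \<in> cball 0 r \<Longrightarrow> \<bar>w x\<bar> \<le> M"
    by (meson compact_imp_bounded bounded_real image_eqI)
  have "\<bar>w x\<bar> \<le> max 0 M" for x
    using M[of x] assms(2)[of x] by (cases "norm x \<le> r") auto
  then show thesis using that[of "max 0 M"] by simp
qed

lemma integrable_mult_weight:
  fixes f w :: "'a::euclidean_space \<Rightarrow> real"
  assumes "set_integrable lborel (cball 0 r) f" "continuous_on UNIV w" "\<And>x. norm x > r \<Longrightarrow> w x = 0"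
  shows "integrable lborel (\<lambda>x. f x * w x)"
proof -
  obtain M where M: "M \<ge> 0" "\<And>x. \<bar>w x\<bar> \<le> M" using bounded_weight[OF assms(2,3)] by auto
  have eq: "(\<lambda>x. f x * w x) = (\<lambda>x. (indicator (cball 0 r) x *\<^sub>R f x) * w x)"
    using assms(3) by (auto simp: indicator_def fun_eq_iff)
  have fi: "integrable lborel (\<lambda>x. indicator (cball 0 r) x *\<^sub>R f x)"
    using assms(1) by (simp add: set_integrable_def)
  have wm: "w \<in> borel_measurable lborel" using assms(2) by (simp add: borel_measurable_continuous_onI)
  show ?thesis unfolding eq
  proof (rule Bochner_Integration.integrable_bound[where f="\<lambda>x. M * (indicator (cball 0 r) x *\<^sub>R f x)"])
    show "(\<lambda>x. (indicator (cball 0 r) x *\<^sub>R f x) * w x) \<in> borel_measurable lborel"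
      by (rule borel_measurable_times[OF borel_measurable_integrable[OF fi] wm])
    show "AE x in lborel. norm ((indicator (cball 0 r) x *\<^sub>R f x) * w x) \<le> norm (M * (indicator (cball 0 r) x *\<^sub>R f x))"
      using M by (intro AE_I2 norm_mult_le_bound)
  qed (use fi in auto)
qed

lemma loc_L1_mult_weight:
  assumes "loc_L1 f" "continuous_on UNIV w" "\<And>x. norm x > r \<Longrightarrow> w x = 0"
  shows "integrable lborel (\<lambda>x. f x * w x)"
  by (rule integrable_mult_weight[OF _ assms(2,3)]) (use assms(1) in \<open>simp_all add: loc_L1_def\<close>)

lemma loc_L1_diff: "loc_L1 f \<Longrightarrow> loc_L1 g \<Longrightarrow> loc_L1 (\<lambda>x. f x - g x)"
  unfolding loc_L1_def by (simp add: set_integral_diff(1))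

lemma loc_L1_divide: "loc_L1 f \<Longrightarrow> loc_L1 (\<lambda>x. f x / c)"
  unfolding loc_L1_def by simp

lemma tendsto_within_cong:
  assumes "(f \<longlongrightarrow> l) (at t within S)" "\<And>s. s \<in> S \<Longrightarrow> f s = g s"
  shows "(g \<longlongrightarrow> l) (at t within S)"
proof (rule Lim_transform_eventually[OF assms(1)])
  show "eventually (\<lambda>s. f s = g s) (at t within S)"
    unfolding eventually_at_filter by (rule always_eventually) (use assms(2) in blast)
qed

lemma pairing_tendsto_0:
  fixes g :: "real \<Rightarrow> 'a::euclidean_space \<Rightarrow> real"
  assumes g: "\<And>s. s \<in> S \<Longrightarrow> loc_L1 (g s)"
    and lim: "((\<lambda>s. LINT x:cball 0 r|lborel. \<bar>g s x\<bar>) \<longlongrightarrow> 0) (at t within S)"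
    and w: "continuous_on UNIV w" "\<And>x. norm x > r \<Longrightarrow> w x = 0"
  shows "((\<lambda>s. LINT x|lborel. g s x * w x) \<longlongrightarrow> 0) (at t within S)"
proof -
  obtain M where M: "M \<ge> 0" "\<And>x. \<bar>w x\<bar> \<le> M" using bounded_weight[OF w] by auto
  have bd: "norm (LINT x|lborel. g s x * w x) \<le> M * (LINT x:cball 0 r|lborel. \<bar>g s x\<bar>)" if "s \<in> S" for s
  proof -
    have si: "set_integrable lborel (cball 0 r) (\<lambda>x. \<bar>g s x\<bar>)"
      using g[OF that] unfolding loc_L1_def by (intro set_integrable_abs) auto
    have "norm (LINT x|lborel. g s x * w x) \<le> (LINT x|lborel. norm (g s x * w x))"
      by (rule integral_norm_bound)
    also have "\<dots> \<le> (LINT x|lborel. M * (indicator (cball 0 r) x *\<^sub>R \<bar>g s x\<bar>))"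
    proof (rule integral_mono)
      show "integrable lborel (\<lambda>x. norm (g s x * w x))"
        using loc_L1_mult_weight[OF g[OF that] w] by (rule integrable_norm)
      show "integrable lborel (\<lambda>x. M * (indicator (cball 0 r) x *\<^sub>R \<bar>g s x\<bar>))"
        using si unfolding set_integrable_def by (rule integrable_mult_right)
      show "norm (g s x * w x) \<le> M * (indicator (cball 0 r) x *\<^sub>R \<bar>g s x\<bar>)" for x
      proof (cases "norm x \<le> r")
        case True
        then show ?thesis using mult_right_mono[OF M(2)[of x], of "\<bar>g s x\<bar>"] by (simp add: abs_mult mult.commute)
      next
        case False
        then show ?thesis using w(2)[of x] by simp
      qed
    qed
    finally show ?thesis by (simp add: set_lebesgue_integral_def)
  qed
  have "((\<lambda>s. M * (LINT x:cball 0 r|lborel. \<bar>g s x\<bar>)) \<longlongrightarrow> M * 0) (at t within S)"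
    by (intro tendsto_intros lim)
  then have "((\<lambda>s. M * (LINT x:cball 0 r|lborel. \<bar>g s x\<bar>)) \<longlongrightarrow> 0) (at t within S)" by simp
  then show ?thesis
  proof (rule Lim_null_comparison[rotated])
    show "eventually (\<lambda>s. norm (LINT x|lborel. g s x * w x) \<le> M * (LINT x:cball 0 r|lborel. \<bar>g s x\<bar>)) (at t within S)"
      unfolding eventually_at_filter by (rule always_eventually) (use bd in blast)
  qed
qed

text \<open>Both unknowns satisfy these clauses, so differentiation of averages and the support of
  the time derivative are treated once for u and v.\<close>

locale C1_loc_L1 =
  fixes T :: real and u ut :: "real \<Rightarrow> 'a::euclidean_space \<Rightarrow> real"
  assumes loc: "\<And>t. 0 \<le> t \<Longrightarrow> t < T \<Longrightarrow> loc_L1 (u t)"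
    and loct: "\<And>t. 0 \<le> t \<Longrightarrow> t < T \<Longrightarrow> loc_L1 (ut t)"
    and diffq: "\<And>t K. 0 \<le> t \<Longrightarrow> t < T \<Longrightarrow> compact K \<Longrightarrow>
      ((\<lambda>s. LINT x:K|lborel. \<bar>(u s x - u t x) / (s - t) - ut t x\<bar>) \<longlongrightarrow> 0) (at t within {0..<T})"
    and contt: "\<And>t K. 0 \<le> t \<Longrightarrow> t < T \<Longrightarrow> compact K \<Longrightarrow>
      ((\<lambda>s. LINT x:K|lborel. \<bar>ut s x - ut t x\<bar>) \<longlongrightarrow> 0) (at t within {0..<T})"
begin

text \<open>Pairing with a bounded weight supported in a ball is continuous for the L1 norm on that
  ball, so it passes through the limit of difference quotients.\<close>

lemma pairing_deriv:
  assumes w: "continuous_on UNIV w" "\<And>x. norm x > r \<Longrightarrow> w x = 0" and t: "0 \<le> t" "t < T"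
  shows "((\<lambda>s. LINT x|lborel. u s x * w x) has_real_derivative (LINT x|lborel. ut t x * w x)) (at t within {0..<T})"
proof -
  have "((\<lambda>s. LINT x|lborel. ((u s x - u t x) / (s - t) - ut t x) * w x) \<longlongrightarrow> 0) (at t within {0..<T})"
  proof (rule pairing_tendsto_0[OF _ _ w])
    show "loc_L1 (\<lambda>x. (u s x - u t x) / (s - t) - ut t x)" if "s \<in> {0..<T}" for s
      using that t by (intro loc_L1_diff loc_L1_divide loc loct) auto
    show "((\<lambda>s. LINT x:cball 0 r|lborel. \<bar>(u s x - u t x) / (s - t) - ut t x\<bar>) \<longlongrightarrow> 0) (at t within {0..<T})"
      by (rule diffq[OF t]) simp
  qed
  moreover have "(LINT x|lborel. ((u s x - u t x) / (s - t) - ut t x) * w x)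
      = ((LINT x|lborel. u s x * w x) - (LINT x|lborel. u t x * w x)) / (s - t) - (LINT x|lborel. ut t x * w x)"
    if "s \<in> {0..<T}" for s
  proof -
    have i: "integrable lborel (\<lambda>x. u s x * w x)" "integrable lborel (\<lambda>x. u t x * w x)" "integrable lborel (\<lambda>x. ut t x * w x)"
      using that t by (auto intro!: loc_L1_mult_weight[OF _ w] loc loct)
    have "(\<lambda>x. ((u s x - u t x) / (s - t) - ut t x) * w x) = (\<lambda>x. (u s x * w x - u t x * w x) / (s - t) - ut t x * w x)"
      by (simp add: fun_eq_iff left_diff_distrib)
    then show ?thesis using i by simp
  qed
  ultimately have "((\<lambda>s. ((LINT x|lborel. u s x * w x) - (LINT x|lborel. u t x * w x)) / (s - t)
      - (LINT x|lborel. ut t x * w x)) \<longlongrightarrow> 0) (at t within {0..<T})"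
    by (rule tendsto_within_cong)
  then show ?thesis unfolding has_field_derivative_iff by (rule LIM_zero_cancel)
qed

lemma pairing_cont:
  assumes w: "continuous_on UNIV w" "\<And>x. norm x > r \<Longrightarrow> w x = 0"
  shows "continuous_on {0..<T} (\<lambda>s. LINT x|lborel. ut s x * w x)"
  unfolding continuous_on_def
proof
  fix t assume "t \<in> {0..<T}"
  then have t: "0 \<le> t" "t < T" by auto
  have "((\<lambda>s. LINT x|lborel. (ut s x - ut t x) * w x) \<longlongrightarrow> 0) (at t within {0..<T})"
    by (rule pairing_tendsto_0[OF _ contt[OF t] w]) (use t in \<open>auto intro!: loc_L1_diff loct\<close>)
  moreover have "(LINT x|lborel. (ut s x - ut t x) * w x) = (LINT x|lborel. ut s x * w x) - (LINT x|lborel. ut t x * w x)"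
    if "s \<in> {0..<T}" for s
  proof -
    have "integrable lborel (\<lambda>x. ut s x * w x)" "integrable lborel (\<lambda>x. ut t x * w x)"
      using that t by (auto intro!: loc_L1_mult_weight[OF _ w] loct)
    then show ?thesis by (simp add: left_diff_distrib)
  qed
  ultimately have "((\<lambda>s. (LINT x|lborel. ut s x * w x) - (LINT x|lborel. ut t x * w x)) \<longlongrightarrow> 0) (at t within {0..<T})"
    by (rule tendsto_within_cong)
  then show "((\<lambda>s. LINT x|lborel. ut s x * w x) \<longlongrightarrow> (LINT x|lborel. ut t x * w x)) (at t within {0..<T})"
    by (rule LIM_zero_cancel)
qed

text \<open>The solution concept prescribes the support of u only, so that of \<open>ut\<close> has
  to be derived. On a compact set at positive distance from the ball of radius R + t, u(s) and u(t)
  vanish for s close to t; the error of the difference quotient is then |ut t| itself, constant in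
  s, and its limit is 0.\<close>

lemma deriv_support:
  assumes supp: "\<And>s. 0 \<le> s \<Longrightarrow> s < T \<Longrightarrow> AE x in lborel. norm x > R + s \<longrightarrow> u s x = 0"
    and t: "0 \<le> t" "t < T"
  shows "AE x in lborel. norm x > R + t \<longrightarrow> ut t x = 0"
proof -
  have nt: "at t within {0..<T} \<noteq> bot"
  proof -
    obtain T' where T': "t < T'" "T' < T" using t dense by blast
    have "at t within {t..T'} \<le> at t within {0..<T}" using t T' by (intro at_le) auto
    moreover have "at t within {t..T'} = at_right t" using T'(1) by (rule at_within_Icc_at_right)
    moreover have "at_right t \<noteq> bot" using trivial_limit_at_right_real by simp
    ultimately show ?thesis by (metis bot.extremum_unique)
  qed
  have "AE x in lborel. x \<in> {x. R + t + inverse (real (Suc n)) \<le> norm x} \<inter> cball 0 (real n) \<longrightarrow> ut t x = 0" for n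
  proof -
    \<comment> \<open>Countably many such compact sets exhaust the exterior; the margin 1/(n+1) pays
      for the growth of the support from t to s.\<close>
    define K where "K = {x::'a. R + t + inverse (real (Suc n)) \<le> norm x} \<inter> cball 0 (real n)"
    have K: "compact K" unfolding K_def
      by (intro closed_Int_compact closed_Collect_le continuous_intros compact_cball)
    have si: "set_integrable lborel K (\<lambda>x. \<bar>ut t x\<bar>)"
      using loct[OF t] K unfolding loc_L1_def by (intro set_integrable_abs) auto
    have ev: "eventually (\<lambda>s. (LINT x:K|lborel. \<bar>(u s x - u t x) / (s - t) - ut t x\<bar>) = (LINT x:K|lborel. \<bar>ut t x\<bar>))
       (at t within {0..<T})"
    proof -
      have eq: "(LINT x:K|lborel. \<bar>(u s x - u t x) / (s - t) - ut t x\<bar>) = (LINT x:K|lborel. \<bar>ut t x\<bar>)"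
        if "s \<in> {0..<T}" "s < t + inverse (real (Suc n))" for s
        unfolding set_lebesgue_integral_def
      proof (rule integral_cong_AE)
        have "set_integrable lborel K (\<lambda>x. \<bar>(u s x - u t x) / (s - t) - ut t x\<bar>)"
        proof (rule set_integrable_abs)
          have "loc_L1 (\<lambda>x. (u s x - u t x) / (s - t) - ut t x)"
            using that t by (intro loc_L1_diff loc_L1_divide loc loct) auto
          then show "set_integrable lborel K (\<lambda>x. (u s x - u t x) / (s - t) - ut t x)"
            using K unfolding loc_L1_def by blast
        qed
        then show "(\<lambda>x. indicator K x *\<^sub>R \<bar>(u s x - u t x) / (s - t) - ut t x\<bar>) \<in> borel_measurable lborel"
          unfolding set_integrable_def by (rule borel_measurable_integrable)
        show "(\<lambda>x. indicator K x *\<^sub>R \<bar>ut t x\<bar>) \<in> borel_measurable lborel"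
          using si unfolding set_integrable_def by (rule borel_measurable_integrable)
        show "AE x in lborel. indicator K x *\<^sub>R \<bar>(u s x - u t x) / (s - t) - ut t x\<bar> = indicator K x *\<^sub>R \<bar>ut t x\<bar>"
        proof -
          have n: "inverse (real (Suc n)) > 0" by simp
          have "AE x in lborel. norm x > R + s \<longrightarrow> u s x = 0" "AE x in lborel. norm x > R + t \<longrightarrow> u t x = 0"
            using supp that t by auto
          then show ?thesis
          proof eventually_elim
            case (elim x)
            show ?case
            proof (cases "x \<in> K")
              case True
              then have "norm x \<ge> R + t + inverse (real (Suc n))" by (simp add: K_def)
              then have "norm x > R + s" "norm x > R + t" using that(2) n by linarith+
              then have "u s x = 0" "u t x = 0" using elim by auto
              then show ?thesis by simp
            qed simp
          qed
        qed
      qed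
      have "eventually (\<lambda>s. s < t + inverse (real (Suc n))) (at t within {0..<T})"
        by (rule order_tendstoD(2)[OF tendsto_ident_at]) simp
      moreover have "eventually (\<lambda>s. s \<in> {0..<T}) (at t within {0..<T})"
        unfolding eventually_at_filter by (auto intro!: always_eventually)
      ultimately show ?thesis by eventually_elim (rule eq)
    qed
    have "((\<lambda>s. LINT x:K|lborel. \<bar>(u s x - u t x) / (s - t) - ut t x\<bar>) \<longlongrightarrow> (LINT x:K|lborel. \<bar>ut t x\<bar>)) (at t within {0..<T})"
      by (rule tendsto_eventually[OF ev])
    then have z: "(LINT x:K|lborel. \<bar>ut t x\<bar>) = 0" using tendsto_unique[OF nt _ diffq[OF t K]] by blast
    have "(LINT x|lborel. indicator K x *\<^sub>R \<bar>ut t x\<bar>) = 0 \<longleftrightarrow> (AE x in lborel. indicator K x *\<^sub>R \<bar>ut t x\<bar> = 0)"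
      by (rule integral_nonneg_eq_0_iff_AE[OF si[unfolded set_integrable_def]]) simp
    then have "AE x in lborel. indicator K x *\<^sub>R \<bar>ut t x\<bar> = 0"
      using z unfolding set_lebesgue_integral_def by blast
    then show ?thesis unfolding K_def[symmetric]
    proof eventually_elim
      case (elim x)
      then show ?case by (cases "x \<in> K") simp_all
    qed
  qed
  then have "AE x in lborel. \<forall>n. x \<in> {x. R + t + inverse (real (Suc n)) \<le> norm x} \<inter> cball 0 (real n) \<longrightarrow> ut t x = 0"
    unfolding AE_all_countable by blast
  then show ?thesis
  proof eventually_elim
    case (elim x)
    show ?case
    proof
      assume "norm x > R + t"
      then obtain n where n: "inverse (real (Suc n)) < norm x - (R + t)" using reals_Archimedean[of "norm x - (R + t)"] by auto
      obtain m where m: "norm x \<le> real m" using real_arch_simple by blast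
      have "inverse (real (Suc (max n m))) \<le> inverse (real (Suc n))" by (intro le_imp_inverse_le) auto
      then have "R + t + inverse (real (Suc (max n m))) \<le> norm x" using n by linarith
      moreover have "norm x \<le> real (max n m)" using m by simp
      ultimately have "x \<in> {x. R + t + inverse (real (Suc (max n m))) \<le> norm x} \<inter> cball 0 (real (max n m))"
        unfolding Int_iff mem_Collect_eq mem_cball_0 by blast
      then show "ut t x = 0" using elim by blast
    qed
  qed
qed

end

text \<open>Fubini on the cylinder over a ball containing the support of w. Slices are integrable
  for almost every time only, so the later estimates of the nonlinearity hold almost everywhere in
  time.\<close>

lemma nonlinear_integrable:
  fixes a :: "real \<Rightarrow> 'a::euclidean_space \<Rightarrow> real" and w :: "'a \<Rightarrow> real"
  assumes a: "set_integrable lborel ({0..t} \<times> cball 0 r) (\<lambda>(s, x). a s x)"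
    and w: "continuous_on UNIV w" "\<And>x. norm x > r \<Longrightarrow> w x = 0"
  shows "set_integrable lborel {0..t} (\<lambda>s. LINT x|lborel. a s x * w x)" (is ?A)
    and "AE s in lborel. s \<in> {0..t} \<longrightarrow> integrable lborel (\<lambda>x. a s x * w x)" (is ?B)
proof -
  obtain M where M: "M \<ge> 0" "\<And>x. \<bar>w x\<bar> \<le> M" using bounded_weight[OF w] by auto
  let ?K = "{0..t} \<times> cball (0::'a) r"
  let ?f = "\<lambda>z. indicator ?K z *\<^sub>R (case z of (s, x) \<Rightarrow> a s x)"
  have fi: "integrable lborel ?f" using a by (simp add: set_integrable_def)
  have wm: "(\<lambda>z. w (snd z)) \<in> borel_measurable (lborel :: (real \<times> 'a) measure)"
  proof -
    have "continuous_on UNIV (\<lambda>z::real \<times> 'a. w (snd z))"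
      by (rule continuous_on_compose2[OF w(1)]) (auto intro: continuous_intros)
    then show ?thesis by (simp add: borel_measurable_continuous_onI)
  qed
  have "integrable lborel (\<lambda>z. ?f z * w (snd z))"
  proof (rule Bochner_Integration.integrable_bound[where f="\<lambda>z. M * ?f z"])
    show "integrable lborel (\<lambda>z. M * ?f z)" using fi by (rule integrable_mult_right)
    show "(\<lambda>z. ?f z * w (snd z)) \<in> borel_measurable lborel"
      by (rule borel_measurable_times[OF borel_measurable_integrable[OF fi] wm])
    show "AE z in lborel. norm (?f z * w (snd z)) \<le> norm (M * ?f z)"
      using M by (intro AE_I2 norm_mult_le_bound)
  qed
  then have i: "integrable (lborel \<Otimes>\<^sub>M lborel) (\<lambda>z. ?f z * w (snd z))" by (simp add: lborel_prod)
  have eq: "?f (s, x) * w (snd (s, x)) = indicator {0..t} s *\<^sub>R (a s x * w x)" for s x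
    using w(2)[of x] by (cases "norm x \<le> r") (auto simp: indicator_def)
  have "integrable lborel (\<lambda>s. LINT x|lborel. ?f (s, x) * w (snd (s, x)))"
    by (rule lborel_pair.integrable_fst'[OF i])
  then have "integrable lborel (\<lambda>s. LINT x|lborel. indicator {0..t} s *\<^sub>R (a s x * w x))" unfolding eq .
  then show ?A unfolding set_integrable_def by (simp only: integral_scaleR_right)
  have "AE s in lborel. integrable lborel (\<lambda>x. ?f (s, x) * w (snd (s, x)))"
    by (rule lborel_pair.AE_integrable_fst'[OF i])
  then have "AE s in lborel. integrable lborel (\<lambda>x. indicator {0..t} s *\<^sub>R (a s x * w x))" unfolding eq .
  then show ?B
  proof eventually_elim
    case (elim s)
    show ?case
    proof
      assume "s \<in> {0..t}"
      then have "indicator {0..t} s = (1::real)" by simp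
      then show "integrable lborel (\<lambda>x. a s x * w x)" using elim by simp
    qed
  qed
qed

text \<open>The partial derivatives \<open>dw b\<close> are themselves test functions, so one use of
  the weak gradient per direction produces the Laplacian of w; it equals w on the ball of radius
  \<rho>, outside of which f vanishes.\<close>

lemma (in exp_weight) gradient_pairing:
  assumes g: "weak_grad f g" and supp: "AE x in lborel. norm x > \<rho> \<longrightarrow> f x = 0"
  shows "integrable lborel (\<lambda>x. g x \<bullet> (\<Sum>b\<in>Basis. dw b x *\<^sub>R b))" (is ?A)
    and "(LINT x|lborel. g x \<bullet> (\<Sum>b\<in>Basis. dw b x *\<^sub>R b)) = - (LINT x|lborel. f x * w x)" (is ?B)
proof -
  have eq: "g x \<bullet> (\<Sum>b\<in>Basis. dw b x *\<^sub>R b) = (\<Sum>b\<in>Basis. (g x \<bullet> b) * dw b x)" for x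
    by (simp add: inner_sum_right mult.commute)
  have gi: "integrable lborel (\<lambda>x. (g x \<bullet> b) * dw b x)" if "b \<in> Basis" for b
    using g that unfolding weak_grad_def
    by (intro loc_L1_mult_weight[OF _ cont_dw[OF that] supp_dw[OF that]]) auto
  have fi: "integrable lborel (\<lambda>x. f x * ddw b x)" if "b \<in> Basis" for b
    using g unfolding weak_grad_def
    by (intro loc_L1_mult_weight[OF _ cont_ddw[OF that] supp_ddw[OF that]]) auto
  have wi: "integrable lborel (\<lambda>x. f x * w x)"
    using g unfolding weak_grad_def by (intro loc_L1_mult_weight[OF _ cont_w supp_w]) auto
  show ?A unfolding eq using gi by (intro Bochner_Integration.integrable_sum)
  have "(LINT x|lborel. g x \<bullet> (\<Sum>b\<in>Basis. dw b x *\<^sub>R b)) = (\<Sum>b\<in>Basis. LINT x|lborel. (g x \<bullet> b) * dw b x)"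
    unfolding eq using gi by (intro Bochner_Integration.integral_sum)
  also have "\<dots> = (\<Sum>b\<in>Basis. - (LINT x|lborel. f x * ddw b x))"
  proof (rule sum.cong[OF refl])
    fix b :: 'a assume b: "b \<in> Basis"
    have "(LINT x|lborel. f x * partial_dir b (dw b) x) = - (LINT x|lborel. (g x \<bullet> b) * dw b x)"
      using g test_dw[OF b] b unfolding weak_grad_def by blast
    then show "(LINT x|lborel. (g x \<bullet> b) * dw b x) = - (LINT x|lborel. f x * ddw b x)"
      by (simp add: partial_dw[OF b])
  qed
  also have "\<dots> = - (LINT x|lborel. (\<Sum>b\<in>Basis. f x * ddw b x))"
    using fi by (simp add: sum_negf Bochner_Integration.integral_sum)
  also have "(LINT x|lborel. (\<Sum>b\<in>Basis. f x * ddw b x)) = (LINT x|lborel. f x * w x)"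
  proof (rule integral_cong_AE)
    show "(\<lambda>x. \<Sum>b\<in>Basis. f x * ddw b x) \<in> borel_measurable lborel"
      using fi by (intro borel_measurable_sum) auto
    show "(\<lambda>x. f x * w x) \<in> borel_measurable lborel" using wi by auto
    show "AE x in lborel. (\<Sum>b\<in>Basis. f x * ddw b x) = f x * w x" using supp
    proof eventually_elim
      case (elim x)
      then show ?case using laplace[of x] by (cases "norm x \<le> \<rho>") (auto simp: sum_distrib_left[symmetric])
    qed
  qed
  finally show ?B .
qed

subsection \<open>Functionals of a weak solution\<close>

text \<open>The weak identities are given for t > 0, and the initial velocities enter only through
  them; passing to t = 0 by continuity recovers the averaged velocities at time 0.\<close>

lemma continuous_eq_at_0:
  fixes f g :: "real \<Rightarrow> real"
  assumes f: "continuous_on {0..<T} f" and g: "continuous_on {0..<T} g" and T: "T > 0"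
    and eq: "\<And>t. 0 < t \<Longrightarrow> t < T \<Longrightarrow> f t = g t" and t: "0 \<le> t" "t < T"
  shows "f t = g t"
proof (cases "t = 0")
  case False then show ?thesis using eq t by simp
next
  case True
  show ?thesis
  proof (rule ccontr)
    assume "f t \<noteq> g t"
    then have ne: "\<bar>f 0 - g 0\<bar> > 0" using True by simp
    have "continuous_on {0..<T} (\<lambda>t. f t - g t)" by (intro continuous_intros f g)
    then obtain d where d: "d > 0"
      "\<And>t. 0 \<le> t \<Longrightarrow> t < T \<Longrightarrow> \<bar>t - 0\<bar> < d \<Longrightarrow> \<bar>(f t - g t) - (f 0 - g 0)\<bar> < \<bar>f 0 - g 0\<bar>"
      using continuous_nbhd[OF _ _ T ne, of "\<lambda>t. f t - g t"] by auto
    define s where "s = min (d / 2) (T / 2)"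
    have "0 < s" "s < d" "s < T" using d(1) T by (auto simp: s_def)
    then show False using d(2)[of s] eq[of s] by simp
  qed
qed

lemma set_integral_eq_HK:
  fixes f :: "real \<Rightarrow> real"
  assumes "continuous_on {0..<T} f" "t < T"
  shows "(LINT s:{0..t}|lborel. f s) = integral {0..t} f"
proof -
  have "continuous_on {0..t} f" by (rule continuous_on_subset[OF assms(1)]) (use assms(2) in auto)
  then have "set_integrable lborel {0..t} f" by (rule borel_integrable_atLeastAtMost')
  then show ?thesis by (rule set_borel_integral_eq_integral(2))
qed

lemma integral_mono_AE_HK:
  fixes f g :: "real \<Rightarrow> real"
  assumes "continuous_on {s..t} f" "set_integrable lborel {s..t} g"
    and "AE x in lborel. x \<in> {s..t} \<longrightarrow> f x \<le> g x"
  shows "integral {s..t} f \<le> integral {s..t} g"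
proof -
  have f: "set_integrable lborel {s..t} f" using assms(1) by (rule borel_integrable_atLeastAtMost')
  have "(LINT x:{s..t}|lborel. f x) \<le> (LINT x:{s..t}|lborel. g x)"
    unfolding set_lebesgue_integral_def
  proof (rule integral_mono_AE)
    show "AE x in lborel. indicator {s..t} x *\<^sub>R f x \<le> indicator {s..t} x *\<^sub>R g x"
      using assms(3)
    proof eventually_elim
      case (elim x) then show ?case by (cases "x \<in> {s..t}") auto
    qed
  qed (use f assms(2) in \<open>simp_all add: set_integrable_def\<close>)
  then show ?thesis
    by (simp add: set_borel_integral_eq_integral(2)[OF f] set_borel_integral_eq_integral(2)[OF assms(2)])
qed

text \<open>Hoelder's inequality on each time slice, over the ball of radius R + y, where w is
  exactly exponential and has mass at most E = D e^y (1+y)^\<beta>. The exponentials balance: e^(-y)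
  e^(-y(p-1)) = e^(-yp) is the power contained in |A|^p, and only the polynomial weight
  remains.\<close>

lemma (in exp_weight) nonlinear_functional:
  fixes a :: "real \<Rightarrow> 'a \<Rightarrow> real" and p \<beta> D d T R :: real
  defines "\<beta> \<equiv> (real DIM('a) - 1) / 2"
  defines "A \<equiv> \<lambda>s. exp (- s) * (LINT x|lborel. a s x * w x)"
  defines "f \<equiv> \<lambda>s. exp (- s) * (LINT x|lborel. \<bar>a s x\<bar> powr p * w x)"
  assumes e: "e \<in> Basis" and p: "p > 1" and R: "R > 0" and rho: "R + T \<le> \<rho>"
    and D: "D \<ge> 2 * exp R * (4 * pi * max 1 R) powr \<beta>" and d: "d \<le> D powr (- (p - 1))"
    and loc: "\<And>t. 0 \<le> t \<Longrightarrow> t < T \<Longrightarrow> loc_L1 (a t)"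
    and supp: "\<And>t. 0 \<le> t \<Longrightarrow> t < T \<Longrightarrow> AE x in lborel. norm x > R + t \<longrightarrow> a t x = 0"
    and Lp: "\<And>K. compact K \<Longrightarrow> K \<subseteq> {0..<T} \<times> UNIV \<Longrightarrow> set_integrable lborel K (\<lambda>(s, x). \<bar>a s x\<bar> powr p)"
    and contA: "continuous_on {0..<T} A"
  shows "\<And>t. 0 \<le> t \<Longrightarrow> t < T \<Longrightarrow> set_integrable lborel {0..t} f"
    and "\<And>t. 0 \<le> t \<Longrightarrow> t < T \<Longrightarrow> (LINT s:{0..t}|lborel. f s) = integral {0..t} f"
    and "continuous_on {0..<T} (\<lambda>t. integral {0..t} f)"
    and "\<And>s t. 0 \<le> s \<Longrightarrow> s \<le> t \<Longrightarrow> t < T \<Longrightarrow> integral {0..t} f - integral {0..s} f \<ge>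
      integral {s..t} (\<lambda>x. d * \<bar>A x\<bar> powr p * (1 + x) powr (- \<beta> * (p - 1)))"
proof -
  have beta: "\<beta> \<ge> 0" using DIM_positive[where 'a='a] by (simp add: \<beta>_def Suc_leI)
  have "2 * exp R * (4 * pi * max 1 R) powr \<beta> > 0" using R by simp
  then have D0: "D > 0" using D by linarith
  have N: "set_integrable lborel {0..t} (\<lambda>s. LINT x|lborel. \<bar>a s x\<bar> powr p * w x)"
    "AE s in lborel. s \<in> {0..t} \<longrightarrow> integrable lborel (\<lambda>x. \<bar>a s x\<bar> powr p * w x)" if "0 \<le> t" "t < T" for t
  proof -
    have "set_integrable lborel ({0..t} \<times> cball 0 r) (\<lambda>(s, x). \<bar>a s x\<bar> powr p)"
      by (rule Lp) (use that in \<open>auto intro: compact_Times\<close>)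
    note * = nonlinear_integrable[OF this cont_w supp_w]
    show "set_integrable lborel {0..t} (\<lambda>s. LINT x|lborel. \<bar>a s x\<bar> powr p * w x)" by (rule *(1))
    show "AE s in lborel. s \<in> {0..t} \<longrightarrow> integrable lborel (\<lambda>x. \<bar>a s x\<bar> powr p * w x)" by (rule *(2))
  qed
  show fi: "set_integrable lborel {0..t} f" if "0 \<le> t" "t < T" for t
  proof -
    have "set_integrable lborel {0..t} (\<lambda>s. (LINT x|lborel. \<bar>a s x\<bar> powr p * w x) * exp (- s))"
      by (rule set_integrable_mult_continuous[OF N(1)[OF that]]) (intro continuous_intros)
    then show ?thesis unfolding f_def by (simp add: mult.commute)
  qed
  show "(LINT s:{0..t}|lborel. f s) = integral {0..t} f" if "0 \<le> t" "t < T" for t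
    by (rule set_borel_integral_eq_integral(2)[OF fi[OF that]])
  have fHK: "f integrable_on {0..t}" if "0 \<le> t" "t < T" for t
    by (rule set_borel_integral_eq_integral(1)[OF fi[OF that]])
  show "continuous_on {0..<T} (\<lambda>t. integral {0..t} f)" by (rule continuous_integral[OF fHK])
  show "integral {0..t} f - integral {0..s} f \<ge>
      integral {s..t} (\<lambda>x. d * \<bar>A x\<bar> powr p * (1 + x) powr (- \<beta> * (p - 1)))" if st: "0 \<le> s" "s \<le> t" "t < T" for s t
  proof -
    have t: "0 \<le> t" "t < T" using st by auto
    have "integral {s..t} (\<lambda>x. d * \<bar>A x\<bar> powr p * (1 + x) powr (- \<beta> * (p - 1))) \<le> integral {s..t} f"
    proof (rule integral_mono_AE_HK)
      show "continuous_on {s..t} (\<lambda>x. d * \<bar>A x\<bar> powr p * (1 + x) powr (- \<beta> * (p - 1)))"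
        using st p by (intro continuous_intros continuous_on_powr' continuous_on_subset[OF contA]) auto
      show "set_integrable lborel {s..t} f" by (rule set_integrable_subset[OF fi[OF t]]) (use st in auto)
      show "AE x in lborel. x \<in> {s..t} \<longrightarrow> d * \<bar>A x\<bar> powr p * (1 + x) powr (- \<beta> * (p - 1)) \<le> f x"
        using N(2)[OF t]
      proof eventually_elim
        case (elim y)
        show ?case
        proof
          assume y: "y \<in> {s..t}"
          then have yT: "0 \<le> y" "y < T" using st by auto
          have ip: "integrable lborel (\<lambda>x. \<bar>a y x\<bar> powr p * w x)" using elim y st by auto
          let ?B = "cball (0::'a) (R + y)"
          define E where "E = D * exp y * (1 + y) powr \<beta>"
          have E0: "E > 0" using D0 yT by (simp add: E_def)
          have Ry: "R + y > 0" using R yT by simp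
          have eqB: "indicator ?B x * w x = indicator ?B x * exp (x \<bullet> e)" for x
            using w_exp[of x] rho yT by (cases "x \<in> ?B") auto
          have "(4 * pi * (R + y)) powr \<beta> \<le> (4 * pi * max 1 R * (1 + y)) powr \<beta>"
          proof (rule powr_mono2[OF beta])
            \<comment> \<open>R + y is bounded by max 1 R times 1 + y, which separates the initial
              radius from time; hence the \<open>max 1 R\<close> in D.\<close>
            have "R \<le> max 1 R * 1" by simp
            moreover have "1 * y \<le> max 1 R * y" by (rule mult_right_mono) (use yT in auto)
            ultimately have "R + y \<le> max 1 R * (1 + y)" by (simp add: distrib_left)
            then have "4 * pi * (R + y) \<le> 4 * pi * (max 1 R * (1 + y))" by (intro mult_left_mono) auto
            then show "4 * pi * (R + y) \<le> 4 * pi * max 1 R * (1 + y)" by (simp only: mult.assoc)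
          qed (use Ry in simp)
          also have "\<dots> = (4 * pi * max 1 R) powr \<beta> * (1 + y) powr \<beta>" by (rule powr_mult)
          finally have pw: "(4 * pi * (R + y)) powr \<beta> \<le> (4 * pi * max 1 R) powr \<beta> * (1 + y) powr \<beta>" .
          have "(LINT x|lborel. indicator ?B x * w x) \<le> 2 * exp (R + y) * (4 * pi * (R + y)) powr \<beta>"
            unfolding eqB \<beta>_def by (rule integral_exp_ball(2)[OF e Ry])
          also have "\<dots> \<le> 2 * exp (R + y) * ((4 * pi * max 1 R) powr \<beta> * (1 + y) powr \<beta>)"
            using pw by (intro mult_left_mono) auto
          also have "\<dots> = (2 * exp R * (4 * pi * max 1 R) powr \<beta>) * exp y * (1 + y) powr \<beta>"
            by (simp only: exp_add mult_ac)
          also have "\<dots> \<le> E" unfolding E_def using D by (intro mult_right_mono) auto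
          finally have BE: "(LINT x|lborel. indicator ?B x * w x) \<le> E" .
          have "\<bar>LINT x|lborel. a y x * w x\<bar> powr p * E powr (- (p - 1)) \<le> (LINT x|lborel. \<bar>a y x\<bar> powr p * w x)"
          proof (rule reverse_Holder[OF p w_nonneg _ ip _ _ BE E0])
            show "integrable lborel (\<lambda>x. a y x * w x)" by (rule loc_L1_mult_weight[OF loc[OF yT] cont_w supp_w])
            show "AE x in lborel. x \<notin> ?B \<longrightarrow> a y x = 0" using supp[OF yT] by (simp add: not_le)
            show "integrable lborel (\<lambda>x. indicator ?B x * w x)" unfolding eqB by (rule integral_exp_ball(1)[OF e Ry])
          qed
          then have "exp (- y) * (\<bar>LINT x|lborel. a y x * w x\<bar> powr p * E powr (- (p - 1))) \<le> f y"
            unfolding f_def by (intro mult_left_mono) auto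
          moreover have "exp (- y) * (\<bar>LINT x|lborel. a y x * w x\<bar> powr p * E powr (- (p - 1)))
              = D powr (- (p - 1)) * \<bar>A y\<bar> powr p * (1 + y) powr (- \<beta> * (p - 1))"
          proof -
            have "\<bar>A y\<bar> powr p = exp (- y * p) * \<bar>LINT x|lborel. a y x * w x\<bar> powr p"
              by (simp add: A_def abs_mult powr_mult exp_powr_real)
            moreover have "E powr (- (p - 1)) = D powr (- (p - 1)) * exp (- y * (p - 1)) * (1 + y) powr (- \<beta> * (p - 1))"
              by (simp add: E_def powr_mult exp_powr_real powr_powr) (simp add: algebra_simps)
            moreover have "exp (- y * p) = exp (- y) * exp (- y * (p - 1))"
              by (simp add: exp_add[symmetric] algebra_simps)
            ultimately show ?thesis by (simp only: mult_ac)
          qed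
          moreover have "d * \<bar>A y\<bar> powr p * (1 + y) powr (- \<beta> * (p - 1))
              \<le> D powr (- (p - 1)) * \<bar>A y\<bar> powr p * (1 + y) powr (- \<beta> * (p - 1))"
            using d by (intro mult_right_mono) auto
          ultimately show "d * \<bar>A y\<bar> powr p * (1 + y) powr (- \<beta> * (p - 1)) \<le> f y" by linarith
        qed
      qed
    qed
    then show ?thesis using integral_increment[OF fHK[OF t] st(1,2)] by simp
  qed
qed

lemma (in exp_weight) exp_pairing_deriv:
  assumes "C1_loc_L1 T u ut" and t: "0 < t" "t < T"
  shows "((\<lambda>s. exp (- s) * (LINT x|lborel. u s x * w x)) has_real_derivative
     exp (- t) * (LINT x|lborel. ut t x * w x) - exp (- t) * (LINT x|lborel. u t x * w x)) (at t)"
proof -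
  interpret C1_loc_L1 T u ut by fact
  have "((\<lambda>s. LINT x|lborel. u s x * w x) has_real_derivative (LINT x|lborel. ut t x * w x)) (at t within {0..<T})"
    by (rule pairing_deriv[OF cont_w supp_w]) (use t in auto)
  moreover have "at t within {0..<T} = at t" by (rule at_within_interior) (use t in simp)
  ultimately have "((\<lambda>s. LINT x|lborel. u s x * w x) has_real_derivative (LINT x|lborel. ut t x * w x)) (at t)" by simp
  then show ?thesis by (auto intro!: derivative_eq_intros)
qed

lemma (in exp_weight) exp_pairing_cont:
  assumes "C1_loc_L1 T u ut"
  shows "continuous_on {0..<T} (\<lambda>s. exp (- s) * (LINT x|lborel. u s x * w x))"
    and "continuous_on {0..<T} (\<lambda>s. exp (- s) * (LINT x|lborel. ut s x * w x))"
proof -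
  interpret C1_loc_L1 T u ut by fact
  have "continuous_on {0..<T} (\<lambda>s. LINT x|lborel. u s x * w x)"
    by (rule DERIV_continuous_on, rule pairing_deriv[OF cont_w supp_w]) auto
  then show "continuous_on {0..<T} (\<lambda>s. exp (- s) * (LINT x|lborel. u s x * w x))"
    by (intro continuous_intros)
  show "continuous_on {0..<T} (\<lambda>s. exp (- s) * (LINT x|lborel. ut s x * w x))"
    by (intro continuous_intros pairing_cont[OF cont_w supp_w])
qed

lemma (in exp_weight) spacetime_integrand:
  assumes g: "weak_grad f g" and supp: "AE x in lborel. norm x > \<rho> \<longrightarrow> f x = 0" and h: "loc_L1 h"
  shows "(LINT x|lborel. c * (h x * w x) + g x \<bullet> (\<Sum>b\<in>Basis. (k * dw b x) *\<^sub>R b))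
     = c * (LINT x|lborel. h x * w x) - k * (LINT x|lborel. f x * w x)"
proof -
  have i: "integrable lborel (\<lambda>x. h x * w x)" by (rule loc_L1_mult_weight[OF h cont_w supp_w])
  have eq: "g x \<bullet> (\<Sum>b\<in>Basis. (k * dw b x) *\<^sub>R b) = k * (g x \<bullet> (\<Sum>b\<in>Basis. dw b x *\<^sub>R b))" for x
    by (simp add: inner_sum_right sum_distrib_left mult.assoc)
  show ?thesis unfolding eq
    using i gradient_pairing[OF g supp] by simp
qed

text \<open>For given T the weight is exact on the ball of radius R + T, which contains all
  supports. Although the cutoff depends on T, the constants D, d, c0 and I do not, so the resulting
  system is uniform in T and \<epsilon>.\<close>

lemma weak_solution_coupled_system:
  fixes b :: "real \<Rightarrow> real" and u0 u1 v0 v1 :: "'a::euclidean_space \<Rightarrow> real" and p q R T \<epsilon> \<beta> D d c0 :: real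
  defines "\<beta> \<equiv> (real DIM('a) - 1) / 2"
  defines "D \<equiv> 2 * exp R * (4 * pi * max 1 R) powr \<beta>"
  defines "d \<equiv> min (D powr (- (p - 1))) (D powr (- (q - 1)))"
  defines "c0 \<equiv> 1 / 4 * exp (- 4 * integral {0..} b)"
  assumes e: "e \<in> Basis" and p: "p > 1" and q: "q > 1" and R: "R > 0"
    and b: "set_integrable lborel {0..} b" "\<And>t. t \<ge> 0 \<Longrightarrow> b t \<ge> 0"
    and v1: "loc_L1 v1" "\<And>x. norm x > R \<Longrightarrow> v1 x = 0"
    and I: "I = (LINT x|lborel. v1 x * exp (x \<bullet> e))" "I > 0"
    and u0: "loc_L1 u0" "\<And>x. u0 x \<ge> 0" "\<And>x. norm x > R \<Longrightarrow> u0 x = 0"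
    and u1: "loc_L1 u1" "\<And>x. u1 x \<ge> u0 x"
    and v0: "loc_L1 v0" "\<And>x. v0 x \<ge> 0" "\<And>x. norm x > R \<Longrightarrow> v0 x = 0"
    and eps: "0 < \<epsilon>" "\<epsilon> \<le> 1" and T: "T > 0"
    and sol: "weak_solution b p q \<epsilon> u0 u1 v0 v1 R T u v"
  shows "\<exists>W W' X X'. coupled_system p q \<beta> (min d (c0 powr p * d)) (2 + (sqrt 5 - 1) / 2) I T \<epsilon> W W' X X'"
proof -
  obtain ut vt gu gv where
    grads: "\<forall>t\<in>{0..<T}. weak_grad (u t) (gu t) \<and> weak_grad (v t) (gv t) \<and> loc_L1 (ut t) \<and> loc_L1 (vt t)"
    and C1: "\<forall>t\<in>{0..<T}. \<forall>K. compact K \<longrightarrow>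
        ((\<lambda>s. LINT x:K|lborel. \<bar>(u s x - u t x) / (s - t) - ut t x\<bar>) \<longlongrightarrow> 0) (at t within {0..<T}) \<and>
        ((\<lambda>s. LINT x:K|lborel. \<bar>(v s x - v t x) / (s - t) - vt t x\<bar>) \<longlongrightarrow> 0) (at t within {0..<T}) \<and>
        ((\<lambda>s. LINT x:K|lborel. \<bar>ut s x - ut t x\<bar>) \<longlongrightarrow> 0) (at t within {0..<T}) \<and>
        ((\<lambda>s. LINT x:K|lborel. \<bar>vt s x - vt t x\<bar>) \<longlongrightarrow> 0) (at t within {0..<T})"
    and Lpq: "\<forall>K. compact K \<and> K \<subseteq> {0..<T} \<times> UNIV \<longrightarrow>
        set_integrable lborel K (\<lambda>(s, x). \<bar>ut s x\<bar> powr q) \<and>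
        set_integrable lborel K (\<lambda>(s, x). \<bar>vt s x\<bar> powr p)"
    and supp: "\<forall>t\<in>{0<..<T}. AE x in lborel. norm x > R + t \<longrightarrow> u t x = 0 \<and> v t x = 0"
    and init: "AE x in lborel. u 0 x = \<epsilon> * u0 x" "AE x in lborel. v 0 x = \<epsilon> * v0 x"
    and weak: "\<forall>t\<in>{0<..<T}. \<forall>\<phi> \<psi>. st_test_fun T \<phi> \<and> st_test_fun T \<psi> \<longrightarrow>
        (LINT s:{0..t}|lborel. LINT x|lborel.
            - ut s x * dt \<phi> (s, x) + ut s x * \<phi> (s, x) + gu s x \<bullet> gradx \<phi> (s, x))
          + (LINT x|lborel. ut t x * \<phi> (t, x))
        = \<epsilon> * (LINT x|lborel. u1 x * \<phi> (0, x))
          + (LINT s:{0..t}|lborel. LINT x|lborel. \<bar>vt s x\<bar> powr p * \<phi> (s, x))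
      \<and>
        (LINT s:{0..t}|lborel. LINT x|lborel.
            - vt s x * dt \<psi> (s, x) + gv s x \<bullet> gradx \<psi> (s, x) + b s * vt s x * \<psi> (s, x))
          + (LINT x|lborel. vt t x * \<psi> (t, x))
        = \<epsilon> * (LINT x|lborel. v1 x * \<psi> (0, x))
          + (LINT s:{0..t}|lborel. LINT x|lborel. \<bar>ut s x\<bar> powr q * \<psi> (s, x))"
    using sol unfolding weak_solution_def by (elim exE conjE) (rule that)
  have rho: "R + T > 0" using R T by simp
  obtain r w dw ddw where ew: "exp_weight e (R + T) r w dw ddw"
    using exp_weight_exists[OF e rho] by blast
  interpret exp_weight e "R + T" r w dw ddw by (rule ew)
  have Cu: "C1_loc_L1 T u ut" and Cv: "C1_loc_L1 T v vt"
    using grads C1 by (unfold_locales; simp add: weak_grad_def)+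
  have su: "AE x in lborel. norm x > R + t \<longrightarrow> u t x = 0" if t: "0 \<le> t" "t < T" for t
  proof (cases "t = 0")
    case True
    show ?thesis using init(1) by eventually_elim (use u0(3) True in simp)
  next
    case False
    then have "AE x in lborel. norm x > R + t \<longrightarrow> u t x = 0 \<and> v t x = 0" using supp t by simp
    then show ?thesis by eventually_elim simp
  qed
  have sv: "AE x in lborel. norm x > R + t \<longrightarrow> v t x = 0" if t: "0 \<le> t" "t < T" for t
  proof (cases "t = 0")
    case True
    show ?thesis using init(2) by eventually_elim (use v0(3) True in simp)
  next
    case False
    then have "AE x in lborel. norm x > R + t \<longrightarrow> u t x = 0 \<and> v t x = 0" using supp t by simp
    then show ?thesis by eventually_elim simp
  qed
  have sut: "AE x in lborel. norm x > R + t \<longrightarrow> ut t x = 0" if t: "0 \<le> t" "t < T" for t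
    by (rule C1_loc_L1.deriv_support[OF Cu su t])
  have svt: "AE x in lborel. norm x > R + t \<longrightarrow> vt t x = 0" if t: "0 \<le> t" "t < T" for t
    by (rule C1_loc_L1.deriv_support[OF Cv sv t])
  define U where "U s = exp (- s) * (LINT x|lborel. u s x * w x)" for s
  define U1 where "U1 s = exp (- s) * (LINT x|lborel. ut s x * w x)" for s
  define V where "V s = exp (- s) * (LINT x|lborel. v s x * w x)" for s
  define V1 where "V1 s = exp (- s) * (LINT x|lborel. vt s x * w x)" for s
  define f where "f s = exp (- s) * (LINT x|lborel. \<bar>vt s x\<bar> powr p * w x)" for s
  define g where "g s = exp (- s) * (LINT x|lborel. \<bar>ut s x\<bar> powr q * w x)" for s
  have contU: "continuous_on {0..<T} U" and contU1: "continuous_on {0..<T} U1"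
    unfolding U_def U1_def by (rule exp_pairing_cont[OF Cu])+
  have contV: "continuous_on {0..<T} V" and contV1: "continuous_on {0..<T} V1"
    unfolding V_def V1_def by (rule exp_pairing_cont[OF Cv])+
  have derU: "(U has_real_derivative U1 t - U t) (at t)" if "0 < t" "t < T" for t
    unfolding U_def U1_def by (rule exp_pairing_deriv[OF Cu that])
  have derV: "(V has_real_derivative V1 t - V t) (at t)" if "0 < t" "t < T" for t
    unfolding V_def V1_def by (rule exp_pairing_deriv[OF Cv that])
  have locut: "loc_L1 (ut t)" and locvt: "loc_L1 (vt t)" and gru: "weak_grad (u t) (gu t)" and grv: "weak_grad (v t) (gv t)"
    if "0 \<le> t" "t < T" for t using grads that by auto
  have dp: "d \<le> D powr (- (p - 1))" and dq: "d \<le> D powr (- (q - 1))" by (auto simp: d_def)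
  have "D > 0" using R by (simp add: D_def)
  then have d0: "d > 0" by (simp add: d_def)
  have Lp: "set_integrable lborel K (\<lambda>(s, x). \<bar>vt s x\<bar> powr p)" and Lq: "set_integrable lborel K (\<lambda>(s, x). \<bar>ut s x\<bar> powr q)"
    if "compact K" "K \<subseteq> {0..<T} \<times> UNIV" for K using Lpq that by auto
  have DD: "2 * exp R * (4 * pi * max 1 R) powr ((real DIM('a) - 1) / 2) \<le> D" by (simp add: D_def \<beta>_def)
  note NF = nonlinear_functional[OF e p R order_refl DD dp locvt svt Lp exp_pairing_cont(2)[OF Cv]]
  note NG = nonlinear_functional[OF e q R order_refl DD dq locut sut Lq exp_pairing_cont(2)[OF Cu]]
  have F2: "(LINT s:{0..t}|lborel. f s) = integral {0..t} f" if "0 \<le> t" "t < T" for t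
    unfolding f_def[abs_def] by (rule NF(2)) (use that in auto)
  have G2: "(LINT s:{0..t}|lborel. g s) = integral {0..t} g" if "0 \<le> t" "t < T" for t
    unfolding g_def[abs_def] by (rule NG(2)) (use that in auto)
  have F3: "continuous_on {0..<T} (\<lambda>t. integral {0..t} f)" unfolding f_def[abs_def] by (rule NF(3)) auto
  have G3: "continuous_on {0..<T} (\<lambda>t. integral {0..t} g)" unfolding g_def[abs_def] by (rule NG(3)) auto
  have F4: "integral {0..t} f - integral {0..s} f \<ge>
      integral {s..t} (\<lambda>x. d * \<bar>V1 x\<bar> powr p * (1 + x) powr (- \<beta> * (p - 1)))" if "0 \<le> s" "s \<le> t" "t < T" for s t
    unfolding f_def[abs_def] V1_def \<beta>_def by (rule NF(4)) (use that in auto)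
  have G4: "integral {0..t} g - integral {0..s} g \<ge>
      integral {s..t} (\<lambda>x. d * \<bar>U1 x\<bar> powr q * (1 + x) powr (- \<beta> * (q - 1)))" if "0 \<le> s" "s \<le> t" "t < T" for s t
    unfolding g_def[abs_def] U1_def \<beta>_def by (rule NG(4)) (use that in auto)
  have suR: "AE x in lborel. norm x > R + T \<longrightarrow> u t x = 0" if t: "0 \<le> t" "t < T" for t
    using su[OF t] by eventually_elim (use t in auto)
  have svR: "AE x in lborel. norm x > R + T \<longrightarrow> v t x = 0" if t: "0 \<le> t" "t < T" for t
    using sv[OF t] by eventually_elim (use t in auto)
  \<comment> \<open>Data supported in the ball of radius R see only the exponential, so the moment I
    does not depend on the cutoff.\<close>
  have w1: "h x * w x = h x * exp (x \<bullet> e)" if "\<And>x. norm x > R \<Longrightarrow> h x = 0" for h :: "'a \<Rightarrow> real" and x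
    using w_exp[of x] that[of x] T by (cases "norm x \<le> R") auto
  have bint: "set_integrable lborel {0..t} b" for t by (rule set_integrable_subset[OF b(1)]) auto
  have bV: "set_integrable lborel {0..t} (\<lambda>s. b s * V1 s)" if "t < T" for t
    by (rule set_integrable_mult_continuous[OF bint]) (rule continuous_on_subset[OF contV1], use that in auto)
  have both: "U1 t + integral {0..t} (\<lambda>s. 2 * U1 s - U s) = \<epsilon> * (LINT x|lborel. u1 x * w x) + integral {0..t} f \<and>
     V1 t + integral {0..t} (\<lambda>s. V1 s - V s) + integral {0..t} (\<lambda>s. b s * V1 s) = I * \<epsilon> + integral {0..t} g"
    if t: "0 < t" "t < T" for t
  proof -
    obtain \<phi> where phi: "st_test_fun T \<phi>" and ph: "\<forall>s\<le>t. \<forall>x.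
        \<phi> (s, x) = exp (- s) * w x \<and> dt \<phi> (s, x) = - exp (- s) * w x \<and>
        gradx \<phi> (s, x) = (\<Sum>b\<in>Basis. (exp (- s) * dw b x) *\<^sub>R b)"
      using spacetime[OF t(2)] by blast
    have pv: "\<phi> (s, x) = exp (- s) * w x" and pt: "dt \<phi> (s, x) = - exp (- s) * w x"
      and pg: "gradx \<phi> (s, x) = (\<Sum>b\<in>Basis. (exp (- s) * dw b x) *\<^sub>R b)" if "s \<le> t" for s x
      using ph that by auto
    have pull: "(LINT x|lborel. h x * \<phi> (s, x)) = exp (- s) * (LINT x|lborel. h x * w x)" if "s \<le> t" for h s
    proof -
      have "h x * \<phi> (s, x) = exp (- s) * (h x * w x)" for x using pv[OF that, of x] by simp
      then show ?thesis by (simp only: integral_mult_right_zero)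
    qed
    \<comment> \<open>Since \<open>dt \<phi>\<close> is the negative of \<phi>, its term joins the
      damping to give 2 U1; the gradient term gives -U by the Laplace identity of the
      weight.\<close>
    have in1: "(LINT x|lborel. - ut s x * dt \<phi> (s, x) + ut s x * \<phi> (s, x) + gu s x \<bullet> gradx \<phi> (s, x)) = 2 * U1 s - U s"
      if s: "s \<in> {0..t}" for s
    proof -
      have s': "s \<le> t" "0 \<le> s" "s < T" using s t by auto
      have "(LINT x|lborel. - ut s x * dt \<phi> (s, x) + ut s x * \<phi> (s, x) + gu s x \<bullet> gradx \<phi> (s, x))
        = (LINT x|lborel. (2 * exp (- s)) * (ut s x * w x) + gu s x \<bullet> (\<Sum>b\<in>Basis. (exp (- s) * dw b x) *\<^sub>R b))"
        unfolding pv[OF s'(1)] pt[OF s'(1)] pg[OF s'(1)]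
        by (rule Bochner_Integration.integral_cong) (simp_all add: mult_ac)
      also have "\<dots> = (2 * exp (- s)) * (LINT x|lborel. ut s x * w x) - exp (- s) * (LINT x|lborel. u s x * w x)"
        by (rule spacetime_integrand[OF gru suR locut]) (use s' in auto)
      finally show ?thesis by (simp add: U_def U1_def)
    qed
    \<comment> \<open>The same computation, with 1 + b(s) in place of the coefficient 2.\<close>
    have in2: "(LINT x|lborel. - vt s x * dt \<phi> (s, x) + gv s x \<bullet> gradx \<phi> (s, x) + b s * vt s x * \<phi> (s, x))
        = (V1 s - V s) + b s * V1 s"
      if s: "s \<in> {0..t}" for s
    proof -
      have s': "s \<le> t" "0 \<le> s" "s < T" using s t by auto
      have "(LINT x|lborel. - vt s x * dt \<phi> (s, x) + gv s x \<bullet> gradx \<phi> (s, x) + b s * vt s x * \<phi> (s, x))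
        = (LINT x|lborel. ((1 + b s) * exp (- s)) * (vt s x * w x) + gv s x \<bullet> (\<Sum>b\<in>Basis. (exp (- s) * dw b x) *\<^sub>R b))"
        unfolding pv[OF s'(1)] pt[OF s'(1)] pg[OF s'(1)]
        by (rule Bochner_Integration.integral_cong) (simp_all add: algebra_simps)
      also have "\<dots> = ((1 + b s) * exp (- s)) * (LINT x|lborel. vt s x * w x) - exp (- s) * (LINT x|lborel. v s x * w x)"
        by (rule spacetime_integrand[OF grv svR locvt]) (use s' in auto)
      finally show ?thesis by (simp add: V_def V1_def algebra_simps)
    qed
    have 1: "(LINT s:{0..t}|lborel. LINT x|lborel. - ut s x * dt \<phi> (s, x) + ut s x * \<phi> (s, x) + gu s x \<bullet> gradx \<phi> (s, x))
        = integral {0..t} (\<lambda>s. 2 * U1 s - U s)"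
    proof -
      have "(LINT s:{0..t}|lborel. LINT x|lborel. - ut s x * dt \<phi> (s, x) + ut s x * \<phi> (s, x) + gu s x \<bullet> gradx \<phi> (s, x))
        = (LINT s:{0..t}|lborel. 2 * U1 s - U s)" by (rule set_lebesgue_integral_cong) (use in1 in auto)
      also have "\<dots> = integral {0..t} (\<lambda>s. 2 * U1 s - U s)"
        by (rule set_integral_eq_HK[where T=T]) (use t in \<open>auto intro!: continuous_intros contU contU1\<close>)
      finally show ?thesis .
    qed
    have 2: "(LINT s:{0..t}|lborel. LINT x|lborel. - vt s x * dt \<phi> (s, x) + gv s x \<bullet> gradx \<phi> (s, x) + b s * vt s x * \<phi> (s, x))
        = integral {0..t} (\<lambda>s. V1 s - V s) + integral {0..t} (\<lambda>s. b s * V1 s)"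
    proof -
      have cVV: "continuous_on {0..<T} (\<lambda>s. V1 s - V s)" by (intro continuous_intros contV contV1)
      have iVV: "set_integrable lborel {0..t} (\<lambda>s. V1 s - V s)"
        by (rule borel_integrable_atLeastAtMost', rule continuous_on_subset[OF cVV]) (use t in auto)
      have "(LINT s:{0..t}|lborel. LINT x|lborel. - vt s x * dt \<phi> (s, x) + gv s x \<bullet> gradx \<phi> (s, x) + b s * vt s x * \<phi> (s, x))
        = (LINT s:{0..t}|lborel. (V1 s - V s) + b s * V1 s)" by (rule set_lebesgue_integral_cong) (use in2 in auto)
      also have "\<dots> = (LINT s:{0..t}|lborel. V1 s - V s) + (LINT s:{0..t}|lborel. b s * V1 s)"
        by (rule set_integral_add(2)[OF iVV bV[OF t(2)]])
      finally show ?thesis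
        by (simp only: set_borel_integral_eq_integral(2)[OF iVV] set_borel_integral_eq_integral(2)[OF bV[OF t(2)]])
    qed
    have 3: "(LINT s:{0..t}|lborel. LINT x|lborel. \<bar>vt s x\<bar> powr p * \<phi> (s, x)) = integral {0..t} f"
    proof -
      have "(LINT s:{0..t}|lborel. LINT x|lborel. \<bar>vt s x\<bar> powr p * \<phi> (s, x)) = (LINT s:{0..t}|lborel. f s)"
        by (rule set_lebesgue_integral_cong) (use pull in \<open>auto simp: f_def\<close>)
      then show ?thesis using F2[of t] t by simp
    qed
    have 4: "(LINT s:{0..t}|lborel. LINT x|lborel. \<bar>ut s x\<bar> powr q * \<phi> (s, x)) = integral {0..t} g"
    proof -
      have "(LINT s:{0..t}|lborel. LINT x|lborel. \<bar>ut s x\<bar> powr q * \<phi> (s, x)) = (LINT s:{0..t}|lborel. g s)"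
        by (rule set_lebesgue_integral_cong) (use pull in \<open>auto simp: g_def\<close>)
      then show ?thesis using G2[of t] t by simp
    qed
    have 5: "(LINT x|lborel. ut t x * \<phi> (t, x)) = U1 t" "(LINT x|lborel. vt t x * \<phi> (t, x)) = V1 t"
      by (simp_all add: pull U1_def V1_def)
    have 6: "(LINT x|lborel. u1 x * \<phi> (0, x)) = (LINT x|lborel. u1 x * w x)" using pull[of 0 u1] t by simp
    have 7: "(LINT x|lborel. v1 x * \<phi> (0, x)) = I" using pull[of 0 v1] t w1[of v1, OF v1(2)] by (simp add: I)
    show ?thesis
      using weak[rule_format, of t \<phi> \<phi>] t phi unfolding 1 2 3 4 5 6 7 by (simp add: algebra_simps)
  qed
  have intc: "h integrable_on {0..t}" if "continuous_on {0..<T} h" "t < T" for h :: "real \<Rightarrow> real" and t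
    by (rule integrable_continuous_real, rule continuous_on_subset[OF that(1)]) (use that in auto)
  have eqU: "U1 t + integral {0..t} (\<lambda>s. 2 * U1 s - U s) = \<epsilon> * (LINT x|lborel. u1 x * w x) + integral {0..t} f"
    if t: "0 \<le> t" "t < T" for t
  proof (rule continuous_eq_at_0[OF _ _ T _ t])
    show "continuous_on {0..<T} (\<lambda>t. U1 t + integral {0..t} (\<lambda>s. 2 * U1 s - U s))"
      by (intro continuous_intros contU1 continuous_integral intc contU)
    show "continuous_on {0..<T} (\<lambda>t. \<epsilon> * (LINT x|lborel. u1 x * w x) + integral {0..t} f)"
      by (intro continuous_intros F3)
  qed (use both in blast)
  have eqV: "V1 t + integral {0..t} (\<lambda>s. V1 s - V s) + integral {0..t} (\<lambda>s. b s * V1 s) = I * \<epsilon> + integral {0..t} g"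
    if t: "0 \<le> t" "t < T" for t
  proof (rule continuous_eq_at_0[OF _ _ T _ t])
    show "continuous_on {0..<T} (\<lambda>t. V1 t + integral {0..t} (\<lambda>s. V1 s - V s) + integral {0..t} (\<lambda>s. b s * V1 s))"
      by (intro continuous_intros contV1 continuous_integral intc contV set_borel_integral_eq_integral(1)[OF bV])
    show "continuous_on {0..<T} (\<lambda>t. I * \<epsilon> + integral {0..t} g)" by (intro continuous_intros G3)
  qed (use both in blast)
  have init_eq: "(LINT x|lborel. h x * w x) = \<epsilon> * (LINT x|lborel. h0 x * w x)"
    if "loc_L1 h" "loc_L1 h0" "AE x in lborel. h x = \<epsilon> * h0 x" for h h0 :: "'a \<Rightarrow> real"
  proof -
    have i: "integrable lborel (\<lambda>x. h x * w x)" "integrable lborel (\<lambda>x. h0 x * w x)"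
      using loc_L1_mult_weight[OF that(1) cont_w supp_w] loc_L1_mult_weight[OF that(2) cont_w supp_w] by blast+
    have "(LINT x|lborel. h x * w x) = (LINT x|lborel. \<epsilon> * (h0 x * w x))"
    proof (rule integral_cong_AE)
      show "AE x in lborel. h x * w x = \<epsilon> * (h0 x * w x)" using that(3) by eventually_elim simp
    qed (use i in auto)
    then show ?thesis by simp
  qed
  have l0: "loc_L1 (u 0)" "loc_L1 (v 0)" using gru[of 0] grv[of 0] T by (auto simp: weak_grad_def)
  have Ui: "U 0 = \<epsilon> * (LINT x|lborel. u0 x * w x)" using init_eq[OF l0(1) u0(1) init(1)] by (simp add: U_def)
  have Vi: "V 0 = \<epsilon> * (LINT x|lborel. v0 x * w x)" using init_eq[OF l0(2) v0(1) init(2)] by (simp add: V_def)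
  have U0: "U 0 \<ge> 0" unfolding Ui using eps u0(2) w_nonneg by (intro mult_nonneg_nonneg Bochner_Integration.integral_nonneg) auto
  have V0: "V 0 \<ge> 0" unfolding Vi using eps v0(2) w_nonneg by (intro mult_nonneg_nonneg Bochner_Integration.integral_nonneg) auto
  \<comment> \<open>Here \<open>u1 \<ge> u0\<close> enters, as the inequality U(0) \<le> a1 required
    by the damped comparison.\<close>
  have U01: "U 0 \<le> \<epsilon> * (LINT x|lborel. u1 x * w x)"
    unfolding Ui using eps
    by (intro mult_left_mono integral_mono loc_L1_mult_weight[OF _ cont_w supp_w] mult_right_mono u0(1) u1 w_nonneg) auto
  have beta: "\<beta> \<ge> 0" using DIM_positive[where 'a='a] by (simp add: \<beta>_def Suc_leI)
  show ?thesis unfolding c0_def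
    by (rule functionals_coupled_system[OF p q beta d0 I(2) eps b contU contU1 contV contV1 derU derV U0 U01 V0 eqU eqV _ _ G3 F4 G4])
      auto
qed

text \<open>The exponential is positive everywhere, so the moment of a nonnegative function vanishes
  only if the function is zero almost everywhere; the cutoff weight supplies integrability.\<close>

lemma exp_moment_pos:
  fixes h :: "'a::euclidean_space \<Rightarrow> real"
  assumes "loc_L1 h" "\<And>x. h x \<ge> 0" "\<And>x. norm x > R \<Longrightarrow> h x = 0" "\<not> (AE x in lborel. h x = 0)" "R > 0" "e \<in> Basis"
  shows "(LINT x|lborel. h x * exp (x \<bullet> e)) > 0"
proof -
  obtain r w dw ddw where "exp_weight e R r w dw ddw" using exp_weight_exists[OF assms(6,5)] by blast
  then interpret exp_weight e R r w dw ddw .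
  have eq: "h x * w x = h x * exp (x \<bullet> e)" for x
    using w_exp[of x] assms(3)[of x] by (cases "norm x \<le> R") auto
  have "integrable lborel (\<lambda>x. h x * w x)" by (rule loc_L1_mult_weight[OF assms(1) cont_w supp_w])
  then have i: "integrable lborel (\<lambda>x. h x * exp (x \<bullet> e))" unfolding eq .
  have "(LINT x|lborel. h x * exp (x \<bullet> e)) = 0 \<longleftrightarrow> (AE x in lborel. h x * exp (x \<bullet> e) = 0)"
    using assms(2) by (intro integral_nonneg_eq_0_iff_AE[OF i]) auto
  then have "(LINT x|lborel. h x * exp (x \<bullet> e)) \<noteq> 0" using assms(4) by simp
  moreover have "(LINT x|lborel. h x * exp (x \<bullet> e)) \<ge> 0" using assms(2) by (intro Bochner_Integration.integral_nonneg) auto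
  ultimately show ?thesis by simp
qed

text \<open>The constant C is obtained from v1, b and the parameters alone, before u0, u1 and v0 are
  given, and \<epsilon>0 = 1 suffices because smallness is used only in the form \<epsilon> \<le>
  1.\<close>

theorem theorem2:
  fixes b :: "real \<Rightarrow> real" and p q R :: real and v1 :: "real^'n \<Rightarrow> real"
  assumes "p > 1" and "q > 1" and "R > 0"
    and "set_integrable lborel {0..} b" and "\<forall>t\<ge>0. b t \<ge> 0"
    and "loc_L1 v1" and "\<forall>x. v1 x \<ge> 0" and "\<forall>x. norm x > R \<longrightarrow> v1 x = 0"
    and "\<not> (AE x in lborel. v1 x = 0)"
    and "Theta CARD('n) p q \<ge> 0"
  shows "\<exists>\<epsilon>0>0. \<forall>u0 u1 v0 :: real^'n \<Rightarrow> real.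
           W11_loc u0 \<and> W11_loc v0 \<and> loc_L1 u1 \<and>
           (\<forall>x. u0 x \<ge> 0 \<and> u1 x \<ge> 0 \<and> v0 x \<ge> 0) \<and>
           (\<forall>x. norm x > R \<longrightarrow> u0 x = 0 \<and> u1 x = 0 \<and> v0 x = 0) \<and>
           (\<forall>x. u1 x \<ge> u0 x) \<longrightarrow>
           (\<exists>C>0. \<forall>\<epsilon>\<in>{0<..\<epsilon>0}. \<forall>T u v.
              weak_solution b p q \<epsilon> u0 u1 v0 v1 R T u v \<longrightarrow>
              T \<le> (if Theta CARD('n) p q > 0
                    then C * \<epsilon> powr (- 1 / Theta CARD('n) p q)
                    else exp (C * \<epsilon> powr (- (p * q - 1)))))"
proof -
  obtain e :: "real^'n" where e: "e \<in> Basis" using nonempty_Basis by blast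
  define \<beta> where "\<beta> = (real DIM(real^'n) - 1) / 2"
  have beta: "\<beta> = (real CARD('n) - 1) / 2" by (simp add: \<beta>_def)
  have beta0: "\<beta> \<ge> 0" using DIM_positive[where 'a="real^'n"] by (simp add: \<beta>_def Suc_leI del: DIM_cart)
  define D where "D = 2 * exp R * (4 * pi * max 1 R) powr \<beta>"
  define d where "d = min (D powr (- (p - 1))) (D powr (- (q - 1)))"
  define c0 where "c0 = 1 / 4 * exp (- 4 * integral {0..} b)"
  define c where "c = min d (c0 powr p * d)"
  define I where "I = (LINT x|lborel. v1 x * exp (x \<bullet> e))"
  have I: "I > 0" unfolding I_def by (rule exp_moment_pos[where R=R]) (use assms e in auto)
  have "D > 0" using assms(3) by (simp add: D_def)
  then have c: "c > 0" by (simp add: c_def d_def c0_def)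
  define r where "r = p * q - 1"
  have r: "r > 0" using assms(1,2) by (simp add: r_def less_1_mult)
  \<comment> \<open>With \<beta> = (n-1)/2 and r = pq - 1 one has r \<Theta> = 1 - \<beta> r: the
    sign of \<Theta> decides between the power and the exponential, and 1/\<Theta> is the exponent
    r/(1 - \<beta> r).\<close>
  have Th: "Theta CARD('n) p q = (1 - \<beta> * r) / r"
    using r by (simp add: Theta_def r_def[symmetric] beta field_simps)
  have a: "\<beta> * r \<le> 1" using assms(10) r unfolding Th by (simp add: zero_le_divide_iff)
  have mu: "2 + (sqrt 5 - 1) / 2 > (0::real)" by (intro add_pos_nonneg) auto
  obtain C where C: "C > 0" and life: "\<And>T \<epsilon> W W' X X'. coupled_system p q \<beta> c (2 + (sqrt 5 - 1) / 2) I T \<epsilon> W W' X X' \<Longrightarrow>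
     T \<le> (if \<beta> * r < 1 then C * \<epsilon> powr (- r / (1 - \<beta> * r)) else exp (C * \<epsilon> powr (- r)))"
    using coupled_system_lifespan[OF assms(1,2) beta0 c mu I] a unfolding r_def by blast
  have bound: "T \<le> (if Theta CARD('n) p q > 0
                    then C * \<epsilon> powr (- 1 / Theta CARD('n) p q)
                    else exp (C * \<epsilon> powr (- (p * q - 1))))"
    if data: "W11_loc u0" "W11_loc v0" "loc_L1 u1" "\<forall>x. u0 x \<ge> 0 \<and> u1 x \<ge> 0 \<and> v0 x \<ge> 0"
      "\<forall>x. norm x > R \<longrightarrow> u0 x = 0 \<and> u1 x = 0 \<and> v0 x = 0" "\<forall>x. u1 x \<ge> u0 x"
      and eps: "0 < \<epsilon>" "\<epsilon> \<le> 1" and sol: "weak_solution b p q \<epsilon> u0 u1 v0 v1 R T u v"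
    for u0 u1 v0 :: "real^'n \<Rightarrow> real" and \<epsilon> T u v
  \<comment> \<open>For T \<le> 0 the bound holds because its right side is positive; the averaging
    argument works on a nontrivial time interval.\<close>
  proof (cases "T > 0")
    case False
    moreover have "(if Theta CARD('n) p q > 0 then C * \<epsilon> powr (- 1 / Theta CARD('n) p q)
        else exp (C * \<epsilon> powr (- (p * q - 1)))) > 0" using C eps by simp
    ultimately show ?thesis by linarith
  next
    case True
    have "\<exists>W W' X X'. coupled_system p q \<beta> c (2 + (sqrt 5 - 1) / 2) I T \<epsilon> W W' X X'"
      unfolding c_def d_def c0_def D_def \<beta>_def
      by (rule weak_solution_coupled_system[OF e assms(1-4) _ assms(6) _ I_def I _ _ _ data(3) _ _ _ _ eps True sol])
        (use assms data in \<open>auto simp: W11_loc_def weak_grad_def\<close>)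
    then have *: "T \<le> (if \<beta> * r < 1 then C * \<epsilon> powr (- r / (1 - \<beta> * r)) else exp (C * \<epsilon> powr (- r)))"
      using life by blast
    have "Theta CARD('n) p q > 0 \<longleftrightarrow> \<beta> * r < 1" unfolding Th using r by (simp add: zero_less_divide_iff)
    moreover have "- 1 / Theta CARD('n) p q = - r / (1 - \<beta> * r)" unfolding Th by simp
    ultimately show ?thesis using * by (simp only: r_def[symmetric])
  qed
  show ?thesis
    by (intro exI[of _ 1] conjI allI impI exI[of _ C] ballI C) (use bound in auto)
qed

end
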